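(* Let $\mathbb S^m(k)$ denote the round $m$-sphere of constant sectional curvature $k$. The Riemannian product $\mathbb S^2(3)\times\mathbb S^2(3)\times\mathbb S^4(1)$ (an $8$-manifold) is Einstein but not higher Bach-flat; that is, its tensor $$\mathcal B^{(2)}_{ab}=\Big(R^{\,i_1i_2j_1j_2}\,\nabla^\ell\nabla^k-\frac16\,(cR_4)^{\,i_1i_2k\,j_1j_2\ell}\Big)(K_4)_{a j_1j_2\ell\,b i_1i_2k}$$ is not identically zero.
   Context: Curvature convention: $R(X,Y,Z,W)=g(\nabla_X\nabla_YZ-\nabla_Y\nabla_XZ-\nabla_{[X,Y]}Z,\,W)$, so $R(e_i,e_j,e_i,e_j)=-1$ for orthonormal $e_i,e_j$ on the unit round sphere. Thorpe's fourth curvature tensor is $$R_4(u_1,\dots,u_4,v_1,\dots,v_4)=\frac{1}{4\cdot 4!}\sum_{\sigma,\tau\in S_4}\mathrm{sgn}(\sigma)\,\mathrm{sgn}(\tau)\,R(u_{\sigma(1)},u_{\sigma(2)},v_{\tau(1)},v_{\tau(2)})\,R(u_{\sigma(3)},u_{\sigma(4)},v_{\tau(3)},v_{\tau(4)}).$$ Let $\mathscr C_p(V)$ be the space of tensors in $\Lambda^pV^*\otimes\Lambda^pV^*$ that are symmetric under interchange of the two factors and satisfy $T_{[i_1\ldots i_pj_1]j_2\ldots j_p}=0$ ($\mathscr C_0(V)=\mathbb R$). Contraction $c:\mathscr C_p\to\mathscr C_{p-1}$ is $(cT)(u_1,\dots,u_{p-1},v_1,\dots,v_{p-1})=\sum_iT(e_i,u_1,\dots,u_{p-1},e_i,v_1,\dots,v_{p-1})$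 with $\{e_i\}$ an orthonormal basis. Metric insertion $\mathsf G:\mathscr C_p\to\mathscr C_{p+1}$ is $$(\mathsf GT)(u_1,\dots,u_{p+1},v_1,\dots,v_{p+1})=\sum_{i,j=1}^{p+1}(-1)^{i+j}g(u_i,v_j)\,T(u_1,\dots,\hat u_i,\dots,u_{p+1},v_1,\dots,\hat v_j,\dots,v_{p+1}).$$ In dimension $8$, the Thorpe--Kulkarni tensor $K_4$ is the orthogonal projection of $R_4\in\mathscr C_4$ onto $\ker c\subset\mathscr C_4$; explicitly $K_4=\sum_{r=0}^{4}\frac{(-1)^r}{r!(r+1)!}\mathsf G^rc^rR_4$. All repeated indices are summed over their full range and contracted with $g$; in each tensor, the first half of the indices forms the first alternating block and the second half the second block. $\nabla$ is the Levi-Civita connection, and the derivatives $\nabla^\ell\nabla^k$ act on $K_4$. (This $\mathcal B^{(2)}$ is the case $n=2$ of the higher Bach tensor, which is, up to a nonzero universal constant, the metric gradient of $g\mapsto\int_M|\hat K_{4}|^2\,dV_g$ on closed oriented $8$-manifolds, where $\hat K_4$ is the self-adjoint operator on $\Lambda^4$ defined by $K_4$ and $|\hat K_4|^2=\mathrm{tr}(\hat K_4^2)$.) *)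

theory Defs
  imports "HOL-Analysis.Analysis"
begin

primrec times_differentiable_on ::
  "nat \<Rightarrow> 'a::euclidean_space set \<Rightarrow> ('a \<Rightarrow> 'b::euclidean_space) \<Rightarrow> bool" where
  "times_differentiable_on 0 U f \<longleftrightarrow> continuous_on U f"
| "times_differentiable_on (Suc k) U f \<longleftrightarrow> f differentiable_on U \<and>
     (\<forall>v. times_differentiable_on k U (\<lambda>x. frechet_derivative f (at x) v))"

definition smooth_on :: "'a::euclidean_space set \<Rightarrow> ('a \<Rightarrow> 'b::euclidean_space) \<Rightarrow> bool" where
  "smooth_on U f \<longleftrightarrow> (\<forall>k. times_differentiable_on k U f)"

text \<open>\<open>(U, f)\<close> is the inverse of a chart of \<open>M\<close>, defined on an open subset of the model space \<open>'m\<close>.\<close>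

definition local_param ::
  "'e::euclidean_space set \<Rightarrow> 'm::euclidean_space set \<Rightarrow> ('m \<Rightarrow> 'e) \<Rightarrow> bool" where
  "local_param M U f \<longleftrightarrow>
     open U \<and> smooth_on U f \<and> (\<forall>x\<in>U. inj (frechet_derivative f (at x))) \<and>
     openin (top_of_set M) (f ` U) \<and> (\<exists>h. homeomorphism U (f ` U) f h)"

definition submanifold :: "'m::euclidean_space itself \<Rightarrow> 'e::euclidean_space set \<Rightarrow> bool" where
  "submanifold (_ :: 'm itself) M \<longleftrightarrow>
     (\<forall>p\<in>M. \<exists>(U :: 'm set) f. local_param M U f \<and> p \<in> f ` U)"

text \<open>
  A metric on (an open subset of) the model space is a function \<open>g\<close> with \<open>g x\<close> the
  inner product on the tangent space at \<open>x\<close>. A submanifold always carries the metric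
  induced from the ambient space; for a Cartesian product of submanifolds, in the
  product of the ambient Euclidean spaces, this is the Riemannian product metric.
\<close>

type_synonym 'm metric = "'m \<Rightarrow> 'm \<Rightarrow> 'm \<Rightarrow> real"

definition induced_metric :: "('m::euclidean_space \<Rightarrow> 'e::euclidean_space) \<Rightarrow> 'm metric" where
  "induced_metric f x u v = frechet_derivative f (at x) u \<bullet> frechet_derivative f (at x) v"

text \<open>The sphere of dimension \<open>DIM('e) - 1\<close> and constant sectional curvature \<open>k > 0\<close>.\<close>

definition round_sphere :: "real \<Rightarrow> 'e::euclidean_space set" where
  "round_sphere k = sphere 0 (1 / sqrt k)"

text \<open>The vector field \<open>\<nabla>\<^bsub>u\<^esub> v\<close> for constant (coordinate) fields \<open>u\<close> and \<open>v\<close>, given by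
  the Koszul formula.\<close>

definition christoffel :: "'m::euclidean_space metric \<Rightarrow> 'm \<Rightarrow> 'm \<Rightarrow> 'm \<Rightarrow> 'm" where
  "christoffel g x u v = (THE z. \<forall>w. 2 * g x z w =
       frechet_derivative (\<lambda>y. g y v w) (at x) u
     + frechet_derivative (\<lambda>y. g y u w) (at x) v
     - frechet_derivative (\<lambda>y. g y u v) (at x) w)"

definition nabla_field ::
  "'m::euclidean_space metric \<Rightarrow> ('m \<Rightarrow> 'm) \<Rightarrow> ('m \<Rightarrow> 'm) \<Rightarrow> 'm \<Rightarrow> 'm" where
  "nabla_field g X Z x = frechet_derivative Z (at x) (X x) + christoffel g x (X x) (Z x)"

definition lie_bracket :: "('m::euclidean_space \<Rightarrow> 'm) \<Rightarrow> ('m \<Rightarrow> 'm) \<Rightarrow> 'm \<Rightarrow> 'm" where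
  "lie_bracket X Y x = frechet_derivative Y (at x) (X x) - frechet_derivative X (at x) (Y x)"

definition curvature_field ::
  "'m::euclidean_space metric \<Rightarrow> ('m \<Rightarrow> 'm) \<Rightarrow> ('m \<Rightarrow> 'm) \<Rightarrow> ('m \<Rightarrow> 'm) \<Rightarrow> 'm \<Rightarrow> 'm" where
  "curvature_field g X Y Z x =
     nabla_field g X (nabla_field g Y Z) x - nabla_field g Y (nabla_field g X Z) x
     - nabla_field g (lie_bracket X Y) Z x"

text \<open>By tensoriality the curvature at a point may be computed with constant extensions
  of the arguments. Sign: \<open>Rm g x u v u v = -1\<close> for orthonormal \<open>u\<close>, \<open>v\<close> on the unit sphere.\<close>

definition Rm :: "'m::euclidean_space metric \<Rightarrow> 'm \<Rightarrow> 'm \<Rightarrow> 'm \<Rightarrow> 'm \<Rightarrow> 'm \<Rightarrow> real" where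
  "Rm g x u v w z = g x (curvature_field g (\<lambda>_. u) (\<lambda>_. v) (\<lambda>_. w) x) z"

text \<open>An arbitrary orthonormal basis for an inner product \<open>h\<close>. It is only used to form
  contractions, which do not depend on the choice.\<close>

definition onb :: "('m::euclidean_space \<Rightarrow> 'm \<Rightarrow> real) \<Rightarrow> 'm set" where
  "onb h = (SOME B. card B = DIM('m) \<and> (\<forall>u\<in>B. \<forall>v\<in>B. h u v = (if u = v then 1 else 0)))"

text \<open>With the sign convention of \<open>Rm\<close>, round spheres have positive Ricci curvature.\<close>

definition Ric :: "'m::euclidean_space metric \<Rightarrow> 'm \<Rightarrow> 'm \<Rightarrow> 'm \<Rightarrow> real" where
  "Ric g x u v = (\<Sum>e\<in>onb (g x). Rm g x e u v e)"

definition einstein :: "'m::euclidean_space itself \<Rightarrow> 'e::euclidean_space set \<Rightarrow> bool" where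
  "einstein (_ :: 'm itself) M \<longleftrightarrow>
     (\<exists>c::real. \<forall>(U :: 'm set) f. local_param M U f \<longrightarrow>
        (\<forall>x\<in>U. \<forall>u v. Ric (induced_metric f) x u v = c * induced_metric f x u v))"

text \<open>
  A tensor field is a function of a point and the list of its arguments;
  \<open>covd g T\<close> puts the direction of differentiation first, so that
  \<open>covd g (covd g T) x (u # v # ws)\<close> is \<open>(\<nabla>\<^bsub>u\<^esub>\<nabla>\<^bsub>v\<^esub> T)(ws)\<close>, the second covariant
  derivative with \<open>u\<close> the outer direction. The arguments are extended as constant fields.
\<close>

primrec covd ::
  "'m::euclidean_space metric \<Rightarrow> ('m \<Rightarrow> 'm list \<Rightarrow> real) \<Rightarrow> 'm \<Rightarrow> 'm list \<Rightarrow> real" where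
  "covd g T x [] = 0"
| "covd g T x (v # ws) = frechet_derivative (\<lambda>y. T y ws) (at x) v
     - (\<Sum>s<length ws. T x (ws[s := christoffel g x v (ws ! s)]))"

text \<open>Double forms at a point: the two alternating blocks are given as two lists of
  vectors. Indices of list entries start at 0, which does not affect the signs.\<close>

type_synonym 'm double_form = "'m list \<Rightarrow> 'm list \<Rightarrow> real"

definition contraction ::
  "('m::euclidean_space \<Rightarrow> 'm \<Rightarrow> real) \<Rightarrow> 'm double_form \<Rightarrow> 'm double_form" where
  "contraction h T us vs = (\<Sum>e\<in>onb h. T (e # us) (e # vs))"

definition omit :: "nat \<Rightarrow> 'a list \<Rightarrow> 'a list" where
  "omit i xs = take i xs @ drop (Suc i) xs"

definition insertion :: "('m \<Rightarrow> 'm \<Rightarrow> real) \<Rightarrow> 'm double_form \<Rightarrow> 'm double_form" where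
  "insertion h T us vs = (\<Sum>i<length us. \<Sum>j<length vs.
     (-1) ^ (i + j) * h (us ! i) (vs ! j) * T (omit i us) (omit j vs))"

definition R4 :: "'m::euclidean_space metric \<Rightarrow> 'm \<Rightarrow> 'm double_form" where
  "R4 g x us vs = 1 / (4 * fact 4) *
     (\<Sum>\<sigma> | \<sigma> permutes {..<4::nat}. \<Sum>\<tau> | \<tau> permutes {..<4::nat}.
        of_int (sign \<sigma>) * of_int (sign \<tau>) *
        Rm g x (us ! \<sigma> 0) (us ! \<sigma> 1) (vs ! \<tau> 0) (vs ! \<tau> 1) *
        Rm g x (us ! \<sigma> 2) (us ! \<sigma> 3) (vs ! \<tau> 2) (vs ! \<tau> 3))"

text \<open>In dimension 8 this is the orthogonal projection of \<open>R4\<close> onto the kernel of the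
  contraction.\<close>

definition K4 :: "'m::euclidean_space metric \<Rightarrow> 'm \<Rightarrow> 'm double_form" where
  "K4 g x us vs = (\<Sum>r\<le>4. (-1) ^ r / (fact r * fact (r + 1)) *
     (insertion (g x) ^^ r) ((contraction (g x) ^^ r) (R4 g x)) us vs)"

definition K4_field :: "'m::euclidean_space metric \<Rightarrow> 'm \<Rightarrow> 'm list \<Rightarrow> real" where
  "K4_field g x ws = K4 g x (take 4 ws) (drop 4 ws)"

text \<open>Raised indices are contracted using an orthonormal basis.\<close>

definition higher_bach :: "'m::euclidean_space metric \<Rightarrow> 'm \<Rightarrow> 'm \<Rightarrow> 'm \<Rightarrow> real" where
  "higher_bach g x a b = (let E = onb (g x) in
     \<Sum>i1\<in>E. \<Sum>i2\<in>E. \<Sum>j1\<in>E. \<Sum>j2\<in>E. \<Sum>k\<in>E. \<Sum>l\<in>E.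
       Rm g x i1 i2 j1 j2 * covd g (covd g (K4_field g)) x [l, k, a, j1, j2, l, b, i1, i2, k]
       - 1 / 6 * contraction (g x) (R4 g x) [i1, i2, k] [j1, j2, l]
           * K4_field g x [a, j1, j2, l, b, i1, i2, k])"

definition higher_bach_flat :: "'m::euclidean_space itself \<Rightarrow> 'e::euclidean_space set \<Rightarrow> bool" where
  "higher_bach_flat (_ :: 'm itself) M \<longleftrightarrow>
     (\<forall>(U :: 'm set) f. local_param M U f \<longrightarrow>
        (\<forall>x\<in>U. \<forall>a b. higher_bach (induced_metric f) x a b = 0))"

end

(* Let M be a product of round spheres and let g_0, g_1, g_2 be the (parallel) metrics of the
   factors, pulled back to M. By the Gauss equation the curvature of M is a constant coefficient
   polynomial in the g_a, and so are R_4, its contractions and K_4. Every such double form of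
   degree p is a sum, over all lists of p labels, of coefficients times determinants whose rows are
   built from the g_a named by the labels. In terms of the coefficients C,
     contraction:  (cC)(as) = sum_a (n_a - number of a in as) * C(a # as),   n_a = dim of factor a,
     insertion:    (GC)(as) = sum_i C(as without its i-th label),
   which makes K_4 computable. Since it is parallel, the Hessian term of the Bach tensor drops out,
   and the remaining full contraction is sum_a c_a g_a with c_0 = -72/5 for S^2(3) x S^2(3) x S^4(1). *)

theory Submission
  imports Defs
begin

section \<open>Determinants with labelled rows\<close>

text \<open>Two obstacles shape the proof. First, contractions use a frame picked by a choice
  operator: it is orthonormal for the whole metric but need not split along the factors, so
  components cannot be read off factor by factor. What any such frame still gives is the trace of
  each g_a and the rule that sum_e g_a(u,e) g_b(e,v) is g_a(u,v) for a = b and 0 otherwise. These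
  alone yield the contraction rule: the entry where the new row meets the new column has trace n_a,
  and each row that already carries the label a returns the old determinant with a minus sign.
  Second, the geometry is defined through arbitrary charts, with \<open>christoffel\<close> as a
  definite description and curvature through total Frechet derivatives. Christoffel fields must
  therefore be identified by the Gauss formula and shown differentiable before curvature can be
  computed. Flatness quantifies over charts, so refuting it also takes an actual chart, a graph over
  a tangent space. Only c_0 is evaluated: pairing the Bach tensor with g_0 isolates it.\<close>

lemma length_omit [simp]: "i < length xs \<Longrightarrow> length (omit i xs) = length xs - 1"
  by (simp add: omit_def)

lemma omit_0 [simp]: "omit 0 (x # xs) = xs"
  by (simp add: omit_def)

lemma omit_Suc [simp]: "omit (Suc i) (x # xs) = x # omit i xs"
  by (simp add: omit_def)

lemma nth_omit:
  "j < length xs \<Longrightarrow> l < length xs - 1 \<Longrightarrow> omit j xs ! l = xs ! (if l < j then l else Suc l)"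
  by (auto simp: omit_def nth_append min_def)

lemma omit_omit:
  "l < m \<Longrightarrow> m < length xs \<Longrightarrow> omit l (omit m xs) = omit (m - 1) (omit l xs)"
  by (rule nth_equalityI) (auto simp: nth_omit)

text \<open>The pair (j, l) removes entry j and then entry l of the shortened list. Removing the
  same two entries in the opposite order shifts one of the two positions by one, hence the extra
  sign. This is the antisymmetry behind exchanging two rows of a determinant.\<close>

lemma omit_swap_sum:
  fixes H :: "'a \<Rightarrow> 'a \<Rightarrow> 'a list \<Rightarrow> 'b::comm_ring_1"
  assumes "length xs = Suc (Suc n)"
  shows "(\<Sum>j<Suc (Suc n). \<Sum>l<Suc n. (-1) ^ (j + l) * H (xs ! j) (omit j xs ! l) (omit l (omit j
      xs)))
       = (\<Sum>j<Suc (Suc n). \<Sum>l<Suc n. (-1) ^ Suc (j + l) * H (omit j xs ! l) (xs ! j) (omit l (omit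
           j xs)))"
proof -
  \<comment> \<open>The involution that exchanges the order of the two removals.\<close>
  define t :: "nat \<times> nat \<Rightarrow> nat \<times> nat"
    where "t = (\<lambda>(j, l). if l < j then (l, j - 1) else (Suc l, j))"
  let ?S = "{..<Suc (Suc n)} \<times> {..<Suc n}"
  have *: "(\<Sum>(j, l)\<in>?S. (-1) ^ (j + l) * H (xs ! j) (omit j xs ! l) (omit l (omit j xs)))
       = (\<Sum>(j, l)\<in>?S. (-1) ^ Suc (j + l) * H (omit j xs ! l) (xs ! j) (omit l (omit j xs)))"
  proof (rule sum.reindex_bij_witness[where i = t and j = t])
    fix p assume p: "p \<in> ?S"
    obtain j l where jl: "p = (j, l)" by (cases p)
    show "t (t p) = p" using p by (auto simp: t_def jl split: if_splits)
    show "t (t p) = p" using p by (auto simp: t_def jl split: if_splits)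
    show "t p \<in> ?S" using p by (auto simp: t_def jl)
    show "t p \<in> ?S" using p by (auto simp: t_def jl)
    show "(case t p of (j, l) \<Rightarrow> (-1) ^ Suc (j + l) * H (omit j xs ! l) (xs ! j) (omit l (omit j
        xs)))
        = (case p of (j, l) \<Rightarrow> (-1) ^ (j + l) * H (xs ! j) (omit j xs ! l) (omit l (omit j xs)))"
    proof (cases "l < j")
      case True
      moreover obtain j' where "j = Suc j'" using True by (cases j) auto
      ultimately show ?thesis using p assms
        by (auto simp: t_def jl nth_omit omit_omit add.commute)
    next
      case False
      then show ?thesis using p assms omit_omit[of j "Suc l" xs]
        by (auto simp: t_def jl nth_omit add.commute)
    qed
  qed
  then show ?thesis by (simp only: sum.cartesian_product)
qed

text \<open>The determinant of the matrix with entries \<open>b (\<alpha>s ! i) (us ! i) (vs ! j)\<close>, expanded along its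
  first row: each row carries a label that selects one of the bilinear forms \<open>b \<alpha>\<close>.\<close>

primrec mdet :: "(nat \<Rightarrow> 'm \<Rightarrow> 'm \<Rightarrow> real) \<Rightarrow> nat list \<Rightarrow> 'm double_form" where
  "mdet b [] us vs = 1"
| "mdet b (\<alpha> # \<alpha>s) us vs =
     (\<Sum>j<length vs. (-1) ^ j * b \<alpha> (hd us) (vs ! j) * mdet b \<alpha>s (tl us) (omit j vs))"

text \<open>The recursion runs along rows. Splitting off the term in which the first row meets the
  first column leaves minors that still have \<open>v\<close> in front, so induction on the rows
  applies to them.\<close>

lemma mdet_column:
  assumes "length \<alpha>s = Suc (length vs)" "length us = length \<alpha>s"
  shows "mdet b \<alpha>s us (v # vs) =
    (\<Sum>i<length us. (-1) ^ i * b (\<alpha>s ! i) (us ! i) v * mdet b (omit i \<alpha>s) (omit i us) vs)"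
  using assms
proof (induction \<alpha>s arbitrary: us vs)
  case (Cons \<alpha> \<alpha>s)
  then obtain u us' where us: "us = u # us'" by (cases us) auto
  have IH: "mdet b \<alpha>s us' (v # omit j vs) = (\<Sum>i<length us'. (-1) ^ i * b (\<alpha>s ! i) (us' ! i) v *
      mdet b (omit i \<alpha>s) (omit i us') (omit j vs))" if "j < length vs" for j
    using that Cons.prems by (intro Cons.IH) (auto simp: us)
  have "mdet b (\<alpha> # \<alpha>s) us (v # vs) = b \<alpha> u v * mdet b \<alpha>s us' vs +
     (\<Sum>j<length vs. \<Sum>i<length us'. (-1) ^ Suc j * b \<alpha> u (vs ! j) * ((-1) ^ i *
        b (\<alpha>s ! i) (us' ! i) v * mdet b (omit i \<alpha>s) (omit i us') (omit j vs)))"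
    by (simp add: us sum.lessThan_Suc_shift IH sum_distrib_left sum_negf del: sum.lessThan_Suc)
  also have "\<dots> = (\<Sum>i<length us. (-1) ^ i * b ((\<alpha> # \<alpha>s) ! i) (us ! i) v *
      mdet b (omit i (\<alpha> # \<alpha>s)) (omit i us) vs)"
    by (subst sum.swap)
      (simp add: us sum.lessThan_Suc_shift sum_distrib_left mult_ac sum_negf del: sum.lessThan_Suc)
  finally show ?case .
qed simp

text \<open>Expand along the first row and then along row i of the minors. Exchanging the two column
  removals by \<open>omit_swap_sum\<close> costs one sign, which turns (-1)^i into
  (-1)^(i+1).\<close>

lemma mdet_row:
  assumes "length us = length \<alpha>s" "length vs = length \<alpha>s" "i < length \<alpha>s"
  shows "mdet b \<alpha>s us vs = (\<Sum>j<length vs. (-1) ^ (i + j) * b (\<alpha>s ! i) (us ! i) (vs ! j) *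
           mdet b (omit i \<alpha>s) (omit i us) (omit j vs))"
  using assms
proof (induction i arbitrary: \<alpha>s us vs)
  case 0
  then show ?case by (cases \<alpha>s; cases us) auto
next
  case (Suc i)
  obtain \<alpha> \<alpha>s' u us' where eq: "\<alpha>s = \<alpha> # \<alpha>s'" "us = u # us'"
    using Suc.prems by (cases \<alpha>s; cases us) auto
  obtain n where n: "length vs = Suc (Suc n)"
    using Suc.prems eq by (cases vs; cases "tl vs") auto
  have IH: "mdet b \<alpha>s' us' (omit j vs) = (\<Sum>l<Suc n. (-1) ^ (i + l) * b (\<alpha>s' ! i) (us' ! i) (omit j
      vs ! l) *
      mdet b (omit i \<alpha>s') (omit i us') (omit l (omit j vs)))" if "j < Suc (Suc n)" for j
    using that Suc.prems Suc.IH[of us' \<alpha>s' "omit j vs"] n by (simp add: eq del: sum.lessThan_Suc)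
  let ?H = "\<lambda>v w ws. b \<alpha> u v * b (\<alpha>s' ! i) (us' ! i) w * mdet b (omit i \<alpha>s') (omit i us') ws"
  have "mdet b \<alpha>s us vs = (-1) ^ i * (\<Sum>j<Suc (Suc n). \<Sum>l<Suc n. (-1) ^ (j + l) *
      ?H (vs ! j) (omit j vs ! l) (omit l (omit j vs)))"
    by (simp add: eq n IH sum_distrib_left power_add mult_ac del: sum.lessThan_Suc)
  also have "\<dots> = (-1) ^ i * (\<Sum>j<Suc (Suc n). \<Sum>l<Suc n. (-1) ^ Suc (j + l) *
      ?H (omit j vs ! l) (vs ! j) (omit l (omit j vs)))"
    by (subst omit_swap_sum[OF n]) simp
  also have "\<dots> = (\<Sum>j<length vs. (-1) ^ (Suc i + j) * b (\<alpha>s ! Suc i) (us ! Suc i) (vs ! j) *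
           mdet b (omit (Suc i) \<alpha>s) (omit (Suc i) us) (omit j vs))"
    by (simp add: eq n sum_distrib_left power_add mult_ac sum_negf del: sum.lessThan_Suc)
  finally show ?case .
qed

text \<open>What contractions need to know of an orthonormal frame \<open>E\<close> when the metric \<open>\<Sum>\<alpha><m. b \<alpha>\<close> splits
  orthogonally into summands of ranks \<open>n \<alpha>\<close>; \<open>E\<close> itself need not be adapted to the splitting.\<close>

definition adapted_frame :: "nat \<Rightarrow> (nat \<Rightarrow> 'm \<Rightarrow> 'm \<Rightarrow> real) \<Rightarrow> (nat \<Rightarrow> real) \<Rightarrow> 'm set \<Rightarrow> bool" where
  "adapted_frame m b n E \<longleftrightarrow> (\<forall>\<alpha><m. (\<Sum>e\<in>E. b \<alpha> e e) = n \<alpha>) \<and>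
     (\<forall>\<alpha><m. \<forall>\<beta><m. \<forall>u v. (\<Sum>e\<in>E. b \<alpha> u e * b \<beta> e v) = (if \<alpha> = \<beta> then b \<alpha> u v else 0))"

text \<open>Expand along the new first row. Its own column contributes the trace n \<alpha>. Any
  other column j leaves a minor whose first column is filled with e; summing over e keeps only the
  rows labelled \<alpha> and puts \<open>vs ! j\<close> in place of e.\<close>

lemma sum_mdet_Cons:
  assumes E: "adapted_frame m b n E" and m: "\<alpha> < m" "set \<alpha>s \<subseteq> {..<m}"
    and len: "length us = length \<alpha>s" "length vs = length \<alpha>s"
  shows "(\<Sum>e\<in>E. mdet b (\<alpha> # \<alpha>s) (e # us) (e # vs)) =
    (n \<alpha> - real (count_list \<alpha>s \<alpha>)) * mdet b \<alpha>s us vs"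
proof -
  have 1: "(-1) ^ Suc j * (\<Sum>e\<in>E. b \<alpha> e (vs ! j) * mdet b \<alpha>s us (e # omit j vs)) =
    - (\<Sum>i<length us. if \<alpha>s ! i = \<alpha> then (-1) ^ (i + j) * b (\<alpha>s ! i) (us ! i) (vs ! j) *
         mdet b (omit i \<alpha>s) (omit i us) (omit j vs) else 0)" if j: "j < length vs" for j
  proof -
    have "(\<Sum>e\<in>E. b \<alpha> e (vs ! j) * mdet b \<alpha>s us (e # omit j vs)) =
      (\<Sum>e\<in>E. \<Sum>i<length us. b \<alpha> e (vs ! j) * ((-1) ^ i * b (\<alpha>s ! i) (us ! i) e *
         mdet b (omit i \<alpha>s) (omit i us) (omit j vs)))"
      using j len by (subst mdet_column) (auto simp: sum_distrib_left)
    also have "\<dots> = (\<Sum>i<length us. \<Sum>e\<in>E. b \<alpha> e (vs ! j) * ((-1) ^ i * b (\<alpha>s ! i) (us ! i) e *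
         mdet b (omit i \<alpha>s) (omit i us) (omit j vs)))"
      by (rule sum.swap)
    also have "\<dots> = (\<Sum>i<length us. (\<Sum>e\<in>E. b (\<alpha>s ! i) (us ! i) e * b \<alpha> e (vs ! j)) * ((-1) ^ i *
         mdet b (omit i \<alpha>s) (omit i us) (omit j vs)))"
      by (simp add: sum_distrib_left sum_distrib_right mult_ac)
    also have "\<dots> = (\<Sum>i<length us. if \<alpha>s ! i = \<alpha> then b (\<alpha>s ! i) (us ! i) (vs ! j) * ((-1) ^ i *
         mdet b (omit i \<alpha>s) (omit i us) (omit j vs)) else 0)"
    proof (intro sum.cong refl)
      fix i assume i: "i \<in> {..<length us}"
      then have "\<alpha>s ! i \<in> set \<alpha>s" using len by auto
      then have "\<alpha>s ! i < m" using m by auto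
      then show "(\<Sum>e\<in>E. b (\<alpha>s ! i) (us ! i) e * b \<alpha> e (vs ! j)) * ((-1) ^ i *
         mdet b (omit i \<alpha>s) (omit i us) (omit j vs)) = (if \<alpha>s ! i = \<alpha> then b (\<alpha>s ! i) (us ! i) (vs
             ! j) * ((-1) ^ i *
         mdet b (omit i \<alpha>s) (omit i us) (omit j vs)) else 0)"
        using E m by (auto simp: adapted_frame_def)
    qed
    finally show ?thesis
      by (simp add: sum_negf[symmetric] sum_distrib_left power_add) (auto intro!: sum.cong simp:
          power_add)
  qed
  have "(\<Sum>e\<in>E. mdet b (\<alpha> # \<alpha>s) (e # us) (e # vs)) = (\<Sum>e\<in>E. b \<alpha> e e) * mdet b \<alpha>s us vs +
     (\<Sum>j<length vs. (-1) ^ Suc j * (\<Sum>e\<in>E. b \<alpha> e (vs ! j) * mdet b \<alpha>s us (e # omit j vs)))"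
    unfolding sum_distrib_left
    by (subst sum.swap)
      (simp add: sum.lessThan_Suc_shift sum.distrib sum_distrib_right mult.assoc del:
          sum.lessThan_Suc)
  also have "(\<Sum>j<length vs. (-1) ^ Suc j * (\<Sum>e\<in>E. b \<alpha> e (vs ! j) * mdet b \<alpha>s us (e # omit j vs))) =
    - (\<Sum>j<length vs. \<Sum>i<length us. if \<alpha>s ! i = \<alpha> then (-1) ^ (i + j) * b (\<alpha>s ! i) (us ! i) (vs !
        j) *
         mdet b (omit i \<alpha>s) (omit i us) (omit j vs) else 0)"
    by (simp add: 1 sum_negf del: power_Suc)
  \<comment> \<open>For a fixed row i labelled \<alpha>, the sum over j is the expansion of the
    original determinant along row i.\<close>
  also have "\<dots> = - (\<Sum>i<length us. if \<alpha>s ! i = \<alpha> then mdet b \<alpha>s us vs else 0)"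
    by (subst sum.swap) (auto intro!: sum.cong simp: mdet_row[OF len, symmetric, unfolded len] len)
  also have "\<dots> = - real (count_list \<alpha>s \<alpha>) * mdet b \<alpha>s us vs"
    by (simp add: sum.If_cases len count_list_eq_length_filter length_filter_conv_card Int_def
        conj_commute eq_commute)
  finally show ?thesis using E m by (simp add: adapted_frame_def algebra_simps)
qed

section \<open>Forms with constant coefficients: contraction and insertion\<close>

primrec label_sum :: "nat \<Rightarrow> nat \<Rightarrow> (nat list \<Rightarrow> real) \<Rightarrow> real" where
  "label_sum m 0 F = F []"
| "label_sum m (Suc p) F = (\<Sum>\<alpha><m. label_sum m p (\<lambda>\<alpha>s. F (\<alpha> # \<alpha>s)))"

lemma label_sum_cong:
  "(\<And>\<alpha>s. length \<alpha>s = p \<Longrightarrow> set \<alpha>s \<subseteq> {..<m} \<Longrightarrow> F \<alpha>s = G \<alpha>s) \<Longrightarrow> label_sum m p F = label_sum m p G"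
proof (induction p arbitrary: F G)
  case (Suc p)
  have "label_sum m p (\<lambda>\<alpha>s. F (\<alpha> # \<alpha>s)) = label_sum m p (\<lambda>\<alpha>s. G (\<alpha> # \<alpha>s))" if "\<alpha> < m" for \<alpha>
    using that by (intro Suc.IH Suc.prems) auto
  then show ?case by simp
qed simp

lemma label_sum_sum: "label_sum m p (\<lambda>\<alpha>s. \<Sum>i\<in>I. F i \<alpha>s) = (\<Sum>i\<in>I. label_sum m p (F i))"
  by (induction p arbitrary: F) (simp_all, rule sum.swap)

lemma label_sum_mult: "label_sum m p (\<lambda>\<alpha>s. c * F \<alpha>s) = c * label_sum m p F"
  by (induction p arbitrary: F) (simp_all add: sum_distrib_left)

text \<open>Inserting a label at position i matches pairs of a list and a label with the lists that
  are one longer. \<open>F\<close> receives both lists because in a metric insertion the coefficient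
  belongs to the short list and the determinant to the long one.\<close>

lemma label_sum_insert:
  assumes "i \<le> p"
  shows "label_sum m p (\<lambda>\<alpha>s. \<Sum>\<beta><m. F \<alpha>s (take i \<alpha>s @ \<beta> # drop i \<alpha>s)) =
     label_sum m (Suc p) (\<lambda>\<alpha>s. F (omit i \<alpha>s) \<alpha>s)"
  using assms
proof (induction i arbitrary: p F)
  case 0
  then show ?case by (simp add: label_sum_sum)
next
  case (Suc i)
  then obtain q where q: "p = Suc q" "i \<le> q" by (cases p) auto
  have "label_sum m q (\<lambda>\<alpha>s. \<Sum>\<beta><m. F (\<alpha> # \<alpha>s) (\<alpha> # take i \<alpha>s @ \<beta> # drop i \<alpha>s)) =
     label_sum m (Suc q) (\<lambda>\<alpha>s. F (\<alpha> # omit i \<alpha>s) (\<alpha> # \<alpha>s))" for \<alpha>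
    by (rule Suc.IH[OF q(2)])
  then show ?case by (simp add: q)
qed

text \<open>If C depends only on the multiset of labels, this is a polynomial in the metrics
  \<open>b\<close> \<alpha> for the exterior product of double forms. A single \<open>mdet\<close>
  is alternating in \<open>vs\<close>, but with unequal labels in general not in
  \<open>us\<close>.\<close>

definition mform :: "nat \<Rightarrow> (nat \<Rightarrow> 'm \<Rightarrow> 'm \<Rightarrow> real) \<Rightarrow> nat \<Rightarrow> (nat list \<Rightarrow> real) \<Rightarrow> 'm double_form" where
  "mform m b p C us vs = label_sum m p (\<lambda>\<alpha>s. C \<alpha>s * mdet b \<alpha>s us vs)"

lemma mform_cong:
  "(\<And>\<alpha>s. length \<alpha>s = p \<Longrightarrow> set \<alpha>s \<subseteq> {..<m} \<Longrightarrow> C \<alpha>s = D \<alpha>s) \<Longrightarrow> mform m b p C = mform m b p D"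
  unfolding mform_def by (intro ext label_sum_cong) auto

lemma contraction_mform:
  fixes us vs :: "'m::euclidean_space list"
  assumes E: "adapted_frame m b n (onb h)" and len: "length us = p" "length vs = p"
  shows "contraction h (mform m b (Suc p) C) us vs =
    mform m b p (\<lambda>\<alpha>s. \<Sum>\<alpha><m. (n \<alpha> - real (count_list \<alpha>s \<alpha>)) * C (\<alpha> # \<alpha>s)) us vs"
proof -
  have "contraction h (mform m b (Suc p) C) us vs =
    (\<Sum>\<alpha><m. label_sum m p (\<lambda>\<alpha>s. C (\<alpha> # \<alpha>s) * (\<Sum>e\<in>onb h. mdet b (\<alpha> # \<alpha>s) (e # us) (e # vs))))"
    unfolding contraction_def mform_def label_sum.simps
    by (subst sum.swap) (simp only: label_sum_sum[symmetric] sum_distrib_left)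
  also have "\<dots> = (\<Sum>\<alpha><m. label_sum m p (\<lambda>\<alpha>s. C (\<alpha> # \<alpha>s) *
      ((n \<alpha> - real (count_list \<alpha>s \<alpha>)) * mdet b \<alpha>s us vs)))"
    by (intro sum.cong refl label_sum_cong) (subst sum_mdet_Cons[OF E], use len in auto)
  also have "\<dots> = mform m b p (\<lambda>\<alpha>s. \<Sum>\<alpha><m. (n \<alpha> - real (count_list \<alpha>s \<alpha>)) * C (\<alpha> # \<alpha>s)) us vs"
    unfolding mform_def by (simp only: label_sum_sum[symmetric] sum_distrib_right) (simp only:
        mult_ac)
  finally show ?thesis .
qed

text \<open>For fixed i and \<beta>, the sum over j is the expansion, along row i, of a determinant
  with a row labelled \<beta> inserted at that position.\<close>

lemma insertion_mform:
  assumes h: "\<And>u v. h u v = (\<Sum>\<alpha><m. b \<alpha> u v)" and len: "length us = Suc p" "length vs = Suc p"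
  shows "insertion h (mform m b p C) us vs =
    mform m b (Suc p) (\<lambda>\<alpha>s. \<Sum>i<Suc p. C (omit i \<alpha>s)) us vs"
proof -
  have "insertion h (mform m b p C) us vs =
    (\<Sum>i<Suc p. label_sum m p (\<lambda>\<alpha>s. \<Sum>\<beta><m. C \<alpha>s * (\<Sum>j<Suc p. (-1) ^ (i + j) * b \<beta> (us ! i) (vs ! j) *
       mdet b \<alpha>s (omit i us) (omit j vs))))"
    unfolding insertion_def mform_def len
  proof (intro sum.cong refl)
    fix i
    have "(\<Sum>j<Suc p. (-1) ^ (i + j) * h (us ! i) (vs ! j) *
         label_sum m p (\<lambda>\<alpha>s. C \<alpha>s * mdet b \<alpha>s (omit i us) (omit j vs)))
      = label_sum m p (\<lambda>\<alpha>s. \<Sum>j<Suc p. (-1) ^ (i + j) * h (us ! i) (vs ! j) *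
         (C \<alpha>s * mdet b \<alpha>s (omit i us) (omit j vs)))"
      by (simp only: label_sum_mult label_sum_sum)
    also have "\<dots> = label_sum m p (\<lambda>\<alpha>s. \<Sum>\<beta><m. C \<alpha>s * (\<Sum>j<Suc p. (-1) ^ (i + j) *
         b \<beta> (us ! i) (vs ! j) * mdet b \<alpha>s (omit i us) (omit j vs)))"
      unfolding h sum_distrib_left sum_distrib_right
      by (subst sum.swap) (simp only: mult_ac)
    finally show "(\<Sum>j<Suc p. (-1) ^ (i + j) * h (us ! i) (vs ! j) *
         label_sum m p (\<lambda>\<alpha>s. C \<alpha>s * mdet b \<alpha>s (omit i us) (omit j vs)))
      = label_sum m p (\<lambda>\<alpha>s. \<Sum>\<beta><m. C \<alpha>s * (\<Sum>j<Suc p. (-1) ^ (i + j) *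
         b \<beta> (us ! i) (vs ! j) * mdet b \<alpha>s (omit i us) (omit j vs)))" .
  qed
  also have "\<dots> = (\<Sum>i<Suc p. label_sum m p (\<lambda>\<alpha>s. \<Sum>\<beta><m. C \<alpha>s *
       mdet b (take i \<alpha>s @ \<beta> # drop i \<alpha>s) us vs))"
  proof (intro sum.cong refl label_sum_cong)
    fix i \<beta> and \<alpha>s :: "nat list"
    assume i: "i \<in> {..<Suc p}" and "length \<alpha>s = p"
    then show "C \<alpha>s * (\<Sum>j<Suc p. (-1) ^ (i + j) * b \<beta> (us ! i) (vs ! j) *
       mdet b \<alpha>s (omit i us) (omit j vs)) = C \<alpha>s * mdet b (take i \<alpha>s @ \<beta> # drop i \<alpha>s) us vs"
      by (subst (2) mdet_row[where i = i]) (auto simp: len omit_def nth_append min_def simp del: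
          sum.lessThan_Suc)
  qed
  also have "\<dots> = (\<Sum>i<Suc p. label_sum m (Suc p) (\<lambda>\<alpha>s. C (omit i \<alpha>s) * mdet b \<alpha>s us vs))"
    by (intro sum.cong refl label_sum_insert) auto
  also have "\<dots> = mform m b (Suc p) (\<lambda>\<alpha>s. \<Sum>i<Suc p. C (omit i \<alpha>s)) us vs"
    unfolding mform_def by (simp only: label_sum_sum[symmetric] sum_distrib_right)
  finally show ?thesis .
qed

section \<open>The Thorpe tensor as a labelled form\<close>

lemma sum_permutes_4:
  fixes f :: "nat \<Rightarrow> nat \<Rightarrow> nat \<Rightarrow> nat \<Rightarrow> real"
  shows "(\<Sum>\<sigma> | \<sigma> permutes {..<4::nat}. of_int (sign \<sigma>) * f (\<sigma> 0) (\<sigma> 1) (\<sigma> 2) (\<sigma> 3)) =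
      f 0 1 2 3 - f 0 1 3 2 - f 0 2 1 3 + f 0 2 3 1 + f 0 3 1 2 - f 0 3 2 1
    - f 1 0 2 3 + f 1 0 3 2 + f 1 2 0 3 - f 1 2 3 0 - f 1 3 0 2 + f 1 3 2 0
    + f 2 0 1 3 - f 2 0 3 1 - f 2 1 0 3 + f 2 1 3 0 + f 2 3 0 1 - f 2 3 1 0
    - f 3 0 1 2 + f 3 0 2 1 + f 3 1 0 2 - f 3 1 2 0 - f 3 2 0 1 + f 3 2 1 0"
proof -
  have *: "{..<4::nat} = insert 0 (insert 1 (insert 2 (insert 3 {})))" by auto
  have **: "sum g {p. p permutes {}} = g id" for g :: "(nat \<Rightarrow> nat) \<Rightarrow> real"
    by simp
  show ?thesis
    unfolding *
    apply (subst sum_over_permutations_insert, simp, simp)+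
    unfolding **
    apply (simp add: sign_compose sign_swap_id sign_id permutation_compose permutation_swap_id
        transpose_def)
    done
qed

lemma mdet_4:
  "mdet b [a0, a1, a2, a3] [u0, u1, u2, u3] [v0, v1, v2, v3] = 
     (let f = (\<lambda>p q r s. b a0 u0 p * b a1 u1 q * b a2 u2 r * b a3 u3 s) in 
      f v0 v1 v2 v3 - f v0 v1 v3 v2 - f v0 v2 v1 v3 + f v0 v2 v3 v1 + f v0 v3 v1 v2 - f v0 v3 v2 v1
    - f v1 v0 v2 v3 + f v1 v0 v3 v2 + f v1 v2 v0 v3 - f v1 v2 v3 v0 - f v1 v3 v0 v2 + f v1 v3 v2 v0
    + f v2 v0 v1 v3 - f v2 v0 v3 v1 - f v2 v1 v0 v3 + f v2 v1 v3 v0 + f v2 v3 v0 v1 - f v2 v3 v1 v0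
    - f v3 v0 v1 v2 + f v3 v0 v2 v1 + f v3 v1 v0 v2 - f v3 v1 v2 v0 - f v3 v2 v0 v1 + f v3 v2 v1
        v0)"
  by (simp add: Let_def algebra_simps)

text \<open>A row consists of a vector and a label, so the exchange moves both together.\<close>

lemma mdet_4_swap_rows:
  "mdet b [a1, a0, a2, a3] [u1, u0, u2, u3] [v0, v1, v2, v3] = - mdet b [a0, a1, a2, a3] [u0, u1,
      u2, u3] [v0, v1, v2, v3]"
  "mdet b [a0, a2, a1, a3] [u0, u2, u1, u3] [v0, v1, v2, v3] = - mdet b [a0, a1, a2, a3] [u0, u1,
      u2, u3] [v0, v1, v2, v3]"
  "mdet b [a0, a1, a3, a2] [u0, u1, u3, u2] [v0, v1, v2, v3] = - mdet b [a0, a1, a2, a3] [u0, u1,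
      u2, u3] [v0, v1, v2, v3]"
  unfolding mdet_4 Let_def by (simp_all add: algebra_simps)

lemma mdet_4_swap_columns:
  "mdet b [a0, a1, a2, a3] [u0, u1, u2, u3] [v0, v2, v1, v3] = - mdet b [a0, a1, a2, a3] [u0, u1,
      u2, u3] [v0, v1, v2, v3]"
  "mdet b [a0, a1, a2, a3] [u0, u1, u2, u3] [v0, v1, v3, v2] = - mdet b [a0, a1, a2, a3] [u0, u1,
      u2, u3] [v0, v1, v2, v3]"
  unfolding mdet_4 Let_def by (simp_all add: algebra_simps)

text \<open>Exchanging two rows with the same label costs a sign that cancels the sign of the
  permutation. So the 24 permutations fall into six classes of four, one for each arrangement of the
  labels.\<close>

lemma sum_permutes_rows:
  "(\<Sum>\<sigma> | \<sigma> permutes {..<4::nat}. of_int (sign \<sigma>) *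
      mdet b [\<alpha>, \<alpha>, \<beta>, \<beta>] [us ! \<sigma> 0, us ! \<sigma> 1, us ! \<sigma> 2, us ! \<sigma> 3] [v0, v1, v2, v3]) =
   4 * (let M = (\<lambda>\<alpha>s. mdet b \<alpha>s [us ! 0, us ! 1, us ! 2, us ! 3] [v0, v1, v2, v3]) in
     M [\<alpha>, \<alpha>, \<beta>, \<beta>] + M [\<alpha>, \<beta>, \<alpha>, \<beta>] + M [\<alpha>, \<beta>, \<beta>, \<alpha>] +
     M [\<beta>, \<beta>, \<alpha>, \<alpha>] + M [\<beta>, \<alpha>, \<beta>, \<alpha>] + M [\<beta>, \<alpha>, \<alpha>, \<beta>])"
proof -
  define M where "M \<alpha>s us = mdet b \<alpha>s us [v0, v1, v2, v3]" for \<alpha>s us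
  define x0 x1 x2 x3 where x: "x0 = us ! 0" "x1 = us ! 1" "x2 = us ! 2" "x3 = us ! 3"
  have swap: "M [a1, a0, a2, a3] [u1, u0, u2, u3] = - M [a0, a1, a2, a3] [u0, u1, u2, u3]"
    "M [a0, a2, a1, a3] [u0, u2, u1, u3] = - M [a0, a1, a2, a3] [u0, u1, u2, u3]"
    "M [a0, a1, a3, a2] [u0, u1, u3, u2] = - M [a0, a1, a2, a3] [u0, u1, u2, u3]"
    for a0 a1 a2 a3 u0 u1 u2 u3
    unfolding M_def by (rule mdet_4_swap_rows)+
  have 1: "M [\<alpha>, \<alpha>, \<beta>, \<beta>] [p, q, s, r] = - M [\<alpha>, \<alpha>, \<beta>, \<beta>] [p, q, r, s]"
    "M [\<alpha>, \<alpha>, \<beta>, \<beta>] [q, p, r, s] = - M [\<alpha>, \<alpha>, \<beta>, \<beta>] [p, q, r, s]" for p q r s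
    by (rule swap)+
  \<comment> \<open>The class representatives are increasing on the first two and on the last two
    places; the sixth is the identity.\<close>
  have 2: "M [\<alpha>, \<alpha>, \<beta>, \<beta>] [x0, x2, x1, x3] = - M [\<alpha>, \<beta>, \<alpha>, \<beta>] [x0, x1, x2, x3]"
    "M [\<alpha>, \<alpha>, \<beta>, \<beta>] [x0, x3, x1, x2] = M [\<alpha>, \<beta>, \<beta>, \<alpha>] [x0, x1, x2, x3]"
    "M [\<alpha>, \<alpha>, \<beta>, \<beta>] [x1, x2, x0, x3] = M [\<beta>, \<alpha>, \<alpha>, \<beta>] [x0, x1, x2, x3]"
    "M [\<alpha>, \<alpha>, \<beta>, \<beta>] [x1, x3, x0, x2] = - M [\<beta>, \<alpha>, \<beta>, \<alpha>] [x0, x1, x2, x3]"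
    "M [\<alpha>, \<alpha>, \<beta>, \<beta>] [x2, x3, x0, x1] = M [\<beta>, \<beta>, \<alpha>, \<alpha>] [x0, x1, x2, x3]"
    by (metis swap minus_minus)+
  note 3 = 1(1)[of x0 x1 x3 x2] 1(1)[of x0 x2 x3 x1] 1(1)[of x0 x3 x2 x1]
    1(1)[of x1 x0 x3 x2] 1(1)[of x1 x2 x3 x0] 1(1)[of x1 x3 x2 x0]
    1(1)[of x2 x0 x3 x1] 1(1)[of x2 x1 x3 x0] 1(1)[of x2 x3 x1 x0]
    1(1)[of x3 x0 x2 x1] 1(1)[of x3 x1 x2 x0] 1(1)[of x3 x2 x1 x0]
    1(2)[of x1 x0] 1(2)[of x2 x0] 1(2)[of x3 x0] 1(2)[of x2 x1] 1(2)[of x3 x1] 1(2)[of x3 x2]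
  show ?thesis
    unfolding Let_def M_def[symmetric]
    by (subst sum_permutes_4) (unfold x[symmetric], simp add: 2 3)
qed

lemma list_4: "length xs = 4 \<Longrightarrow> xs = [xs ! 0, xs ! 1, xs ! 2, xs ! 3]"
  by (rule nth_equalityI) (auto simp: less_Suc_eq numeral_eq_Suc)

text \<open>The three terms are the pairings of four indices; with an orthonormal frame adapted to the
  product, \<open>R\<^sub>4\<close> on four frame vectors averages products of sectional curvatures over them.\<close>

definition thorpe_coeff :: "(nat \<Rightarrow> real) \<Rightarrow> nat list \<Rightarrow> real" where
  "thorpe_coeff k \<alpha>s = ((if \<alpha>s ! 0 = \<alpha>s ! 1 then if \<alpha>s ! 2 = \<alpha>s ! 3 then k (\<alpha>s ! 0) * k (\<alpha>s ! 2)
      else 0 else 0) +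
     (if \<alpha>s ! 0 = \<alpha>s ! 2 then if \<alpha>s ! 1 = \<alpha>s ! 3 then k (\<alpha>s ! 0) * k (\<alpha>s ! 1) else 0 else 0) +
     (if \<alpha>s ! 0 = \<alpha>s ! 3 then if \<alpha>s ! 1 = \<alpha>s ! 2 then k (\<alpha>s ! 0) * k (\<alpha>s ! 1) else 0 else 0)) / 3"

text \<open>Each curvature factor is minus a sum of 2-by-2 minors, and the two signs cancel. The sum
  over \<tau> turns a product of two minors into 4 times a 4-by-4 determinant, and the sum over
  \<sigma> gives 4 times the six label arrangements. Exchanging \<alpha> and \<beta> identifies
  these in pairs, so each of the three pairings has weight 4 * 4 * 2 / 96 = 1/3.\<close>

lemma R4_mform:
  assumes Rm: "\<And>u v w z. Rm g x u v w z = (\<Sum>\<alpha><m. k \<alpha> * (b \<alpha> v w * b \<alpha> u z - b \<alpha> u w * b \<alpha> v z))"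
    and len: "length us = 4" "length vs = 4"
  shows "R4 g x us vs = mform m b 4 (thorpe_coeff k) us vs"
proof -
  define v0 v1 v2 v3 where v: "v0 = vs ! 0" "v1 = vs ! 1" "v2 = vs ! 2" "v3 = vs ! 3"
  have vs: "vs = [v0, v1, v2, v3]" using list_4[OF len(2)] by (simp add: v)
  have us: "us = [us ! 0, us ! 1, us ! 2, us ! 3]" by (rule list_4[OF len(1)])
  have tau: "(\<Sum>\<tau> | \<tau> permutes {..<4::nat}. of_int (sign \<tau>) *
       (Rm g x p q (vs ! \<tau> 0) (vs ! \<tau> 1) * Rm g x r s (vs ! \<tau> 2) (vs ! \<tau> 3))) =
     4 * (\<Sum>\<alpha><m. \<Sum>\<beta><m. k \<alpha> * k \<beta> * mdet b [\<alpha>, \<alpha>, \<beta>, \<beta>] [p, q, r, s] vs)" for p q r s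
  proof -
    define F where "F \<alpha> \<beta> t0 t1 t2 t3 = (b \<alpha> q (vs ! t0) * b \<alpha> p (vs ! t1) - b \<alpha> p (vs ! t0) * b \<alpha>
        q (vs ! t1)) *
      (b \<beta> s (vs ! t2) * b \<beta> r (vs ! t3) - b \<beta> r (vs ! t2) * b \<beta> s (vs ! t3))" for \<alpha> \<beta> and t0 t1
          t2 t3 :: nat
    have D: "(\<Sum>\<tau> | \<tau> permutes {..<4::nat}. of_int (sign \<tau>) * F \<alpha> \<beta> (\<tau> 0) (\<tau> 1) (\<tau> 2) (\<tau> 3)) =
        4 * mdet b [\<alpha>, \<alpha>, \<beta>, \<beta>] [p, q, r, s] [v0, v1, v2, v3]" for \<alpha> \<beta>
      by (subst sum_permutes_4) (unfold F_def v[symmetric] mdet_4 Let_def, simp add: algebra_simps)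
    have "Rm g x p q (vs ! t0) (vs ! t1) * Rm g x r s (vs ! t2) (vs ! t3) =
        (\<Sum>\<alpha><m. \<Sum>\<beta><m. k \<alpha> * k \<beta> * F \<alpha> \<beta> t0 t1 t2 t3)" for t0 t1 t2 t3
      unfolding Rm sum_product F_def by (simp only: mult_ac)
    then have "(\<Sum>\<tau> | \<tau> permutes {..<4::nat}. of_int (sign \<tau>) *
       (Rm g x p q (vs ! \<tau> 0) (vs ! \<tau> 1) * Rm g x r s (vs ! \<tau> 2) (vs ! \<tau> 3))) =
       (\<Sum>\<tau> | \<tau> permutes {..<4::nat}. \<Sum>\<alpha><m. \<Sum>\<beta><m. k \<alpha> * k \<beta> *
          (of_int (sign \<tau>) * F \<alpha> \<beta> (\<tau> 0) (\<tau> 1) (\<tau> 2) (\<tau> 3)))"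
      by (simp add: sum_distrib_left mult_ac)
    also have "\<dots> = (\<Sum>\<alpha><m. \<Sum>\<tau> | \<tau> permutes {..<4::nat}. \<Sum>\<beta><m. k \<alpha> * k \<beta> *
          (of_int (sign \<tau>) * F \<alpha> \<beta> (\<tau> 0) (\<tau> 1) (\<tau> 2) (\<tau> 3)))"
      by (rule sum.swap)
    also have "\<dots> = (\<Sum>\<alpha><m. \<Sum>\<beta><m. \<Sum>\<tau> | \<tau> permutes {..<4::nat}. k \<alpha> * k \<beta> *
          (of_int (sign \<tau>) * F \<alpha> \<beta> (\<tau> 0) (\<tau> 1) (\<tau> 2) (\<tau> 3)))"
      by (intro sum.cong refl sum.swap)
    also have "\<dots> = (\<Sum>\<alpha><m. \<Sum>\<beta><m. k \<alpha> * k \<beta> * (\<Sum>\<tau> | \<tau> permutes {..<4::nat}.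
          of_int (sign \<tau>) * F \<alpha> \<beta> (\<tau> 0) (\<tau> 1) (\<tau> 2) (\<tau> 3)))"
      by (simp only: sum_distrib_left)
    finally show ?thesis unfolding D by (simp add: vs sum_distrib_left mult_ac del: mdet.simps)
  qed
  let ?M = "\<lambda>\<alpha>s. mdet b \<alpha>s us vs"
  have "R4 g x us vs = 1 / 96 * (\<Sum>\<sigma> | \<sigma> permutes {..<4::nat}. of_int (sign \<sigma>) *
      (4 * (\<Sum>\<alpha><m. \<Sum>\<beta><m. k \<alpha> * k \<beta> *
         mdet b [\<alpha>, \<alpha>, \<beta>, \<beta>] [us ! \<sigma> 0, us ! \<sigma> 1, us ! \<sigma> 2, us ! \<sigma> 3] vs)))"
    unfolding R4_def tau[symmetric] by (simp add: sum_distrib_left mult_ac fact_numeral)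
  also have "\<dots> = 1 / 24 * (\<Sum>\<sigma> | \<sigma> permutes {..<4::nat}. \<Sum>\<alpha><m. \<Sum>\<beta><m. k \<alpha> * k \<beta> *
         (of_int (sign \<sigma>) * mdet b [\<alpha>, \<alpha>, \<beta>, \<beta>] [us ! \<sigma> 0, us ! \<sigma> 1, us ! \<sigma> 2, us ! \<sigma> 3] vs))"
    by (simp add: sum_distrib_left mult_ac del: mdet.simps)
  also have "(\<Sum>\<sigma> | \<sigma> permutes {..<4::nat}. \<Sum>\<alpha><m. \<Sum>\<beta><m. k \<alpha> * k \<beta> *
         (of_int (sign \<sigma>) * mdet b [\<alpha>, \<alpha>, \<beta>, \<beta>] [us ! \<sigma> 0, us ! \<sigma> 1, us ! \<sigma> 2, us ! \<sigma> 3] vs)) =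
      (\<Sum>\<alpha><m. \<Sum>\<sigma> | \<sigma> permutes {..<4::nat}. \<Sum>\<beta><m. k \<alpha> * k \<beta> *
         (of_int (sign \<sigma>) * mdet b [\<alpha>, \<alpha>, \<beta>, \<beta>] [us ! \<sigma> 0, us ! \<sigma> 1, us ! \<sigma> 2, us ! \<sigma> 3] vs))"
    by (rule sum.swap)
  also have "\<dots> = (\<Sum>\<alpha><m. \<Sum>\<beta><m. \<Sum>\<sigma> | \<sigma> permutes {..<4::nat}. k \<alpha> * k \<beta> *
         (of_int (sign \<sigma>) * mdet b [\<alpha>, \<alpha>, \<beta>, \<beta>] [us ! \<sigma> 0, us ! \<sigma> 1, us ! \<sigma> 2, us ! \<sigma> 3] vs))"
    by (intro sum.cong refl sum.swap)
  also have "\<dots> = (\<Sum>\<alpha><m. \<Sum>\<beta><m. k \<alpha> * k \<beta> * (4 * (?M [\<alpha>, \<alpha>, \<beta>, \<beta>] + ?M [\<alpha>, \<beta>, \<alpha>, \<beta>] + ?M [\<alpha>, \<beta>, \<beta>,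
      \<alpha>] +
     ?M [\<beta>, \<beta>, \<alpha>, \<alpha>] + ?M [\<beta>, \<alpha>, \<beta>, \<alpha>] + ?M [\<beta>, \<alpha>, \<alpha>, \<beta>])))"
    unfolding vs sum_distrib_left[symmetric] sum_permutes_rows Let_def us[symmetric] ..
  finally have 1: "R4 g x us vs = 1 / 6 * ((\<Sum>\<alpha><m. \<Sum>\<beta><m. k \<alpha> * k \<beta> * (?M [\<alpha>, \<alpha>, \<beta>, \<beta>] + ?M [\<alpha>, \<beta>,
      \<alpha>, \<beta>] + ?M [\<alpha>, \<beta>, \<beta>, \<alpha>])) +
      (\<Sum>\<alpha><m. \<Sum>\<beta><m. k \<alpha> * k \<beta> * (?M [\<beta>, \<beta>, \<alpha>, \<alpha>] + ?M [\<beta>, \<alpha>, \<beta>, \<alpha>] + ?M [\<beta>, \<alpha>, \<alpha>, \<beta>])))"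
    by (simp add: sum_distrib_left sum.distrib[symmetric] algebra_simps del: mdet.simps)
  have 2: "(\<Sum>\<alpha><m. \<Sum>\<beta><m. k \<alpha> * k \<beta> * (?M [\<beta>, \<beta>, \<alpha>, \<alpha>] + ?M [\<beta>, \<alpha>, \<beta>, \<alpha>] + ?M [\<beta>, \<alpha>, \<alpha>, \<beta>])) =
    (\<Sum>\<alpha><m. \<Sum>\<beta><m. k \<alpha> * k \<beta> * (?M [\<alpha>, \<alpha>, \<beta>, \<beta>] + ?M [\<alpha>, \<beta>, \<alpha>, \<beta>] + ?M [\<alpha>, \<beta>, \<beta>, \<alpha>]))"
    by (subst sum.swap) (simp only: mult_ac)
  have "mform m b 4 (thorpe_coeff k) us vs = 
    (\<Sum>\<alpha>0<m. \<Sum>\<alpha>1<m. \<Sum>\<alpha>2<m. \<Sum>\<alpha>3<m. thorpe_coeff k [\<alpha>0, \<alpha>1, \<alpha>2, \<alpha>3] * ?M [\<alpha>0, \<alpha>1, \<alpha>2, \<alpha>3])"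
    by (simp add: mform_def numeral_eq_Suc del: mdet.simps)
  also have "\<dots> = 1 / 3 * (\<Sum>\<alpha><m. \<Sum>\<beta><m. k \<alpha> * k \<beta> * (?M [\<alpha>, \<alpha>, \<beta>, \<beta>] + ?M [\<alpha>, \<beta>, \<alpha>, \<beta>] + ?M [\<alpha>, \<beta>,
      \<beta>, \<alpha>]))"
  proof -
    have s0: "(\<Sum>i<m. if P then f i else 0) = (if P then \<Sum>i<m. f i else (0::real))" for P f by simp
    have delta: "(\<Sum>i<m. if a = i then f i else 0) = (if a < m then f a else (0::real))" for a f by
        simp
    have 1: "(\<Sum>\<alpha>0<m. \<Sum>\<alpha>1<m. \<Sum>\<alpha>2<m. \<Sum>\<alpha>3<m. if \<alpha>0 = \<alpha>1 then if \<alpha>2 = \<alpha>3 then X \<alpha>0 \<alpha>1 \<alpha>2 \<alpha>3 else 0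
        else 0) =
       (\<Sum>\<alpha><m. \<Sum>\<beta><m. X \<alpha> \<alpha> \<beta> \<beta> :: real)" for X
      by (simp only: s0 delta) (simp cong: sum.cong_simp)
    have 2: "(\<Sum>\<alpha>0<m. \<Sum>\<alpha>1<m. \<Sum>\<alpha>2<m. \<Sum>\<alpha>3<m. if \<alpha>0 = \<alpha>2 then if \<alpha>1 = \<alpha>3 then X \<alpha>0 \<alpha>1 \<alpha>2 \<alpha>3 else 0
        else 0) =
       (\<Sum>\<alpha><m. \<Sum>\<beta><m. X \<alpha> \<beta> \<alpha> \<beta> :: real)" for X
      by (simp only: s0 delta) (simp cong: sum.cong_simp)
    have 3: "(\<Sum>\<alpha>0<m. \<Sum>\<alpha>1<m. \<Sum>\<alpha>2<m. \<Sum>\<alpha>3<m. if \<alpha>0 = \<alpha>3 then if \<alpha>1 = \<alpha>2 then X \<alpha>0 \<alpha>1 \<alpha>2 \<alpha>3 else 0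
        else 0) =
       (\<Sum>\<alpha><m. \<Sum>\<beta><m. X \<alpha> \<beta> \<beta> \<alpha> :: real)" for X
    proof -
      \<comment> \<open>Here the outer condition involves the innermost summation variable, so that
        sum is evaluated first and the other condition moved to the front.\<close>
      have "(\<Sum>\<alpha>3<m. if \<alpha>0 = \<alpha>3 then if \<alpha>1 = \<alpha>2 then X \<alpha>0 \<alpha>1 \<alpha>2 \<alpha>3 else 0 else 0) =
          (if \<alpha>1 = \<alpha>2 then if \<alpha>0 < m then X \<alpha>0 \<alpha>1 \<alpha>2 \<alpha>0 else 0 else 0)" for \<alpha>0 \<alpha>1 \<alpha>2
        by simp
      then show ?thesis
        by (simp only: s0 delta) (simp cong: sum.cong_simp)
    qed
    have "thorpe_coeff k [\<alpha>0, \<alpha>1, \<alpha>2, \<alpha>3] * ?M [\<alpha>0, \<alpha>1, \<alpha>2, \<alpha>3] =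
       1 / 3 * (if \<alpha>0 = \<alpha>1 then if \<alpha>2 = \<alpha>3 then k \<alpha>0 * k \<alpha>2 * ?M [\<alpha>0, \<alpha>1, \<alpha>2, \<alpha>3] else 0 else 0) +
       1 / 3 * (if \<alpha>0 = \<alpha>2 then if \<alpha>1 = \<alpha>3 then k \<alpha>0 * k \<alpha>1 * ?M [\<alpha>0, \<alpha>1, \<alpha>2, \<alpha>3] else 0 else 0) +
       1 / 3 * (if \<alpha>0 = \<alpha>3 then if \<alpha>1 = \<alpha>2 then k \<alpha>0 * k \<alpha>1 * ?M [\<alpha>0, \<alpha>1, \<alpha>2, \<alpha>3] else 0 else 0)"
           for \<alpha>0 \<alpha>1 \<alpha>2 \<alpha>3
    proof -
      have d: "(if P then if Q then x * y else 0 else 0) = (if P then if Q then x else 0 else 0) *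
          y"
        for P Q and x y :: real by simp
      have nth: "[\<alpha>0, \<alpha>1, \<alpha>2, \<alpha>3] ! 0 = \<alpha>0" "[\<alpha>0, \<alpha>1, \<alpha>2, \<alpha>3] ! 1 = \<alpha>1"
        "[\<alpha>0, \<alpha>1, \<alpha>2, \<alpha>3] ! 2 = \<alpha>2" "[\<alpha>0, \<alpha>1, \<alpha>2, \<alpha>3] ! 3 = \<alpha>3" by simp_all
      have r: "(x + y + z) / 3 * w = 1 / 3 * (x * w) + 1 / 3 * (y * w) + 1 / 3 * (z * w)" for x y
          z w :: real
        by (simp add: field_simps)
      show ?thesis unfolding d thorpe_coeff_def nth r ..
    qed
    then show ?thesis
      by (simp only: sum.distrib sum_distrib_left[symmetric] 1 2 3 distrib_left)
  qed
  finally show ?thesis unfolding 1 2 by (simp del: mdet.simps)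
qed

section \<open>Coefficients of double forms\<close>

definition contraction_coeff ::
  "nat \<Rightarrow> (nat \<Rightarrow> real) \<Rightarrow> (nat list \<Rightarrow> real) \<Rightarrow> nat list \<Rightarrow> real" where
  "contraction_coeff m n C \<alpha>s = (\<Sum>\<alpha><m. (n \<alpha> - real (count_list \<alpha>s \<alpha>)) * C (\<alpha> # \<alpha>s))"

definition insertion_coeff :: "(nat list \<Rightarrow> real) \<Rightarrow> nat list \<Rightarrow> real" where
  "insertion_coeff C \<alpha>s = (\<Sum>i<length \<alpha>s. C (omit i \<alpha>s))"

definition projection_coeff ::
  "nat \<Rightarrow> (nat \<Rightarrow> real) \<Rightarrow> (nat list \<Rightarrow> real) \<Rightarrow> nat list \<Rightarrow> real" where
  "projection_coeff m n C \<alpha>s = (\<Sum>r\<le>4. (-1) ^ r / (fact r * fact (r + 1)) *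
     (insertion_coeff ^^ r) ((contraction_coeff m n ^^ r) C) \<alpha>s)"

text \<open>Agreement is asked only on blocks of length p, because double forms are encoded as total
  functions on lists and the two sides are unrelated at other lengths.\<close>

definition eq_mform ::
  "nat \<Rightarrow> (nat \<Rightarrow> 'm \<Rightarrow> 'm \<Rightarrow> real) \<Rightarrow> nat \<Rightarrow> 'm double_form \<Rightarrow> (nat list \<Rightarrow> real) \<Rightarrow> bool" where
  "eq_mform m b p T C \<longleftrightarrow> (\<forall>us vs. length us = p \<longrightarrow> length vs = p \<longrightarrow> T us vs = mform m b p C us vs)"

lemma eq_mform_contraction:
  fixes T :: "'m::euclidean_space double_form"
  assumes "adapted_frame m b n (onb h)" "eq_mform m b (Suc p) T C"
  shows "eq_mform m b p (contraction h T) (contraction_coeff m n C)"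
  unfolding eq_mform_def
proof (intro allI impI)
  fix us vs :: "'m list" assume len: "length us = p" "length vs = p"
  then have "contraction h T us vs = contraction h (mform m b (Suc p) C) us vs"
    using assms(2) by (simp add: contraction_def eq_mform_def)
  then show "contraction h T us vs = mform m b p (contraction_coeff m n C) us vs"
    using contraction_mform[OF assms(1) len, of C] by (simp add: contraction_coeff_def[abs_def])
qed

lemma eq_mform_insertion:
  assumes "\<forall>u v. h u v = (\<Sum>\<alpha><m. b \<alpha> u v)" "eq_mform m b p T C"
  shows "eq_mform m b (Suc p) (insertion h T) (insertion_coeff C)"
  unfolding eq_mform_def
proof (intro allI impI)
  fix us vs :: "'a list" assume len: "length us = Suc p" "length vs = Suc p"
  then have "insertion h T us vs = insertion h (mform m b p C) us vs"
    using assms(2) by (simp add: insertion_def eq_mform_def del: sum.lessThan_Suc)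
  also have "\<dots> = mform m b (Suc p) (\<lambda>\<alpha>s. \<Sum>i<Suc p. C (omit i \<alpha>s)) us vs"
    using assms(1) len by (intro insertion_mform) auto
  also have "mform m b (Suc p) (\<lambda>\<alpha>s. \<Sum>i<Suc p. C (omit i \<alpha>s)) = mform m b (Suc p) (insertion_coeff
      C)"
    by (rule mform_cong) (simp add: insertion_coeff_def del: sum.lessThan_Suc)
  finally show "insertion h T us vs = mform m b (Suc p) (insertion_coeff C) us vs" .
qed

lemma eq_mform_contraction_funpow:
  assumes "adapted_frame m b n (onb h)" "eq_mform m b (p + r) T C"
  shows "eq_mform m b p ((contraction h ^^ r) T) ((contraction_coeff m n ^^ r) C)"
  using assms(2)
proof (induction r arbitrary: p)
  case (Suc r)
  show ?case
    using eq_mform_contraction[OF assms(1) Suc.IH[of "Suc p"]] Suc.prems by simp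
qed simp

lemma eq_mform_insertion_funpow:
  assumes "\<forall>u v. h u v = (\<Sum>\<alpha><m. b \<alpha> u v)" "eq_mform m b p T C"
  shows "eq_mform m b (p + r) ((insertion h ^^ r) T) ((insertion_coeff ^^ r) C)"
proof (induction r)
  case (Suc r)
  show ?case using eq_mform_insertion[OF assms(1) Suc.IH] by simp
qed (use assms in simp)

lemma K4_eq_mform:
  assumes h: "\<forall>u v. g x u v = (\<Sum>\<alpha><m. b \<alpha> u v)"
    and frame: "adapted_frame m b n (onb (g x))"
    and R4: "eq_mform m b 4 (R4 g x) C"
  shows "eq_mform m b 4 (K4 g x) (projection_coeff m n C)"
proof -
  have *: "eq_mform m b 4 ((insertion (g x) ^^ r) ((contraction (g x) ^^ r) (R4 g x)))
      ((insertion_coeff ^^ r) ((contraction_coeff m n ^^ r) C))" if "r \<le> 4" for r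
    using eq_mform_insertion_funpow[OF h, where p = "4 - r" and r = r] that
      eq_mform_contraction_funpow[OF frame, of "4 - r" r] R4 by simp
  show ?thesis
    unfolding eq_mform_def
  proof (intro allI impI)
    fix us vs :: "'a list" assume len: "length us = 4" "length vs = 4"
    have "K4 g x us vs = (\<Sum>r\<le>4. (-1) ^ r / (fact r * fact (r + 1)) *
       mform m b 4 ((insertion_coeff ^^ r) ((contraction_coeff m n ^^ r) C)) us vs)"
      unfolding K4_def using * len by (intro sum.cong) (auto simp: eq_mform_def)
    then show "K4 g x us vs = mform m b 4 (projection_coeff m n C) us vs"
      unfolding mform_def projection_coeff_def
      by (simp only: label_sum_mult[symmetric] label_sum_sum[symmetric] sum_distrib_right
          mult.assoc)
  qed
qed

section \<open>Full contractions of labelled forms\<close>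

lemma sum_mdet_list_update:
  assumes E: "adapted_frame m b n E" and m: "\<alpha> < m" "set \<alpha>s \<subseteq> {..<m}"
    and len: "length us = length \<alpha>s" "length vs = length \<alpha>s" "r < length \<alpha>s"
  shows "(\<Sum>e\<in>E. b \<alpha> w e * mdet b \<alpha>s (us[r := e]) vs) =
    (if \<alpha> = \<alpha>s ! r then mdet b \<alpha>s (us[r := w]) vs else 0)"
proof -
  have omit: "omit r (us[r := e]) = omit r us" for e by (simp add: omit_def)
  have m': "\<alpha>s ! r < m" using m len by (meson lessThan_iff nth_mem subsetD)
  have "(\<Sum>e\<in>E. b \<alpha> w e * mdet b \<alpha>s (us[r := e]) vs) =
     (\<Sum>e\<in>E. \<Sum>j<length vs. b \<alpha> w e * ((-1) ^ (r + j) * b (\<alpha>s ! r) e (vs ! j) * 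
           mdet b (omit r \<alpha>s) (omit r us) (omit j vs)))"
    using len by (subst mdet_row[where i = r]) (auto simp: sum_distrib_left omit)
  also have "\<dots> = (\<Sum>j<length vs. (\<Sum>e\<in>E. b \<alpha> w e * b (\<alpha>s ! r) e (vs ! j)) * ((-1) ^ (r + j) *
           mdet b (omit r \<alpha>s) (omit r us) (omit j vs)))"
    by (subst sum.swap) (simp add: sum_distrib_left sum_distrib_right mult_ac)
  also have "\<dots> = (\<Sum>j<length vs. if \<alpha> = \<alpha>s ! r then (-1) ^ (r + j) * b (\<alpha>s ! r) w (vs ! j) *
           mdet b (omit r \<alpha>s) (omit r us) (omit j vs) else 0)"
    using E m(1) m' by (intro sum.cong) (auto simp: adapted_frame_def)
  also have "\<dots> = (if \<alpha> = \<alpha>s ! r then mdet b \<alpha>s (us[r := w]) vs else 0)"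
    using len by (subst (2) mdet_row[where i = r]) (auto simp: omit)
  finally show ?thesis .
qed

text \<open>By \<open>sum_mdet_list_update\<close> each sum over a j copies the corresponding i into
  its row, provided the labels agree. What remains is a determinant with three rows and columns in
  common, contracted one after the other.\<close>

lemma sum_mdet_full_contraction:
  assumes E: "adapted_frame m b n E"
    and m: "\<alpha>1 < m" "\<alpha>2 < m" "\<alpha>3 < m" "set [\<beta>0, \<beta>1, \<beta>2, \<beta>3] \<subseteq> {..<m}"
  shows "(\<Sum>i1\<in>E. \<Sum>i2\<in>E. \<Sum>i3\<in>E. \<Sum>j1\<in>E. \<Sum>j2\<in>E. \<Sum>j3\<in>E. b \<alpha>1 i1 j1 * (b \<alpha>2 i2 j2 * (b \<alpha>3 i3 j3 *
       mdet b [\<beta>0, \<beta>1, \<beta>2, \<beta>3] [u, j1, j2, j3] [v, i1, i2, i3]))) =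
    (if \<alpha>1 = \<beta>1 \<and> \<alpha>2 = \<beta>2 \<and> \<alpha>3 = \<beta>3 then
      (n \<beta>1 - real (count_list [\<beta>0] \<beta>1)) * ((n \<beta>2 - real (count_list [\<beta>1, \<beta>0] \<beta>2)) *
      ((n \<beta>3 - real (count_list [\<beta>2, \<beta>1, \<beta>0] \<beta>3)) * b \<beta>0 u v)) else 0)"
proof -
  let ?\<beta>s = "[\<beta>0, \<beta>1, \<beta>2, \<beta>3]"
  have 1: "(\<Sum>j1\<in>E. b \<alpha>1 w j1 * mdet b ?\<beta>s [u, j1, p, q] [v, i1, i2, i3]) =
      (if \<alpha>1 = \<beta>1 then mdet b ?\<beta>s [u, w, p, q] [v, i1, i2, i3] else 0)" for w p q i1 i2 i3
    using sum_mdet_list_update[OF E m(1) m(4), of "[u, w, p, q]" "[v, i1, i2, i3]" 1 w] by (simp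
        del: mdet.simps)
  have 2: "(\<Sum>j2\<in>E. b \<alpha>2 w j2 * mdet b ?\<beta>s [u, p, j2, q] [v, i1, i2, i3]) =
      (if \<alpha>2 = \<beta>2 then mdet b ?\<beta>s [u, p, w, q] [v, i1, i2, i3] else 0)" for w p q i1 i2 i3
    using sum_mdet_list_update[OF E m(2) m(4), of "[u, p, w, q]" "[v, i1, i2, i3]" 2 w] by (simp
        del: mdet.simps)
  have 3: "(\<Sum>j3\<in>E. b \<alpha>3 w j3 * mdet b ?\<beta>s [u, p, q, j3] [v, i1, i2, i3]) =
      (if \<alpha>3 = \<beta>3 then mdet b ?\<beta>s [u, p, q, w] [v, i1, i2, i3] else 0)" for w p q i1 i2 i3
    using sum_mdet_list_update[OF E m(3) m(4), of "[u, p, q, w]" "[v, i1, i2, i3]" 3 w] by (simp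
        del: mdet.simps)
  have c: "(\<Sum>j\<in>E. f j * (if P then h j else 0)) = (if P then \<Sum>j\<in>E. f j * h j else (0::real))" for
      P f h by simp
  have s: "(\<Sum>j\<in>E. if P then h j else 0) = (if P then \<Sum>j\<in>E. h j else (0::real))" for P h by simp
  \<comment> \<open>Reversing rows and columns together preserves the determinant and puts the slots
    to be contracted in front, where \<open>sum_mdet_Cons\<close> applies.\<close>
  have rev: "mdet b ?\<beta>s [u, i1, i2, i3] [v, i1, i2, i3] = mdet b [\<beta>3, \<beta>2, \<beta>1, \<beta>0] [i3, i2, i1, u]
      [i3, i2, i1, v]" for i1 i2 i3
    unfolding mdet_4 Let_def by (simp add: algebra_simps)
  have "(\<Sum>i1\<in>E. \<Sum>i2\<in>E. \<Sum>i3\<in>E. \<Sum>j1\<in>E. \<Sum>j2\<in>E. \<Sum>j3\<in>E. b \<alpha>1 i1 j1 * (b \<alpha>2 i2 j2 * (b \<alpha>3 i3 j3 *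
       mdet b [\<beta>0, \<beta>1, \<beta>2, \<beta>3] [u, j1, j2, j3] [v, i1, i2, i3]))) =
      (\<Sum>i1\<in>E. \<Sum>i2\<in>E. \<Sum>i3\<in>E. \<Sum>j1\<in>E. b \<alpha>1 i1 j1 * (\<Sum>j2\<in>E. b \<alpha>2 i2 j2 * (\<Sum>j3\<in>E. b \<alpha>3 i3 j3 *
       mdet b [\<beta>0, \<beta>1, \<beta>2, \<beta>3] [u, j1, j2, j3] [v, i1, i2, i3])))"
    by (simp only: sum_distrib_left)
  also have "\<dots> = (if \<alpha>1 = \<beta>1 \<and> \<alpha>2 = \<beta>2 \<and> \<alpha>3 = \<beta>3 then \<Sum>i1\<in>E. \<Sum>i2\<in>E. \<Sum>i3\<in>E.
       mdet b ?\<beta>s [u, i1, i2, i3] [v, i1, i2, i3] else 0)"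
    by (simp only: 1 2 3 c s) simp
  also have "(\<Sum>i1\<in>E. \<Sum>i2\<in>E. \<Sum>i3\<in>E. mdet b ?\<beta>s [u, i1, i2, i3] [v, i1, i2, i3]) =
     (n \<beta>3 - real (count_list [\<beta>2, \<beta>1, \<beta>0] \<beta>3)) *
     ((n \<beta>2 - real (count_list [\<beta>1, \<beta>0] \<beta>2)) * ((n \<beta>1 - real (count_list [\<beta>0] \<beta>1)) * mdet b [\<beta>0]
         [u] [v]))"
  proof -
    have "(\<Sum>e\<in>E. mdet b [\<beta>3, \<beta>2, \<beta>1, \<beta>0] [e, i2, i1, u] [e, i2, i1, v]) =
        (n \<beta>3 - real (count_list [\<beta>2, \<beta>1, \<beta>0] \<beta>3)) * mdet b [\<beta>2, \<beta>1, \<beta>0] [i2, i1, u] [i2, i1, v]"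
            for i1 i2
      by (rule sum_mdet_Cons[OF E]) (use m in auto)
    moreover have "(\<Sum>e\<in>E. mdet b [\<beta>2, \<beta>1, \<beta>0] [e, i1, u] [e, i1, v]) =
        (n \<beta>2 - real (count_list [\<beta>1, \<beta>0] \<beta>2)) * mdet b [\<beta>1, \<beta>0] [i1, u] [i1, v]" for i1
      by (rule sum_mdet_Cons[OF E]) (use m in auto)
    moreover have "(\<Sum>e\<in>E. mdet b [\<beta>1, \<beta>0] [e, u] [e, v]) =
        (n \<beta>1 - real (count_list [\<beta>0] \<beta>1)) * mdet b [\<beta>0] [u] [v]"
      by (rule sum_mdet_Cons[OF E]) (use m in auto)
    ultimately show ?thesis
      by (simp only: rev sum_distrib_left[symmetric])
  qed
  also have "mdet b [\<beta>0] [u] [v] = b \<beta>0 u v" by simp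
  finally show ?thesis by (simp only: mult_ac)
qed

text \<open>Labels sit on rows, so antisymmetry in the columns holds term by term for arbitrary
  coefficients.\<close>

lemma mform_swap_columns:
  "mform m b 4 C [u0, u1, u2, u3] [v0, v2, v1, v3] = - mform m b 4 C [u0, u1, u2, u3] [v0, v1, v2,
      v3]"
  "mform m b 4 C [u0, u1, u2, u3] [v0, v1, v3, v2] = - mform m b 4 C [u0, u1, u2, u3] [v0, v1, v2,
      v3]"
proof -
  have 4: "mform m b 4 C us vs = (\<Sum>\<alpha>0<m. \<Sum>\<alpha>1<m. \<Sum>\<alpha>2<m. \<Sum>\<alpha>3<m.
      C [\<alpha>0, \<alpha>1, \<alpha>2, \<alpha>3] * mdet b [\<alpha>0, \<alpha>1, \<alpha>2, \<alpha>3] us vs)" for us vs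
    by (simp add: mform_def numeral_eq_Suc del: mdet.simps)
  show "mform m b 4 C [u0, u1, u2, u3] [v0, v2, v1, v3] = - mform m b 4 C [u0, u1, u2, u3] [v0,
      v1, v2, v3]"
    unfolding 4 mdet_4_swap_columns(1)[of _ _ _ _ _ _ _ _ _ _ v2 v1] by (simp add: sum_negf del:
        mdet.simps)
  show "mform m b 4 C [u0, u1, u2, u3] [v0, v1, v3, v2] = - mform m b 4 C [u0, u1, u2, u3] [v0,
      v1, v2, v3]"
    unfolding 4 mdet_4_swap_columns(2)[of _ _ _ _ _ _ _ _ _ _ _ v3 v2] by (simp add: sum_negf del:
        mdet.simps)
qed

text \<open>The factors count choices of distinct vectors in a frame adapted to the splitting: each
  is the dimension belonging to a label minus the number of its vectors already taken.\<close>

definition full_contraction_coeff ::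
  "(nat \<Rightarrow> real) \<Rightarrow> (nat list \<Rightarrow> real) \<Rightarrow> nat \<Rightarrow> nat \<Rightarrow> nat \<Rightarrow> nat \<Rightarrow> real" where
  "full_contraction_coeff n C \<beta>0 \<beta>1 \<beta>2 \<beta>3 = (n \<beta>1 - real (count_list [\<beta>0] \<beta>1)) *
     ((n \<beta>2 - real (count_list [\<beta>1, \<beta>0] \<beta>2)) *
     ((n \<beta>3 - real (count_list [\<beta>2, \<beta>1, \<beta>0] \<beta>3)) * C [\<beta>0, \<beta>1, \<beta>2, \<beta>3]))"

lemma sum_mform_full_contraction:
  assumes E: "adapted_frame m b n E" and m: "\<alpha>1 < m" "\<alpha>2 < m" "\<alpha>3 < m"
  shows "(\<Sum>i1\<in>E. \<Sum>i2\<in>E. \<Sum>i3\<in>E. \<Sum>j1\<in>E. \<Sum>j2\<in>E. \<Sum>j3\<in>E. b \<alpha>1 i1 j1 * (b \<alpha>2 i2 j2 * (b \<alpha>3 i3 j3 *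
       mform m b 4 C [u, j1, j2, j3] [v, i1, i2, i3]))) =
    (\<Sum>\<beta>0<m. full_contraction_coeff n C \<beta>0 \<alpha>1 \<alpha>2 \<alpha>3 * b \<beta>0 u v)"
proof -
  define Z where "Z F = (\<Sum>i1\<in>E. \<Sum>i2\<in>E. \<Sum>i3\<in>E. \<Sum>j1\<in>E. \<Sum>j2\<in>E. \<Sum>j3\<in>E. F i1 i2 i3 j1 j2 j3)"
    for F :: "'a \<Rightarrow> 'a \<Rightarrow> 'a \<Rightarrow> 'a \<Rightarrow> 'a \<Rightarrow> 'a \<Rightarrow> real"
  have Z_sum: "Z (\<lambda>i1 i2 i3 j1 j2 j3. \<Sum>\<beta><m. F \<beta> i1 i2 i3 j1 j2 j3) = (\<Sum>\<beta><m. Z (F \<beta>))" for F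
    unfolding Z_def by (simp only: sum.swap[of _ "{..<m}"])
  have Z_mult: "Z (\<lambda>i1 i2 i3 j1 j2 j3. c * F i1 i2 i3 j1 j2 j3) = c * Z F" for c F
    unfolding Z_def by (simp only: sum_distrib_left)
  have 4: "mform m b 4 C us vs = (\<Sum>\<beta>0<m. \<Sum>\<beta>1<m. \<Sum>\<beta>2<m. \<Sum>\<beta>3<m.
      C [\<beta>0, \<beta>1, \<beta>2, \<beta>3] * mdet b [\<beta>0, \<beta>1, \<beta>2, \<beta>3] us vs)" for us vs
    by (simp add: mform_def numeral_eq_Suc del: mdet.simps)
  have "(\<Sum>i1\<in>E. \<Sum>i2\<in>E. \<Sum>i3\<in>E. \<Sum>j1\<in>E. \<Sum>j2\<in>E. \<Sum>j3\<in>E. b \<alpha>1 i1 j1 * (b \<alpha>2 i2 j2 * (b \<alpha>3 i3 j3 *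
       mform m b 4 C [u, j1, j2, j3] [v, i1, i2, i3]))) =
     Z (\<lambda>i1 i2 i3 j1 j2 j3. \<Sum>\<beta>0<m. \<Sum>\<beta>1<m. \<Sum>\<beta>2<m. \<Sum>\<beta>3<m. C [\<beta>0, \<beta>1, \<beta>2, \<beta>3] *
        (b \<alpha>1 i1 j1 * (b \<alpha>2 i2 j2 * (b \<alpha>3 i3 j3 * mdet b [\<beta>0, \<beta>1, \<beta>2, \<beta>3] [u, j1, j2, j3] [v, i1,
            i2, i3]))))"
    unfolding Z_def 4 by (simp only: sum_distrib_left mult.left_commute)
  also have "\<dots> = (\<Sum>\<beta>0<m. \<Sum>\<beta>1<m. \<Sum>\<beta>2<m. \<Sum>\<beta>3<m. C [\<beta>0, \<beta>1, \<beta>2, \<beta>3] *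
      Z (\<lambda>i1 i2 i3 j1 j2 j3. b \<alpha>1 i1 j1 * (b \<alpha>2 i2 j2 * (b \<alpha>3 i3 j3 *
         mdet b [\<beta>0, \<beta>1, \<beta>2, \<beta>3] [u, j1, j2, j3] [v, i1, i2, i3]))))"
    by (simp only: Z_sum Z_mult)
  also have "\<dots> = (\<Sum>\<beta>0<m. \<Sum>\<beta>1<m. \<Sum>\<beta>2<m. \<Sum>\<beta>3<m. if \<beta>1 = \<alpha>1 then if \<beta>2 = \<alpha>2 then if \<beta>3 = \<alpha>3 then
      full_contraction_coeff n C \<beta>0 \<alpha>1 \<alpha>2 \<alpha>3 * b \<beta>0 u v else 0 else 0 else 0)"
  proof (intro sum.cong refl)
    fix \<beta>0 \<beta>1 \<beta>2 \<beta>3 assume \<beta>: "\<beta>0 \<in> {..<m}" "\<beta>1 \<in> {..<m}" "\<beta>2 \<in> {..<m}" "\<beta>3 \<in> {..<m}"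
    show "C [\<beta>0, \<beta>1, \<beta>2, \<beta>3] * Z (\<lambda>i1 i2 i3 j1 j2 j3. b \<alpha>1 i1 j1 * (b \<alpha>2 i2 j2 * (b \<alpha>3 i3 j3 *
         mdet b [\<beta>0, \<beta>1, \<beta>2, \<beta>3] [u, j1, j2, j3] [v, i1, i2, i3]))) =
       (if \<beta>1 = \<alpha>1 then if \<beta>2 = \<alpha>2 then if \<beta>3 = \<alpha>3 then
      full_contraction_coeff n C \<beta>0 \<alpha>1 \<alpha>2 \<alpha>3 * b \<beta>0 u v else 0 else 0 else 0)"
      unfolding Z_def using \<beta> by (subst sum_mdet_full_contraction[OF E m]) (auto simp:
          full_contraction_coeff_def)
  qed
  also have "\<dots> = (\<Sum>\<beta>0<m. full_contraction_coeff n C \<beta>0 \<alpha>1 \<alpha>2 \<alpha>3 * b \<beta>0 u v)"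
  proof -
    have s: "(\<Sum>i<m. if P then f i else 0) = (if P then \<Sum>i<m. f i else (0::real))" for P f by simp
    have delta: "(\<Sum>i<m. if i = a then f i else 0) = (if a < m then f a else (0::real))" for a f by
        simp
    show ?thesis using m by (simp only: s delta if_True)
  qed
  finally show ?thesis .
qed

definition bach_coeff ::
  "nat \<Rightarrow> (nat \<Rightarrow> real) \<Rightarrow> (nat list \<Rightarrow> real) \<Rightarrow> (nat list \<Rightarrow> real) \<Rightarrow> nat \<Rightarrow> real" where
  "bach_coeff m n P C \<beta> = (\<Sum>\<alpha>1<m. \<Sum>\<alpha>2<m. \<Sum>\<alpha>3<m. P [\<alpha>1, \<alpha>2, \<alpha>3] *
     (let Y = full_contraction_coeff n C \<beta> in
      Y \<alpha>1 \<alpha>2 \<alpha>3 + Y \<alpha>1 \<alpha>3 \<alpha>2 + Y \<alpha>2 \<alpha>1 \<alpha>3 + Y \<alpha>2 \<alpha>3 \<alpha>1 + Y \<alpha>3 \<alpha>1 \<alpha>2 + Y \<alpha>3 \<alpha>2 \<alpha>1))"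

text \<open>Each of the six terms of the 3-by-3 determinant becomes a diagonal one when the i's are
  renamed. The antisymmetry of the second form in i1, i2, i3 absorbs the sign of the renaming, so
  all six terms of \<open>bach_coeff\<close> carry a plus sign.\<close>

lemma sum_mform_mform:
  assumes E: "adapted_frame m b n E"
  shows "(\<Sum>i1\<in>E. \<Sum>i2\<in>E. \<Sum>j1\<in>E. \<Sum>j2\<in>E. \<Sum>i3\<in>E. \<Sum>j3\<in>E.
       mform m b 3 P [i1, i2, i3] [j1, j2, j3] * mform m b 4 C [u, j1, j2, j3] [v, i1, i2, i3]) =
    (\<Sum>\<beta><m. bach_coeff m n P C \<beta> * b \<beta> u v)"
proof -
  define Z where "Z F = (\<Sum>i1\<in>E. \<Sum>i2\<in>E. \<Sum>i3\<in>E. \<Sum>j1\<in>E. \<Sum>j2\<in>E. \<Sum>j3\<in>E. F i1 i2 i3 j1 j2 j3)"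
    for F :: "'a \<Rightarrow> 'a \<Rightarrow> 'a \<Rightarrow> 'a \<Rightarrow> 'a \<Rightarrow> 'a \<Rightarrow> real"
  define K where "K i1 i2 i3 j1 j2 j3 = mform m b 4 C [u, j1, j2, j3] [v, i1, i2, i3]" for i1 i2
      i3 j1 j2 j3
  define X where "X \<alpha>1 \<alpha>2 \<alpha>3 = Z (\<lambda>i1 i2 i3 j1 j2 j3. b \<alpha>1 i1 j1 * (b \<alpha>2 i2 j2 * (b \<alpha>3 i3 j3 * K
      i1 i2 i3 j1 j2 j3)))"
    for \<alpha>1 \<alpha>2 \<alpha>3
  have Z_sum: "Z (\<lambda>i1 i2 i3 j1 j2 j3. \<Sum>\<beta><m. F \<beta> i1 i2 i3 j1 j2 j3) = (\<Sum>\<beta><m. Z (F \<beta>))" for F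
    unfolding Z_def by (simp only: sum.swap[of _ "{..<m}"])
  have Z_mult: "Z (\<lambda>i1 i2 i3 j1 j2 j3. c * F i1 i2 i3 j1 j2 j3) = c * Z F" for c F
    unfolding Z_def by (simp only: sum_distrib_left)
  have Z_add: "Z (\<lambda>i1 i2 i3 j1 j2 j3. F i1 i2 i3 j1 j2 j3 + G i1 i2 i3 j1 j2 j3) = Z F + Z G" for
      F G
    unfolding Z_def by (simp only: sum.distrib)
  have Z_minus: "Z (\<lambda>i1 i2 i3 j1 j2 j3. - F i1 i2 i3 j1 j2 j3) = - Z F" for F
    unfolding Z_def by (simp only: sum_negf)
  \<comment> \<open>The frame vectors are bound, so permuting i1, i2, i3 leaves the total sum
    unchanged.\<close>
  have Z12: "Z F = Z (\<lambda>i1 i2 i3. F i2 i1 i3)" for F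
    unfolding Z_def by (rule sum.swap)
  have Z23: "Z F = Z (\<lambda>i1 i2 i3. F i1 i3 i2)" for F
    unfolding Z_def by (intro sum.cong refl sum.swap)
  have K: "K i2 i1 i3 j1 j2 j3 = - K i1 i2 i3 j1 j2 j3" "K i1 i3 i2 j1 j2 j3 = - K i1 i2 i3 j1 j2
      j3"
    for i1 i2 i3 j1 j2 j3
    unfolding K_def by (rule mform_swap_columns)+
  have K': "K i2 i3 i1 j1 j2 j3 = K i1 i2 i3 j1 j2 j3" "K i3 i1 i2 j1 j2 j3 = K i1 i2 i3 j1 j2 j3"
     "K i3 i2 i1 j1 j2 j3 = - K i1 i2 i3 j1 j2 j3"
    for i1 i2 i3 j1 j2 j3
    using K(2)[of i2 i1 i3 j1 j2 j3] K(1)[of i3 i1 i2 j1 j2 j3] K(1)[of i2 i3 i1 j1 j2 j3]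
      K(1)[of i1 i2 i3 j1 j2 j3] K(2)[of i1 i2 i3 j1 j2 j3] by simp_all
  have Z231: "Z F = Z (\<lambda>i1 i2 i3. F i2 i3 i1)" for F
    by (subst Z23, subst Z12) simp
  have Z312: "Z F = Z (\<lambda>i1 i2 i3. F i3 i1 i2)" for F
    by (subst Z12, subst Z23) simp
  have Z321: "Z F = Z (\<lambda>i1 i2 i3. F i3 i2 i1)" for F
    by (subst Z12, subst Z231) simp
  have X: "Z (\<lambda>i1 i2 i3 j1 j2 j3. mdet b [\<alpha>1, \<alpha>2, \<alpha>3] [i1, i2, i3] [j1, j2, j3] * K i1 i2 i3 j1 j2
      j3) =
      X \<alpha>1 \<alpha>2 \<alpha>3 + X \<alpha>1 \<alpha>3 \<alpha>2 + X \<alpha>2 \<alpha>1 \<alpha>3 + X \<alpha>2 \<alpha>3 \<alpha>1 + X \<alpha>3 \<alpha>1 \<alpha>2 + X \<alpha>3 \<alpha>2 \<alpha>1"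
    for \<alpha>1 \<alpha>2 \<alpha>3
  proof -
    have 1: "X \<alpha>1 \<alpha>3 \<alpha>2 = Z (\<lambda>i1 i2 i3 j1 j2 j3. - (b \<alpha>1 i1 j1 * (b \<alpha>2 i2 j3 * (b \<alpha>3 i3 j2 * K i1
        i2 i3 j1 j2 j3))))"
    proof -
      have "b \<alpha>1 i1 j1 * (b \<alpha>3 i3 j2 * (b \<alpha>2 i2 j3 * K i1 i3 i2 j1 j2 j3)) = - (b \<alpha>1 i1 j1 * (b \<alpha>2
          i2 j3 * (b \<alpha>3 i3 j2 * K i1 i2 i3 j1 j2 j3)))"
        for i1 i2 i3 j1 j2 j3
        using K(2)[of i1 i2 i3 j1 j2 j3] by (simp add: mult_ac)
      then show ?thesis unfolding X_def by (subst Z23) (simp only:)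
    qed
    have 2: "X \<alpha>2 \<alpha>1 \<alpha>3 = Z (\<lambda>i1 i2 i3 j1 j2 j3. - (b \<alpha>1 i1 j2 * (b \<alpha>2 i2 j1 * (b \<alpha>3 i3 j3 * K i1
        i2 i3 j1 j2 j3))))"
    proof -
      have "b \<alpha>2 i2 j1 * (b \<alpha>1 i1 j2 * (b \<alpha>3 i3 j3 * K i2 i1 i3 j1 j2 j3)) = - (b \<alpha>1 i1 j2 * (b \<alpha>2
          i2 j1 * (b \<alpha>3 i3 j3 * K i1 i2 i3 j1 j2 j3)))"
        for i1 i2 i3 j1 j2 j3
        using K(1)[of i1 i2 i3 j1 j2 j3] by (simp add: mult_ac)
      then show ?thesis unfolding X_def by (subst Z12) (simp only:)
    qed
    have 3: "X \<alpha>2 \<alpha>3 \<alpha>1 = Z (\<lambda>i1 i2 i3 j1 j2 j3. b \<alpha>1 i1 j3 * (b \<alpha>2 i2 j1 * (b \<alpha>3 i3 j2 * K i1 i2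
        i3 j1 j2 j3)))"
    proof -
      have "b \<alpha>2 i2 j1 * (b \<alpha>3 i3 j2 * (b \<alpha>1 i1 j3 * K i2 i3 i1 j1 j2 j3)) = b \<alpha>1 i1 j3 * (b \<alpha>2 i2
          j1 * (b \<alpha>3 i3 j2 * K i1 i2 i3 j1 j2 j3))"
        for i1 i2 i3 j1 j2 j3
        using K'(1)[of i2 i3 i1 j1 j2 j3] by (simp add: mult_ac)
      then show ?thesis unfolding X_def by (subst Z231) (simp only:)
    qed
    have 4: "X \<alpha>3 \<alpha>1 \<alpha>2 = Z (\<lambda>i1 i2 i3 j1 j2 j3. b \<alpha>1 i1 j2 * (b \<alpha>2 i2 j3 * (b \<alpha>3 i3 j1 * K i1 i2
        i3 j1 j2 j3)))"
    proof -
      have "b \<alpha>3 i3 j1 * (b \<alpha>1 i1 j2 * (b \<alpha>2 i2 j3 * K i3 i1 i2 j1 j2 j3)) = b \<alpha>1 i1 j2 * (b \<alpha>2 i2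
          j3 * (b \<alpha>3 i3 j1 * K i1 i2 i3 j1 j2 j3))"
        for i1 i2 i3 j1 j2 j3
        using K'(2)[of i3 i1 i2 j1 j2 j3] by (simp add: mult_ac)
      then show ?thesis unfolding X_def by (subst Z312) (simp only:)
    qed
    have 5: "X \<alpha>3 \<alpha>2 \<alpha>1 = Z (\<lambda>i1 i2 i3 j1 j2 j3. - (b \<alpha>1 i1 j3 * (b \<alpha>2 i2 j2 * (b \<alpha>3 i3 j1 * K i1
        i2 i3 j1 j2 j3))))"
    proof -
      have "b \<alpha>3 i3 j1 * (b \<alpha>2 i2 j2 * (b \<alpha>1 i1 j3 * K i3 i2 i1 j1 j2 j3)) = - (b \<alpha>1 i1 j3 * (b \<alpha>2
          i2 j2 * (b \<alpha>3 i3 j1 * K i1 i2 i3 j1 j2 j3)))"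
        for i1 i2 i3 j1 j2 j3
        using K'(3)[of i1 i2 i3 j1 j2 j3] by (simp add: mult_ac)
      then show ?thesis unfolding X_def by (subst Z321) (simp only:)
    qed
    show ?thesis
      unfolding 1 2 3 4 5 unfolding X_def Z_add[symmetric]
      by (simp add: algebra_simps)
  qed
  have 3: "mform m b 3 P us vs = (\<Sum>\<alpha>1<m. \<Sum>\<alpha>2<m. \<Sum>\<alpha>3<m. P [\<alpha>1, \<alpha>2, \<alpha>3] * mdet b [\<alpha>1, \<alpha>2, \<alpha>3] us
      vs)" for us vs
    by (simp add: mform_def numeral_eq_Suc del: mdet.simps)
  have "(\<Sum>i1\<in>E. \<Sum>i2\<in>E. \<Sum>j1\<in>E. \<Sum>j2\<in>E. \<Sum>i3\<in>E. \<Sum>j3\<in>E.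
       mform m b 3 P [i1, i2, i3] [j1, j2, j3] * mform m b 4 C [u, j1, j2, j3] [v, i1, i2, i3]) =
     Z (\<lambda>i1 i2 i3 j1 j2 j3. mform m b 3 P [i1, i2, i3] [j1, j2, j3] * K i1 i2 i3 j1 j2 j3)"
    unfolding Z_def K_def
    by (subst (2) sum.swap, subst (3) sum.swap) (rule refl)
  also have "\<dots> = Z (\<lambda>i1 i2 i3 j1 j2 j3. \<Sum>\<alpha>1<m. \<Sum>\<alpha>2<m. \<Sum>\<alpha>3<m. P [\<alpha>1, \<alpha>2, \<alpha>3] *
      (mdet b [\<alpha>1, \<alpha>2, \<alpha>3] [i1, i2, i3] [j1, j2, j3] * K i1 i2 i3 j1 j2 j3))"
    unfolding 3 by (simp only: sum_distrib_right mult.assoc)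
  also have "\<dots> = (\<Sum>\<alpha>1<m. \<Sum>\<alpha>2<m. \<Sum>\<alpha>3<m. P [\<alpha>1, \<alpha>2, \<alpha>3] *
      (X \<alpha>1 \<alpha>2 \<alpha>3 + X \<alpha>1 \<alpha>3 \<alpha>2 + X \<alpha>2 \<alpha>1 \<alpha>3 + X \<alpha>2 \<alpha>3 \<alpha>1 + X \<alpha>3 \<alpha>1 \<alpha>2 + X \<alpha>3 \<alpha>2 \<alpha>1))"
    by (simp only: Z_sum Z_mult X)
  also have "\<dots> = (\<Sum>\<alpha>1<m. \<Sum>\<alpha>2<m. \<Sum>\<alpha>3<m. \<Sum>\<beta><m. P [\<alpha>1, \<alpha>2, \<alpha>3] *
     (let Y = full_contraction_coeff n C \<beta> in
      Y \<alpha>1 \<alpha>2 \<alpha>3 + Y \<alpha>1 \<alpha>3 \<alpha>2 + Y \<alpha>2 \<alpha>1 \<alpha>3 + Y \<alpha>2 \<alpha>3 \<alpha>1 + Y \<alpha>3 \<alpha>1 \<alpha>2 + Y \<alpha>3 \<alpha>2 \<alpha>1) * b \<beta> u v)"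
  proof (intro sum.cong refl)
    fix \<alpha>1 \<alpha>2 \<alpha>3 assume \<alpha>: "\<alpha>1 \<in> {..<m}" "\<alpha>2 \<in> {..<m}" "\<alpha>3 \<in> {..<m}"
    have Y: "X \<alpha> \<beta> \<gamma> = (\<Sum>\<beta>0<m. full_contraction_coeff n C \<beta>0 \<alpha> \<beta> \<gamma> * b \<beta>0 u v)"
      if "\<alpha> < m" "\<beta> < m" "\<gamma> < m" for \<alpha> \<beta> \<gamma>
      unfolding X_def K_def Z_def using that by (rule sum_mform_full_contraction[OF E])
    show "P [\<alpha>1, \<alpha>2, \<alpha>3] *
      (X \<alpha>1 \<alpha>2 \<alpha>3 + X \<alpha>1 \<alpha>3 \<alpha>2 + X \<alpha>2 \<alpha>1 \<alpha>3 + X \<alpha>2 \<alpha>3 \<alpha>1 + X \<alpha>3 \<alpha>1 \<alpha>2 + X \<alpha>3 \<alpha>2 \<alpha>1) = (\<Sum>\<beta><m. P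
          [\<alpha>1, \<alpha>2, \<alpha>3] *
     (let Y = full_contraction_coeff n C \<beta> in
      Y \<alpha>1 \<alpha>2 \<alpha>3 + Y \<alpha>1 \<alpha>3 \<alpha>2 + Y \<alpha>2 \<alpha>1 \<alpha>3 + Y \<alpha>2 \<alpha>3 \<alpha>1 + Y \<alpha>3 \<alpha>1 \<alpha>2 + Y \<alpha>3 \<alpha>2 \<alpha>1) * b \<beta> u v)"
      using \<alpha> by (simp add: Y Let_def sum_distrib_left sum.distrib distrib_left distrib_right
          mult.assoc)
  qed
  also have "\<dots> = (\<Sum>\<beta><m. bach_coeff m n P C \<beta> * b \<beta> u v)"
  proof -
    have "(\<Sum>\<alpha>1<m. \<Sum>\<alpha>2<m. \<Sum>\<alpha>3<m. \<Sum>\<beta><m. F \<alpha>1 \<alpha>2 \<alpha>3 \<beta>) = (\<Sum>\<beta><m. \<Sum>\<alpha>1<m. \<Sum>\<alpha>2<m. \<Sum>\<alpha>3<m. F \<alpha>1 \<alpha>2 \<alpha>3 \<beta>)"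
      for F :: "nat \<Rightarrow> nat \<Rightarrow> nat \<Rightarrow> nat \<Rightarrow> real"
    proof -
      have "(\<Sum>\<alpha>1<m. \<Sum>\<alpha>2<m. \<Sum>\<alpha>3<m. \<Sum>\<beta><m. F \<alpha>1 \<alpha>2 \<alpha>3 \<beta>) = (\<Sum>\<alpha>1<m. \<Sum>\<alpha>2<m. \<Sum>\<beta><m. \<Sum>\<alpha>3<m. F \<alpha>1 \<alpha>2 \<alpha>3 \<beta>)"
        by (rule sum.cong[OF refl], rule sum.cong[OF refl], rule sum.swap)
      also have "\<dots> = (\<Sum>\<alpha>1<m. \<Sum>\<beta><m. \<Sum>\<alpha>2<m. \<Sum>\<alpha>3<m. F \<alpha>1 \<alpha>2 \<alpha>3 \<beta>)"
        by (rule sum.cong[OF refl], rule sum.swap)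
      also have "\<dots> = (\<Sum>\<beta><m. \<Sum>\<alpha>1<m. \<Sum>\<alpha>2<m. \<Sum>\<alpha>3<m. F \<alpha>1 \<alpha>2 \<alpha>3 \<beta>)"
        by (rule sum.swap)
      finally show ?thesis .
    qed
    then show ?thesis unfolding bach_coeff_def sum_distrib_right .
  qed
  finally show ?thesis .
qed

section \<open>The coefficients for two surfaces and a fourfold\<close>

lemma sum_lessThan_3: "(\<Sum>\<alpha><3. f \<alpha>) = f 0 + f (Suc 0) + f 2" for f :: "nat \<Rightarrow> 'a::comm_monoid_add"
  by (simp add: numeral_3_eq_3 numeral_2_eq_2)

definition factor_dim :: "nat \<Rightarrow> real" where
  "factor_dim \<alpha> = (if \<alpha> = 0 \<or> \<alpha> = Suc 0 then 2 else 4)"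

text \<open>Labels 0 and 1 are the two surfaces, label 2 the fourfold. Curvature times (dimension -
  1) is 3 for each of them, which makes the product Einstein.\<close>

definition factor_curvature :: "nat \<Rightarrow> real" where
  "factor_curvature \<alpha> = (if \<alpha> = 2 then 1 else 3)"

text \<open>On label lists violating this bound, \<^const>\<open>mdet\<close> vanishes on the product of two surfaces and
  a fourfold, so that their coefficients are junk.\<close>

definition admissible :: "nat list \<Rightarrow> bool" where
  "admissible \<alpha>s \<longleftrightarrow> count_list \<alpha>s 0 \<le> 2 \<and> count_list \<alpha>s (Suc 0) \<le> 2"

abbreviation "R4_coeff \<equiv> thorpe_coeff factor_curvature"
abbreviation "contract_coeff \<equiv> contraction_coeff 3 factor_dim"

text \<open>By cases on the labels; the value depends only on how many of them belong to each
  surface. It is restricted to admissible lists because it fails elsewhere: at [0, 0, 0] the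
  coefficient is -9.\<close>

lemma contract_R4_coeff:
  assumes "a \<in> {0, Suc 0, 2}" "b \<in> {0, Suc 0, 2}" "c \<in> {0, Suc 0, 2}" "admissible [a, b, c]"
  shows "contract_coeff R4_coeff [a, b, c] =
     (let p = count_list [a, b, c] 0; q = count_list [a, b, c] (Suc 0) in
      if p + q = 3 \<or> p + q = 2 \<and> p \<noteq> 1 then 3 else if p + q \<le> 1 then 1 else 0)"
  using assms unfolding contraction_coeff_def sum_lessThan_3 thorpe_coeff_def factor_dim_def
      factor_curvature_def
  by (elim insertE emptyE; simp add: admissible_def numeral_3_eq_3)

text \<open>If a = b is a surface, prefixing that label once more gives an inadmissible list, but
  its weight 2 - 2 is zero and the junk value does not enter.\<close>

lemma contract2_R4_coeff:
  assumes "a \<in> {0, Suc 0, 2}" "b \<in> {0, Suc 0, 2}"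
  shows "contract_coeff (contract_coeff R4_coeff) [a, b] = (if a = b \<and> a \<noteq> 2 then 18 else 6)"
  using assms unfolding contraction_coeff_def[of _ _ "contraction_coeff _ _ _"] sum_lessThan_3
  by (elim insertE emptyE; simp add: admissible_def contract_R4_coeff factor_dim_def)

lemma contract3_R4_coeff:
  assumes "a \<in> {0, Suc 0, 2}"
  shows "contract_coeff (contract_coeff (contract_coeff R4_coeff)) [a] = (if a = 2 then 42 else 54)"
  using assms unfolding contraction_coeff_def[of _ _ "contraction_coeff _ _ (contraction_coeff _ _
      _)"] sum_lessThan_3
  by (elim insertE emptyE; simp add: contract2_R4_coeff factor_dim_def)

lemma contract4_R4_coeff:
  "contract_coeff (contract_coeff (contract_coeff (contract_coeff R4_coeff))) [] = 384"
  unfolding contraction_coeff_def[of _ _ "contraction_coeff _ _ (contraction_coeff _ _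
      (contraction_coeff _ _ _))"] sum_lessThan_3
  by (simp add: contract3_R4_coeff factor_dim_def)

text \<open>Conjunctions suit evaluation at concrete labels; the nested conditionals of the
  definition suit the collapsing of sums, one variable at a time.\<close>

lemma thorpe_coeff_simp:
  "thorpe_coeff k [a, b, c, d] = ((if a = b \<and> c = d then k a * k c else 0) +
     (if a = c \<and> b = d then k a * k b else 0) + (if a = d \<and> b = c then k a * k b else 0)) / 3"
proof -
  have "(if P then if Q then x else 0 else 0) = (if P \<and> Q then x else (0::real))" for P Q x by simp
  moreover have "[a, b, c, d] ! 0 = a" "[a, b, c, d] ! 1 = b" "[a, b, c, d] ! 2 = c" "[a, b, c, d]
      ! 3 = d"
    by simp_all
  ultimately show ?thesis unfolding thorpe_coeff_def by (simp only:)
qed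

lemma insertion_coeff_simps:
  "insertion_coeff C [a] = C []"
  "insertion_coeff C [a, b] = C [b] + C [a]"
  "insertion_coeff C [a, b, c] = C [b, c] + C [a, c] + C [a, b]"
  "insertion_coeff C [a, b, c, d] = C [b, c, d] + C [a, c, d] + C [a, b, d] + C [a, b, c]"
  by (simp_all add: insertion_coeff_def)

text \<open>The first label is fixed to 0 because it becomes the label of the metric that survives
  the full contraction, and only the component along the first surface is evaluated.\<close>

lemma projection_R4_coeff:
  assumes "b \<in> {0, Suc 0, 2}" "c \<in> {0, Suc 0, 2}" "d \<in> {0, Suc 0, 2}"
    "admissible [0, b, c, d]"
  shows "projection_coeff 3 factor_dim R4_coeff [0, b, c, d] =
     (let p = count_list [0, b, c, d] 0; q = count_list [0, b, c, d] (Suc 0) in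
      if p + q = 0 \<or> p + q = 4 then 6 / 5 else if even (p + q) then 1 / 5 else - 3 / 10)"
proof -
  let ?C1 = "contract_coeff R4_coeff"
  let ?C2 = "contract_coeff ?C1"
  let ?C3 = "contract_coeff ?C2"
  \<comment> \<open>Deleting r of the four labels one at a time reaches each sublist r! times, so
    the factor 1 / (r! (r+1)!) becomes 1 / (r+1)!.\<close>
  have "projection_coeff 3 factor_dim R4_coeff [0, b, c, d] = R4_coeff [0, b, c, d]
     - 1 / 2 * (?C1 [b, c, d] + ?C1 [0, c, d] + ?C1 [0, b, d] + ?C1 [0, b, c])
     + 1 / 6 * (?C2 [0, b] + ?C2 [0, c] + ?C2 [0, d] + ?C2 [b, c] + ?C2 [b, d] + ?C2 [c, d])
     - 1 / 24 * (?C3 [0] + ?C3 [b] + ?C3 [c] + ?C3 [d]) + 1 / 120 * contract_coeff ?C3 []"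
    by (simp add: projection_coeff_def numeral_eq_Suc fact_numeral insertion_coeff_simps
        field_simps)
  also have "\<dots> = (let p = count_list [0, b, c, d] 0; q = count_list [0, b, c, d] (Suc 0) in
      if p + q = 0 \<or> p + q = 4 then 6 / 5 else if even (p + q) then 1 / 5 else - 3 / 10)"
    using assms
    by (elim insertE emptyE; simp add: admissible_def contract_R4_coeff contract2_R4_coeff
        contract3_R4_coeff contract4_R4_coeff thorpe_coeff_simp factor_curvature_def)
  finally show ?thesis .
qed

text \<open>Inadmissible lists meet a zero weight in \<open>full_contraction_coeff\<close>, so only
  the coefficients computed above contribute. With the factor -1/6 of the Bach tensor the value
  becomes -72/5.\<close>

lemma bach_coeff_0:
  "bach_coeff 3 factor_dim (contract_coeff R4_coeff) (projection_coeff 3 factor_dim R4_coeff) 0 =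
      432 / 5"
  unfolding bach_coeff_def sum_lessThan_3 Let_def full_contraction_coeff_def
  by (simp add: contract_R4_coeff projection_R4_coeff admissible_def factor_dim_def)

section \<open>Second derivatives and linear systems\<close>

lemma times_differentiable_onD:
  assumes "times_differentiable_on (Suc k) U f" "open U" "x \<in> U"
  shows "(f has_derivative frechet_derivative f (at x)) (at x)"
proof -
  have "f differentiable_on U"
    using assms(1) unfolding times_differentiable_on.simps by (rule conjunct1)
  then have "f differentiable (at x within U)"
    using assms(3) unfolding differentiable_on_def by blast
  then have "f differentiable (at x)"
    unfolding at_within_open[OF assms(3,2)] .
  then show ?thesis by (rule frechet_derivative_works[THEN iffD1])
qed

lemma has_real_derivative_along_line:
  fixes f :: "'a::real_normed_vector \<Rightarrow> real"
  assumes "(f has_derivative f') (at (a + t *\<^sub>R u))"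
  shows "((\<lambda>s. f (a + s *\<^sub>R u)) has_real_derivative f' u) (at t)"
proof -
  have "((\<lambda>s. f (a + s *\<^sub>R u)) has_derivative (\<lambda>s. f' (s *\<^sub>R u))) (at t)"
    by (rule has_derivative_compose[where f = "\<lambda>s. a + s *\<^sub>R u" and g = f, OF _ assms])
      (auto intro!: derivative_eq_intros)
  then show ?thesis
    using linear_scale[OF has_derivative_linear[OF assms]]
    by (simp add: has_field_derivative_def mult.commute[of "f' u"] mult_commute_abs)
qed

text \<open>Both mixed derivatives are limits of the same second difference quotient.\<close>

lemma second_difference_mvt:
  fixes f :: "'a::euclidean_space \<Rightarrow> real"
  assumes f: "\<And>y. y \<in> U \<Longrightarrow> (f has_derivative f' y) (at y)"
    and f': "\<And>y. y \<in> U \<Longrightarrow> ((\<lambda>z. f' z u) has_derivative f'' y) (at y)"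
    and t: "0 < t" and U: "\<And>r s. 0 \<le> r \<Longrightarrow> r \<le> t \<Longrightarrow> 0 \<le> s \<Longrightarrow> s \<le> t \<Longrightarrow> x + r *\<^sub>R u + s *\<^sub>R v \<in> U"
  obtains r s where "0 < r" "r < t" "0 < s" "s < t"
    "f (x + t *\<^sub>R u + t *\<^sub>R v) - f (x + t *\<^sub>R u) - f (x + t *\<^sub>R v) + f x = t * t * f'' (x + r *\<^sub>R
        u + s *\<^sub>R v) v"
proof -
  have 1: "((\<lambda>r. f (x + r *\<^sub>R u + s *\<^sub>R v)) has_real_derivative f' (x + r *\<^sub>R u + s *\<^sub>R v) u) (at
      r)"
    if "0 \<le> r" "r \<le> t" "0 \<le> s" "s \<le> t" for r s
    using has_real_derivative_along_line[of f "f' (x + r *\<^sub>R u + s *\<^sub>R v)" "x + s *\<^sub>R v" r u] f[OF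
        U] that
    by (simp add: algebra_simps)
  have "\<exists>r>0. r < t \<and> (f (x + t *\<^sub>R u + t *\<^sub>R v) - f (x + t *\<^sub>R u)) - (f (x + 0 *\<^sub>R u + t *\<^sub>R v) -
      f (x + 0 *\<^sub>R u)) =
      (t - 0) * (f' (x + r *\<^sub>R u + t *\<^sub>R v) u - f' (x + r *\<^sub>R u) u)"
    using 1[of _ t] 1[of _ 0] t
    by (intro MVT2[where f = "\<lambda>r. f (x + r *\<^sub>R u + t *\<^sub>R v) - f (x + r *\<^sub>R u)"]) (auto intro!:
        DERIV_diff)
  then obtain r where r: "0 < r" "r < t" 
    "f (x + t *\<^sub>R u + t *\<^sub>R v) - f (x + t *\<^sub>R u) - f (x + t *\<^sub>R v) + f x = t * (f' (x + r *\<^sub>R u +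
        t *\<^sub>R v) u - f' (x + r *\<^sub>R u) u)"
    by auto
  have "((\<lambda>s. f' (x + r *\<^sub>R u + s *\<^sub>R v) u) has_real_derivative f'' (x + r *\<^sub>R u + s *\<^sub>R v) v) (at
      s)"
    if "0 \<le> s" "s \<le> t" for s
    using has_real_derivative_along_line[of "\<lambda>z. f' z u" "f'' (x + r *\<^sub>R u + s *\<^sub>R v)" "x + r *\<^sub>R
        u" s v] f'[OF U] r that
    by (simp add: algebra_simps)
  \<comment> \<open>The mean value theorem along u left a difference of first derivatives; it is now
    applied to that difference along v.\<close>
  then have "\<exists>s>0. s < t \<and> f' (x + r *\<^sub>R u + t *\<^sub>R v) u - f' (x + r *\<^sub>R u + 0 *\<^sub>R v) u =
      (t - 0) * f'' (x + r *\<^sub>R u + s *\<^sub>R v) v"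
    using t by (intro MVT2[where f = "\<lambda>s. f' (x + r *\<^sub>R u + s *\<^sub>R v) u"]) auto
  then show ?thesis using r that by (auto simp: mult.assoc)
qed

lemma mixed_derivatives_commute_real:
  fixes f :: "'a::euclidean_space \<Rightarrow> real"
  assumes f: "\<And>y. y \<in> U \<Longrightarrow> (f has_derivative f' y) (at y)"
    and f': "\<And>y w. y \<in> U \<Longrightarrow> ((\<lambda>z. f' z w) has_derivative f'' y w) (at y)"
    and cont: "\<And>w z. continuous_on U (\<lambda>y. f'' y w z)"
    and U: "open U" "x \<in> U"
  shows "f'' x u v = f'' x v u"
proof (rule ccontr)
  assume ne: "f'' x u v \<noteq> f'' x v u"
  \<comment> \<open>Half the gap: numbers within e of the two mixed derivatives cannot
    coincide.\<close>
  define e where "e = \<bar>f'' x u v - f'' x v u\<bar> / 2"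
  have e: "e > 0" using ne by (simp add: e_def)
  have isC: "isCont (\<lambda>y. f'' y w z) x" for w z
    using cont U by (auto simp: continuous_on_eq_continuous_at)
  obtain d1 where d1: "d1 > 0" "\<And>y. dist y x < d1 \<Longrightarrow> \<bar>f'' y u v - f'' x u v\<bar> < e"
    using isC[of u v] e unfolding continuous_at_eps_delta by (auto simp: dist_real_def)
  obtain d2 where d2: "d2 > 0" "\<And>y. dist y x < d2 \<Longrightarrow> \<bar>f'' y v u - f'' x v u\<bar> < e"
    using isC[of v u] e unfolding continuous_at_eps_delta by (auto simp: dist_real_def)
  obtain d3 where d3: "d3 > 0" "ball x d3 \<subseteq> U"
    using U openE by blast
  define d where "d = min d1 (min d2 d3)"
  \<comment> \<open>With this t the whole parallelogram spanned by t u and t v at x stays within d /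
    2 of x; the summand 1 covers u = v = 0.\<close>
  define t where "t = d / (2 * (norm u + norm v + 1))"
  have n: "norm u + norm v + 1 > 0" by (simp add: add_nonneg_pos)
  have d: "d > 0" using d1 d2 d3 by (simp add: d_def)
  have t: "t > 0" using d n by (simp add: t_def)
  have near: "dist (x + r *\<^sub>R u + s *\<^sub>R v) x < d" if "0 \<le> r" "r \<le> t" "0 \<le> s" "s \<le> t" for r s
  proof -
    have "dist (x + r *\<^sub>R u + s *\<^sub>R v) x = norm (r *\<^sub>R u + s *\<^sub>R v)"
      by (simp add: dist_norm algebra_simps)
    also have "\<dots> \<le> r * norm u + s * norm v"
      using that norm_triangle_ineq[of "r *\<^sub>R u" "s *\<^sub>R v"] by simp
    also have "\<dots> \<le> t * norm u + t * norm v"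
      using that by (intro add_mono mult_right_mono) auto
    also have "\<dots> \<le> t * (norm u + norm v + 1)" using t by (simp add: algebra_simps)
    also have "\<dots> = d / 2" using n by (simp add: t_def field_simps)
    also have "\<dots> < d" using d by simp
    finally show ?thesis .
  qed
  have inU: "x + r *\<^sub>R u + s *\<^sub>R v \<in> U" if "0 \<le> r" "r \<le> t" "0 \<le> s" "s \<le> t" for r s
    using near[OF that] d3 by (auto simp: d_def dist_commute)
  obtain r s where rs: "0 < r" "r < t" "0 < s" "s < t"
    "f (x + t *\<^sub>R u + t *\<^sub>R v) - f (x + t *\<^sub>R u) - f (x + t *\<^sub>R v) + f x = t * t * f'' (x + r *\<^sub>R
        u + s *\<^sub>R v) u v"
    by (rule second_difference_mvt[where v = v and x = x and u = u, OF f f' t inU])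
  have inU': "x + r *\<^sub>R v + s *\<^sub>R u \<in> U" if "0 \<le> r" "r \<le> t" "0 \<le> s" "s \<le> t" for r s
    using inU[of s r] that by (simp add: algebra_simps)
  obtain r' s' where rs': "0 < r'" "r' < t" "0 < s'" "s' < t"
    "f (x + t *\<^sub>R v + t *\<^sub>R u) - f (x + t *\<^sub>R v) - f (x + t *\<^sub>R u) + f x = t * t * f'' (x + r' *\<^sub>R
        v + s' *\<^sub>R u) v u"
    by (rule second_difference_mvt[where v = u and x = x and u = v, OF f f' t inU'])
  have swap: "x + t *\<^sub>R v + t *\<^sub>R u = x + t *\<^sub>R u + t *\<^sub>R v" by (simp add: algebra_simps)
  have "t * t * f'' (x + r *\<^sub>R u + s *\<^sub>R v) u v = t * t * f'' (x + r' *\<^sub>R v + s' *\<^sub>R u) v u"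
    using rs(5) rs'(5)[unfolded swap] by linarith
  then have eq: "f'' (x + r *\<^sub>R u + s *\<^sub>R v) u v = f'' (x + s' *\<^sub>R u + r' *\<^sub>R v) v u"
    using t by (simp add: algebra_simps)
  have "\<bar>f'' (x + r *\<^sub>R u + s *\<^sub>R v) u v - f'' x u v\<bar> < e"
    using near[of r s] rs by (intro d1(2)) (simp add: d_def)
  moreover have "\<bar>f'' (x + s' *\<^sub>R u + r' *\<^sub>R v) v u - f'' x v u\<bar> < e"
    using near[of s' r'] rs' by (intro d2(2)) (simp add: d_def)
  ultimately show False using eq by (simp add: e_def abs_if split: if_splits)
qed

lemma frechet_derivative_commute:
  fixes f :: "'a::euclidean_space \<Rightarrow> 'b::euclidean_space"
  assumes f: "times_differentiable_on (Suc (Suc 0)) U f" and U: "open U" "x \<in> U"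
  shows "frechet_derivative (\<lambda>y. frechet_derivative f (at y) v) (at x) u =
         frechet_derivative (\<lambda>y. frechet_derivative f (at y) u) (at x) v"
proof (rule euclidean_eqI)
  fix i :: 'b assume "i \<in> Basis"
  let ?f' = "\<lambda>y. frechet_derivative f (at y)"
  let ?f'' = "\<lambda>y w. frechet_derivative (\<lambda>z. frechet_derivative f (at z) w) (at y)"
  have 1: "(f has_derivative ?f' y) (at y)" if "y \<in> U" for y
    using times_differentiable_onD[OF f U(1) that] .
  have 2: "((\<lambda>z. ?f' z w) has_derivative ?f'' y w) (at y)" if "y \<in> U" for y w
    using f U(1) that by (intro times_differentiable_onD[where k = 0]) auto
  have "?f'' x v u \<bullet> i = ?f'' x u v \<bullet> i"
  proof (rule mixed_derivatives_commute_real[where f = "\<lambda>y. f y \<bullet> i" and f' = "\<lambda>y w. ?f' y w \<bullet> i"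
      and U = U])
    show "((\<lambda>y. f y \<bullet> i) has_derivative (\<lambda>w. ?f' y w \<bullet> i)) (at y)" if "y \<in> U" for y
      by (intro has_derivative_inner_left 1 that)
    show "((\<lambda>y. ?f' y w \<bullet> i) has_derivative (\<lambda>z. ?f'' y w z \<bullet> i)) (at y)" if "y \<in> U" for y w
      by (intro has_derivative_inner_left 2 that)
    show "continuous_on U (\<lambda>y. ?f'' y w z \<bullet> i)" for w z
      using f by (intro continuous_intros) auto
  qed (use U in auto)
  then show "frechet_derivative (\<lambda>y. ?f' y v) (at x) u \<bullet> i = frechet_derivative (\<lambda>y. ?f' y u) (at
      x) v \<bullet> i" .
qed

text \<open>The product rule would add a multiple of \<beta> x = 0 by the derivative of p, so
  continuity of p can take the place of its differentiability.\<close>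

lemma has_derivative_scaleR_vanishing:
  fixes \<beta> :: "'a::real_normed_vector \<Rightarrow> 'b::real_normed_vector"
  assumes p: "isCont p x" and \<beta>: "(\<beta> has_derivative \<beta>') (at x)" and 0: "\<beta> x = 0"
  shows "((\<lambda>y. p y *\<^sub>R \<beta> y) has_derivative (\<lambda>h. p x *\<^sub>R \<beta>' h)) (at x)"
proof -
  have bl: "bounded_linear \<beta>'" using \<beta> by (rule has_derivative_bounded_linear)
  obtain K where K: "\<And>h. norm (\<beta>' h) \<le> norm h * K" using bounded_linear.bounded[OF bl] by blast
  have lim: "((\<lambda>h. norm (\<beta> (x + h) - \<beta> x - \<beta>' h) / norm h) \<longlongrightarrow> 0) (at 0)"
    using \<beta> by (simp add: has_derivative_at)
  have p0: "((\<lambda>h. p (x + h)) \<longlongrightarrow> p x) (at 0)"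
    using p by (simp add: isCont_iff)
  have "((\<lambda>h. \<bar>p (x + h)\<bar> * (norm (\<beta> (x + h) - \<beta> x - \<beta>' h) / norm h) + \<bar>p (x + h) - p x\<bar> * K) \<longlongrightarrow> \<bar>p
      x\<bar> * 0 + \<bar>p x - p x\<bar> * K) (at 0)"
    by (intro tendsto_intros lim p0)
  then have lim2: "((\<lambda>h. \<bar>p (x + h)\<bar> * (norm (\<beta> (x + h) - \<beta> x - \<beta>' h) / norm h) + \<bar>p (x + h) - p
      x\<bar> * K) \<longlongrightarrow> 0) (at 0)"
    by simp
  have bound: "norm (p (x + h) *\<^sub>R \<beta> (x + h) - p x *\<^sub>R \<beta> x - p x *\<^sub>R \<beta>' h) / norm h
     \<le> \<bar>p (x + h)\<bar> * (norm (\<beta> (x + h) - \<beta> x - \<beta>' h) / norm h) + \<bar>p (x + h) - p x\<bar> * K" if "h \<noteq> 0"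
         for h
  proof -
    have "p (x + h) *\<^sub>R \<beta> (x + h) - p x *\<^sub>R \<beta> x - p x *\<^sub>R \<beta>' h =
      p (x + h) *\<^sub>R (\<beta> (x + h) - \<beta> x - \<beta>' h) + (p (x + h) - p x) *\<^sub>R \<beta>' h"
      by (simp add: 0 algebra_simps)
    also have "norm \<dots> \<le> \<bar>p (x + h)\<bar> * norm (\<beta> (x + h) - \<beta> x - \<beta>' h) + \<bar>p (x + h) - p x\<bar> * (norm h
        * K)"
      using K by (intro norm_triangle_le add_mono) (auto intro!: mult_left_mono)
    finally show ?thesis using that by (simp add: field_simps)
  qed
  have "((\<lambda>h. norm (p (x + h) *\<^sub>R \<beta> (x + h) - p x *\<^sub>R \<beta> x - p x *\<^sub>R \<beta>' h) / norm h) \<longlongrightarrow> 0) (at 0)"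
  proof (rule tendsto_sandwich[OF _ _ tendsto_const lim2])
    show "\<forall>\<^sub>F h in at 0. 0 \<le> norm (p (x + h) *\<^sub>R \<beta> (x + h) - p x *\<^sub>R \<beta> x - p x *\<^sub>R \<beta>' h) / norm h"
        by simp
    show "\<forall>\<^sub>F h in at 0. norm (p (x + h) *\<^sub>R \<beta> (x + h) - p x *\<^sub>R \<beta> x - p x *\<^sub>R \<beta>' h) / norm h
     \<le> \<bar>p (x + h)\<bar> * (norm (\<beta> (x + h) - \<beta> x - \<beta>' h) / norm h) + \<bar>p (x + h) - p x\<bar> * K"
      unfolding eventually_at_filter by (intro always_eventually allI impI bound) auto
  qed
  then show ?thesis
    unfolding has_derivative_at using bl by (auto intro!: bounded_linear_intros)
qed

text \<open>With a left inverse \<open>L\<close> of \<open>A x\<close>, the solution satisfies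
  \<open>\<gamma> y = L (c y) - L ((A y - A x) (\<gamma> y))\<close>; this first bounds \<open>\<gamma>\<close> near \<open>x\<close>, then shows
  its continuity and finally its differentiability at \<open>x\<close>.\<close>

lemma linear_system_solution_differentiable:
  fixes A :: "'a::euclidean_space \<Rightarrow> 'b::euclidean_space \<Rightarrow> 'c::euclidean_space"
  assumes U: "open U" "x \<in> U" and lin: "\<And>y. y \<in> U \<Longrightarrow> linear (A y)" and inj: "inj (A x)"
    and A: "\<And>v. (\<lambda>y. A y v) differentiable (at x)" and c: "c differentiable (at x)"
    and eq: "\<And>y. y \<in> U \<Longrightarrow> A y (\<gamma> y) = c y"
  shows "\<gamma> differentiable (at x)"
proof -
  obtain L where L: "linear L" "L \<circ> A x = id"
    using linear_injective_left_inverse[OF lin[OF U(2)] inj] by blast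
  have blL: "bounded_linear L" using L(1) by (simp add: linear_linear)
  have LA: "L (A x v) = v" for v using fun_cong[OF L(2), of v] by simp
  \<comment> \<open>The error made by freezing A at x, seen through L; it vanishes at y = x.\<close>
  define \<beta> where "\<beta> b y = L (A y b - A x b)" for b y
  have d\<beta>: "\<beta> b differentiable (at x)" for b
  proof -
    obtain D where "((\<lambda>y. A y b) has_derivative D) (at x)" using A[of b] by (auto simp:
        differentiable_def)
    from has_derivative_diff[OF this has_derivative_const[of "A x b"]]
    have "((\<lambda>y. A y b - A x b) has_derivative D) (at x)" by simp
    then show ?thesis
      unfolding \<beta>_def differentiable_def using bounded_linear.has_derivative[OF blL] by blast
  qed
  have \<beta>0: "\<beta> b x = 0" for b using L(1) by (simp add: \<beta>_def linear_0)
  have c\<beta>: "isCont (\<beta> b) x" for b using d\<beta> by (rule differentiable_imp_continuous_within)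
  have dLc: "(\<lambda>y. L (c y)) differentiable (at x)"
    using c bounded_linear.has_derivative[OF blL] unfolding differentiable_def by blast
  have cLc: "isCont (\<lambda>y. L (c y)) x" using dLc by (rule differentiable_imp_continuous_within)
  have \<gamma>: "\<gamma> y = L (c y) - (\<Sum>b\<in>Basis. (\<gamma> y \<bullet> b) *\<^sub>R \<beta> b y)" if "y \<in> U" for y
  proof -
    have "(\<Sum>b\<in>Basis. (\<gamma> y \<bullet> b) *\<^sub>R \<beta> b y) = L (\<Sum>b\<in>Basis. (\<gamma> y \<bullet> b) *\<^sub>R A y b) - L (\<Sum>b\<in>Basis. (\<gamma> y
        \<bullet> b) *\<^sub>R A x b)"
      unfolding \<beta>_def by (simp add: linear_sum[OF L(1)] linear_scale[OF L(1)] linear_diff[OF L(1)]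
          algebra_simps sum_subtractf)
    also have "(\<Sum>b\<in>Basis. (\<gamma> y \<bullet> b) *\<^sub>R A y b) = A y (\<gamma> y)"
      using linear_sum[OF lin[OF that], of "\<lambda>b. (\<gamma> y \<bullet> b) *\<^sub>R b" Basis]
      by (simp add: linear_scale[OF lin[OF that]] euclidean_representation)
    also have "(\<Sum>b\<in>Basis. (\<gamma> y \<bullet> b) *\<^sub>R A x b) = A x (\<gamma> y)"
      using linear_sum[OF lin[OF U(2)], of "\<lambda>b. (\<gamma> y \<bullet> b) *\<^sub>R b" Basis]
      by (simp add: linear_scale[OF lin[OF U(2)]] euclidean_representation)
    finally show ?thesis using eq[OF that] LA by simp
  qed
  define S where "S y = (\<Sum>b\<in>Basis. norm (\<beta> b y))" for y
  have S0: "(S \<longlongrightarrow> 0) (at x)"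
  proof -
    have "isCont S x" unfolding S_def by (intro continuous_intros c\<beta>)
    then show ?thesis by (simp add: isCont_def S_def \<beta>0)
  qed
  have bound: "norm (\<gamma> y - L (c y)) \<le> norm (\<gamma> y) * S y" if "y \<in> U" for y
  proof -
    have "norm (\<gamma> y - L (c y)) = norm (\<Sum>b\<in>Basis. (\<gamma> y \<bullet> b) *\<^sub>R \<beta> b y)"
      by (subst \<gamma>[OF that]) simp
    also have "\<dots> \<le> (\<Sum>b\<in>Basis. norm (\<gamma> y) * norm (\<beta> b y))"
      by (intro sum_norm_le) (auto intro!: mult_right_mono Basis_le_norm)
    finally show ?thesis by (simp add: S_def sum_distrib_left)
  qed
  have evU: "\<forall>\<^sub>F y in at x. y \<in> U" using U by (rule eventually_at_in_open')
  \<comment> \<open>Where S y is below 1/2, the term norm (\<gamma> y) * S y can be absorbed, so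
    \<gamma> y is bounded by 2 norm (L (c y)).\<close>
  have evS: "\<forall>\<^sub>F y in at x. S y < 1 / 2" using S0 by (rule order_tendstoD) simp
  have ev: "\<forall>\<^sub>F y in at x. norm (\<gamma> y - L (c y)) \<le> 2 * norm (L (c y)) * S y"
    using evU evS
  proof eventually_elim
    case (elim y)
    have S: "S y \<ge> 0" by (simp add: S_def sum_nonneg)
    have "norm (\<gamma> y) \<le> norm (\<gamma> y - L (c y)) + norm (L (c y))" using norm_triangle_ineq[of "\<gamma> y - L
        (c y)" "L (c y)"] by simp
    also have "\<dots> \<le> norm (\<gamma> y) * S y + norm (L (c y))" using bound[OF elim(1)] by simp
    also have "\<dots> \<le> norm (\<gamma> y) * (1 / 2) + norm (L (c y))" using elim(2) by (intro add_right_mono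
        mult_left_mono) auto
    finally have "norm (\<gamma> y) \<le> 2 * norm (L (c y))" by simp
    then show ?case using bound[OF elim(1)] mult_right_mono[OF _ S, of "norm (\<gamma> y)" "2 * norm (L
        (c y))"] by linarith
  qed
  have "((\<lambda>y. 2 * norm (L (c y)) * S y) \<longlongrightarrow> 2 * norm (L (c x)) * 0) (at x)"
    using cLc by (intro tendsto_intros S0) (simp add: isCont_def)
  then have "((\<lambda>y. \<gamma> y - L (c y)) \<longlongrightarrow> 0) (at x)"
    by (intro Lim_null_comparison[OF ev]) simp
  then have "((\<lambda>y. (\<gamma> y - L (c y)) + L (c y)) \<longlongrightarrow> 0 + L (c x)) (at x)"
    using cLc by (intro tendsto_add) (simp_all add: isCont_def)
  moreover have "\<gamma> x = L (c x)" using LA[of "\<gamma> x"] by (simp add: eq[OF U(2)])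
  ultimately have cont: "isCont \<gamma> x" by (simp add: isCont_def)
  obtain Dc where Dc: "((\<lambda>y. L (c y)) has_derivative Dc) (at x)" using dLc by (auto simp:
      differentiable_def)
  define D\<beta> where "D\<beta> b = frechet_derivative (\<beta> b) (at x)" for b
  have D\<beta>: "(\<beta> b has_derivative D\<beta> b) (at x)" for b
    unfolding D\<beta>_def using d\<beta> by (rule frechet_derivative_works[THEN iffD1])
  \<comment> \<open>The coordinates of \<gamma> are so far only continuous at x, but each multiplies
    a \<beta> b that vanishes there.\<close>
  have "((\<lambda>y. L (c y) - (\<Sum>b\<in>Basis. (\<gamma> y \<bullet> b) *\<^sub>R \<beta> b y)) has_derivative
      (\<lambda>h. Dc h - (\<Sum>b\<in>Basis. (\<gamma> x \<bullet> b) *\<^sub>R D\<beta> b h))) (at x)"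
    using cont by (intro has_derivative_diff Dc has_derivative_sum has_derivative_scaleR_vanishing
        D\<beta> \<beta>0 continuous_intros) 
  then have "(\<gamma> has_derivative (\<lambda>h. Dc h - (\<Sum>b\<in>Basis. (\<gamma> x \<bullet> b) *\<^sub>R D\<beta> b h))) (at x)"
    by (rule has_derivative_transform_within_open[OF _ U]) (simp add: \<gamma>[symmetric])
  then show ?thesis by (auto simp: differentiable_def)
qed

section \<open>Parametrized products of spheres\<close>

text \<open>\<open>Q\<close> \<alpha> is the orthogonal projection onto the ambient space of factor
  \<alpha>. Projections treat all factors uniformly, however the product type is nested.\<close>

locale sphere_product =
  fixes Q :: "nat \<Rightarrow> 'e::euclidean_space \<Rightarrow> 'e" and k :: "nat \<Rightarrow> real" and m :: nat
  assumes Q: "\<And>\<alpha>. linear (Q \<alpha>)"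
    and Q_adj: "\<And>\<alpha> u v. Q \<alpha> u \<bullet> v = u \<bullet> Q \<alpha> v"
    and Q_Q: "\<And>\<alpha> \<beta> u. \<alpha> < m \<Longrightarrow> \<beta> < m \<Longrightarrow> Q \<alpha> (Q \<beta> u) = (if \<alpha> = \<beta> then Q \<alpha> u else 0)"
    and Q_sum: "\<And>u. (\<Sum>\<alpha><m. Q \<alpha> u) = u"
    and k: "\<And>\<alpha>. \<alpha> < m \<Longrightarrow> k \<alpha> > 0"
begin

lemma bounded_linear_Q: "bounded_linear (Q \<alpha>)"
  using Q by (simp add: linear_linear)

lemma Q_inner_Q: "\<alpha> < m \<Longrightarrow> \<beta> < m \<Longrightarrow> Q \<alpha> u \<bullet> Q \<beta> v = (if \<alpha> = \<beta> then u \<bullet> Q \<alpha> v else 0)"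
  by (simp add: Q_adj Q_Q)

end

text \<open>An arbitrary chart of the product. As the codimension is m, the m orthogonal vectors
  \<open>Q\<close> \<alpha> \<open>(f x)\<close> span the normal space.\<close>

locale product_param = sphere_product Q k m
  for Q :: "nat \<Rightarrow> 'e::euclidean_space \<Rightarrow> 'e" and k :: "nat \<Rightarrow> real" and m :: nat +
  fixes f :: "'m::euclidean_space \<Rightarrow> 'e" and U :: "'m set"
  assumes U: "open U" and smooth: "smooth_on U f"
    and inj: "\<And>x. x \<in> U \<Longrightarrow> inj (frechet_derivative f (at x))"
    and dim: "DIM('e) = DIM('m) + m"
    and sphere: "\<And>x \<alpha>. x \<in> U \<Longrightarrow> \<alpha> < m \<Longrightarrow> k \<alpha> * (f x \<bullet> Q \<alpha> (f x)) = 1"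
begin

definition D1 :: "'m \<Rightarrow> 'm \<Rightarrow> 'e" where "D1 x = frechet_derivative f (at x)"
definition D2 :: "'m \<Rightarrow> 'm \<Rightarrow> 'm \<Rightarrow> 'e" where "D2 x u v = frechet_derivative (\<lambda>y. D1 y v) (at x) u"
definition D3 :: "'m \<Rightarrow> 'm \<Rightarrow> 'm \<Rightarrow> 'm \<Rightarrow> 'e" where
  "D3 x u v w = frechet_derivative (\<lambda>y. D2 y v w) (at x) u"

definition factor_metric :: "'m \<Rightarrow> nat \<Rightarrow> 'm \<Rightarrow> 'm \<Rightarrow> real" where
  "factor_metric x \<alpha> u v = D1 x u \<bullet> Q \<alpha> (D1 x v)"

abbreviation "g \<equiv> induced_metric f"

lemma g_D1: "g x u v = D1 x u \<bullet> D1 x v"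
  by (simp add: induced_metric_def D1_def)

lemma g_sum: "g x u v = (\<Sum>\<alpha><m. factor_metric x \<alpha> u v)"
  by (simp add: g_D1 factor_metric_def inner_sum_right[symmetric] Q_sum)

lemma times_diff: "times_differentiable_on n U f"
  using smooth by (simp add: smooth_on_def)

lemma D1_deriv: "x \<in> U \<Longrightarrow> (f has_derivative D1 x) (at x)"
  unfolding D1_def using times_differentiable_onD[OF times_diff U] .

lemma times_diff_D1: "times_differentiable_on n U (\<lambda>y. D1 y v)"
  unfolding D1_def using times_diff[of "Suc n"] by simp

lemma D2_deriv: "x \<in> U \<Longrightarrow> ((\<lambda>y. D1 y v) has_derivative (\<lambda>u. D2 x u v)) (at x)"
  unfolding D2_def using times_differentiable_onD[OF times_diff_D1 U] .

lemma times_diff_D2: "times_differentiable_on n U (\<lambda>y. D2 y u v)"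
  unfolding D2_def using times_diff_D1[of "Suc n"] by simp

lemma D3_deriv: "x \<in> U \<Longrightarrow> ((\<lambda>y. D2 y v w) has_derivative (\<lambda>u. D3 x u v w)) (at x)"
  unfolding D3_def using times_differentiable_onD[OF times_diff_D2 U] .

lemma D2_sym: "x \<in> U \<Longrightarrow> D2 x u v = D2 x v u"
  unfolding D2_def D1_def by (rule frechet_derivative_commute[OF times_diff U])

lemma D3_sym: "x \<in> U \<Longrightarrow> D3 x u v w = D3 x v u w"
  unfolding D3_def D2_def by (rule frechet_derivative_commute[OF times_diff_D1 U])

lemma linear_D1: "x \<in> U \<Longrightarrow> linear (D1 x)"
  using D1_deriv by (rule has_derivative_linear)

lemma linear_D2_left: "x \<in> U \<Longrightarrow> linear (\<lambda>u. D2 x u v)"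
  using D2_deriv by (rule has_derivative_linear)

lemma linear_D2_right: "x \<in> U \<Longrightarrow> linear (D2 x u)"
proof -
  assume x: "x \<in> U"
  have "D2 x u = (\<lambda>v. D2 x v u)" using x by (intro ext D2_sym)
  then show "linear (D2 x u)" using linear_D2_left[OF x, of u] by (simp only:)
qed

lemma inj_D1: "x \<in> U \<Longrightarrow> inj (D1 x)"
  using inj by (simp add: D1_def)

lemma D1_eq_0: "x \<in> U \<Longrightarrow> D1 x u = 0 \<longleftrightarrow> u = 0"
  using inj_D1[of x] linear_injective_0[OF linear_D1[of x]] linear_0[OF linear_D1[of x]] by auto

lemma tangent:
  assumes x: "x \<in> U" and \<alpha>: "\<alpha> < m"
  shows "D1 x u \<bullet> Q \<alpha> (f x) = 0"
proof -
  have 1: "f y \<bullet> Q \<alpha> (f y) = 1 / k \<alpha>" if "y \<in> U" for y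
    using sphere[OF that \<alpha>] k[OF \<alpha>] by (simp add: field_simps)
  have "((\<lambda>y. f y \<bullet> Q \<alpha> (f y)) has_derivative (\<lambda>h. f x \<bullet> Q \<alpha> (D1 x h) + D1 x h \<bullet> Q \<alpha> (f x))) (at x)"
    by (rule has_derivative_inner[OF D1_deriv[OF x] bounded_linear.has_derivative[OF
        bounded_linear_Q D1_deriv[OF x]]])
  moreover have "((\<lambda>y. f y \<bullet> Q \<alpha> (f y)) has_derivative (\<lambda>h. 0)) (at x)"
    by (rule has_derivative_transform_within_open[OF has_derivative_const[of "1 / k \<alpha>"] U x])
       (simp add: 1)
  ultimately have "(\<lambda>h. f x \<bullet> Q \<alpha> (D1 x h) + D1 x h \<bullet> Q \<alpha> (f x)) = (\<lambda>h. 0)"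
    by (rule has_derivative_unique)
  from fun_cong[OF this, of u] have "f x \<bullet> Q \<alpha> (D1 x u) + D1 x u \<bullet> Q \<alpha> (f x) = 0" .
  then show ?thesis using Q_adj[of \<alpha> "f x" "D1 x u"] by (simp add: inner_commute)
qed

lemma tangent': "x \<in> U \<Longrightarrow> \<alpha> < m \<Longrightarrow> \<beta> < m \<Longrightarrow> Q \<beta> (D1 x u) \<bullet> Q \<alpha> (f x) = 0"
  by (simp add: Q_inner_Q tangent)

text \<open>Differentiating the tangency relation once more gives the second fundamental form of the
  sphere factors.\<close>

lemma normal_D2:
  assumes x: "x \<in> U" and \<alpha>: "\<alpha> < m"
  shows "D2 x u v \<bullet> Q \<alpha> (f x) = - factor_metric x \<alpha> u v"
proof -
  have "((\<lambda>y. D1 y v \<bullet> Q \<alpha> (f y)) has_derivative (\<lambda>h. D1 x v \<bullet> Q \<alpha> (D1 x h) + D2 x h v \<bullet> Q \<alpha> (f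
      x))) (at x)"
    by (rule has_derivative_inner[OF D2_deriv[OF x] bounded_linear.has_derivative[OF
        bounded_linear_Q D1_deriv[OF x]]])
  moreover have "((\<lambda>y. D1 y v \<bullet> Q \<alpha> (f y)) has_derivative (\<lambda>h. 0)) (at x)"
    by (rule has_derivative_transform_within_open[OF has_derivative_const[of 0] U x])
       (use tangent[OF _ \<alpha>] in simp)
  ultimately have "(\<lambda>h. D1 x v \<bullet> Q \<alpha> (D1 x h) + D2 x h v \<bullet> Q \<alpha> (f x)) = (\<lambda>h. 0)"
    by (rule has_derivative_unique)
  from fun_cong[OF this, of u] have "D1 x v \<bullet> Q \<alpha> (D1 x u) + D2 x u v \<bullet> Q \<alpha> (f x) = 0" .
  then show ?thesis using Q_adj[of \<alpha> "D1 x v" "D1 x u"] by (simp add: factor_metric_def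
      inner_commute)
qed

text \<open>\<open>onb\<close> is defined by choice, so its properties rest on existence. The frame
  is the preimage of an orthonormal basis of the tangent space.\<close>

lemma onb_exists:
  assumes x: "x \<in> U"
  shows "\<exists>B. card B = DIM('m) \<and> (\<forall>u\<in>B. \<forall>v\<in>B. g x u v = (if u = v then 1 else 0))"
proof -
  have sub: "subspace (range (D1 x))"
    using linear_D1[OF x] by (simp add: linear_subspace_image)
  obtain C where C: "C \<subseteq> range (D1 x)" "pairwise orthogonal C" "\<And>c. c \<in> C \<Longrightarrow> norm c = 1"
    "card C = dim (range (D1 x))"
    using orthonormal_basis_subspace[OF sub] by metis
  have "dim (range (D1 x)) = DIM('m)"
    using dim_image_eq[OF linear_D1[OF x], of UNIV] inj_D1[OF x] by (simp add: dim_UNIV)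
  define B where "B = D1 x -` C"
  have CB: "C = D1 x ` B" using C(1) by (auto simp: B_def)
  have "card B = DIM('m)"
    using C(4) \<open>dim (range (D1 x)) = DIM('m)\<close> inj_D1[OF x] card_image[of "D1 x" B]
    by (simp add: CB inj_on_subset)
  moreover have "g x u v = (if u = v then 1 else 0)" if "u \<in> B" "v \<in> B" for u v
    using C(2,3) that inj_D1[OF x]
    by (auto simp: CB g_D1 pairwise_def orthogonal_def inj_eq norm_eq_1)
  ultimately show ?thesis by blast
qed

lemma onb:
  assumes x: "x \<in> U"
  shows "card (onb (g x)) = DIM('m)"
    "\<And>u v. u \<in> onb (g x) \<Longrightarrow> v \<in> onb (g x) \<Longrightarrow> D1 x u \<bullet> D1 x v = (if u = v then 1 else 0)"
  using someI_ex[OF onb_exists[OF x]] unfolding onb_def[symmetric] g_D1 by auto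

text \<open>The image of the frame together with the m normals, scaled to unit length by sqrt (k
  \<alpha>), is orthonormal and has as many elements as the ambient dimension, so it is an
  orthonormal basis.\<close>

lemma frame_expansion:
  assumes x: "x \<in> U"
  shows "w = (\<Sum>e\<in>onb (g x). (w \<bullet> D1 x e) *\<^sub>R D1 x e) + (\<Sum>\<alpha><m. (k \<alpha> * (w \<bullet> Q \<alpha> (f x))) *\<^sub>R Q \<alpha> (f
      x))"
proof -
  let ?B = "onb (g x)"
  define n where "n \<alpha> = sqrt (k \<alpha>) *\<^sub>R Q \<alpha> (f x)" for \<alpha>
  have nn: "n \<alpha> \<bullet> n \<beta> = (if \<alpha> = \<beta> then 1 else 0)" if "\<alpha> < m" "\<beta> < m" for \<alpha> \<beta>
    using that sphere[OF x] k[of \<alpha>] by (auto simp: n_def Q_inner_Q mult.assoc[symmetric])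
  have Dn: "D1 x e \<bullet> n \<alpha> = 0" if "\<alpha> < m" for e \<alpha>
    using tangent[OF x that] by (simp add: n_def)
  have fin: "finite ?B" using onb(1)[OF x] by (intro card_ge_0_finite) simp
  have injD: "inj_on (D1 x) ?B" using inj_D1[OF x] inj_on_subset by blast
  have injn: "inj_on n {..<m}" 
  proof (rule inj_onI, rule ccontr)
    fix \<alpha> \<beta> assume "\<alpha> \<in> {..<m}" "\<beta> \<in> {..<m}" "n \<alpha> = n \<beta>" "\<alpha> \<noteq> \<beta>"
    then show False using nn[of \<alpha> \<beta>] nn[of \<beta> \<beta>] by simp
  qed
  have disj: "D1 x ` ?B \<inter> n ` {..<m} = {}"
  proof -
    have False if "D1 x e = n \<alpha>" "\<alpha> < m" for e \<alpha>
      using Dn[OF that(2), of e] nn[OF that(2) that(2)] that(1) by simp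
    then show ?thesis by blast
  qed
  let ?S = "D1 x ` ?B \<union> n ` {..<m}"
  have norm1: "norm s = 1" if "s \<in> ?S" for s
    using that onb(2)[OF x] nn by (auto simp: norm_eq_1)
  have orth: "pairwise orthogonal ?S"
    using onb(2)[OF x] nn Dn by (auto simp: pairwise_def orthogonal_def inner_commute)
  have card: "card ?S = DIM('e)"
    using disj fin injD injn onb(1)[OF x] by (simp add: card_Un_disjoint card_image dim)
  have "0 \<notin> ?S" using norm1 by force
  then have "independent ?S" using orth pairwise_orthogonal_independent by blast
  then have "span ?S = UNIV"
    using card dim_eq_card_independent[of ?S] by (simp add: dim_eq_full[symmetric])
  then have "w = (\<Sum>s\<in>?S. (w \<bullet> s) *\<^sub>R s)"
    using orthonormal_basis_expand[OF orth norm1, of w] fin by simp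
  also have "\<dots> = (\<Sum>e\<in>?B. (w \<bullet> D1 x e) *\<^sub>R D1 x e) + (\<Sum>\<alpha><m. (w \<bullet> n \<alpha>) *\<^sub>R n \<alpha>)"
    using fin disj by (simp add: sum.union_disjoint sum.reindex[OF injD] sum.reindex[OF injn])
  also have "(\<Sum>\<alpha><m. (w \<bullet> n \<alpha>) *\<^sub>R n \<alpha>) = (\<Sum>\<alpha><m. (k \<alpha> * (w \<bullet> Q \<alpha> (f x))) *\<^sub>R Q \<alpha> (f x))"
    using k by (intro sum.cong) (auto simp: n_def mult.assoc[symmetric] less_imp_le mult_ac)
  finally show ?thesis .
qed

lemma parseval:
  assumes x: "x \<in> U"
  shows "w \<bullet> z = (\<Sum>e\<in>onb (g x). (w \<bullet> D1 x e) * (D1 x e \<bullet> z)) +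
     (\<Sum>\<alpha><m. k \<alpha> * (w \<bullet> Q \<alpha> (f x)) * (Q \<alpha> (f x) \<bullet> z))"
  by (subst frame_expansion[OF x, of w]) (simp add: inner_add_left inner_sum_left)

lemma tangential_vector:
  assumes x: "x \<in> U" and w: "\<And>\<alpha>. \<alpha> < m \<Longrightarrow> w \<bullet> Q \<alpha> (f x) = 0"
  obtains u where "w = D1 x u"
proof
  show "w = D1 x (\<Sum>e\<in>onb (g x). (w \<bullet> D1 x e) *\<^sub>R e)"
    using frame_expansion[OF x, of w] w
    by (simp add: linear_sum[OF linear_D1[OF x]] linear_scale[OF linear_D1[OF x]])
qed

text \<open>The trace of \<open>Q\<close> \<alpha> is the dimension of the ambient space of factor
  \<alpha>. Computed in the frame completed by unit normals, it gets exactly 1 from the normal of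
  factor \<alpha>, hence the - 1. The composition rule is Parseval's identity, as each
  \<open>Q\<close> \<alpha> keeps tangent vectors orthogonal to the normals.\<close>

lemma adapted_frame_onb:
  assumes x: "x \<in> U"
  shows "adapted_frame m (factor_metric x) (\<lambda>\<alpha>. (\<Sum>c\<in>Basis. c \<bullet> Q \<alpha> c) - 1) (onb (g x))"
  unfolding adapted_frame_def
proof (intro conjI allI impI)
  fix \<alpha> assume \<alpha>: "\<alpha> < m"
  have E: "(\<Sum>c\<in>Basis. (c \<bullet> p) * (q \<bullet> c)) = p \<bullet> q" for p q :: 'e
    using euclidean_inner[of p q] by (simp add: inner_commute[of _ p])
  have "(\<Sum>c\<in>Basis. c \<bullet> Q \<alpha> c) = (\<Sum>c\<in>Basis. (\<Sum>e\<in>onb (g x). (c \<bullet> D1 x e) * (Q \<alpha> (D1 x e) \<bullet> c)) +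
     (\<Sum>\<beta><m. k \<beta> * ((c \<bullet> Q \<beta> (f x)) * (Q \<alpha> (Q \<beta> (f x)) \<bullet> c))))"
    by (subst parseval[OF x]) (simp add: Q_adj mult.assoc)
  also have "\<dots> = (\<Sum>e\<in>onb (g x). \<Sum>c\<in>Basis. (c \<bullet> D1 x e) * (Q \<alpha> (D1 x e) \<bullet> c)) +
     (\<Sum>\<beta><m. \<Sum>c\<in>Basis. k \<beta> * ((c \<bullet> Q \<beta> (f x)) * (Q \<alpha> (Q \<beta> (f x)) \<bullet> c)))"
    unfolding sum.distrib by (intro arg_cong2[where f = "(+)"]; rule sum.swap)
  also have "\<dots> = (\<Sum>e\<in>onb (g x). D1 x e \<bullet> Q \<alpha> (D1 x e)) + (\<Sum>\<beta><m. k \<beta> * (Q \<beta> (f x) \<bullet> Q \<alpha> (Q \<beta> (f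
      x))))"
    unfolding sum_distrib_left[symmetric] E by (simp add: Q_adj)
  also have "(\<Sum>\<beta><m. k \<beta> * (Q \<beta> (f x) \<bullet> Q \<alpha> (Q \<beta> (f x)))) = (\<Sum>\<beta><m. if \<beta> = \<alpha> then 1 else 0)"
    using \<alpha> sphere[OF x] by (intro sum.cong) (auto simp: Q_Q Q_inner_Q)
  finally show "(\<Sum>e\<in>onb (g x). factor_metric x \<alpha> e e) = (\<Sum>c\<in>Basis. c \<bullet> Q \<alpha> c) - 1"
    using \<alpha> by (simp add: factor_metric_def)
next
  fix \<alpha> \<beta> u v assume \<alpha>: "\<alpha> < m" and \<beta>: "\<beta> < m"
  have "Q \<alpha> (D1 x u) \<bullet> Q \<beta> (D1 x v) = (\<Sum>e\<in>onb (g x). (Q \<alpha> (D1 x u) \<bullet> D1 x e) * (D1 x e \<bullet> Q \<beta> (D1 x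
      v)))"
    using \<alpha> \<beta> by (subst parseval[OF x]) (simp add: tangent'[OF x])
  moreover have "Q \<alpha> (D1 x u) \<bullet> Q \<beta> (D1 x v) = (if \<alpha> = \<beta> then factor_metric x \<alpha> u v else 0)"
    using \<alpha> \<beta> by (simp add: Q_inner_Q factor_metric_def)
  moreover have "Q \<alpha> (D1 x u) \<bullet> D1 x e = factor_metric x \<alpha> u e" for e
    by (simp add: factor_metric_def Q_adj)
  ultimately show "(\<Sum>e\<in>onb (g x). factor_metric x \<alpha> u e * factor_metric x \<beta> e v) = (if \<alpha> = \<beta> then
      factor_metric x \<alpha> u v else 0)"
    by (simp add: factor_metric_def)
qed

end

section \<open>Levi-Civita connection and curvature of the product\<close>

context product_param
begin

abbreviation normal_part :: "'m \<Rightarrow> 'm \<Rightarrow> 'm \<Rightarrow> 'e" where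
  "normal_part x u v \<equiv> (\<Sum>\<alpha><m. (k \<alpha> * factor_metric x \<alpha> u v) *\<^sub>R Q \<alpha> (f x))"

lemma normal_part_inner:
  assumes "x \<in> U" "\<beta> < m"
  shows "normal_part x u v \<bullet> Q \<beta> (f x) = factor_metric x \<beta> u v"
proof -
  have "normal_part x u v \<bullet> Q \<beta> (f x) = (\<Sum>\<alpha><m. if \<alpha> = \<beta> then k \<beta> * factor_metric x \<beta> u v * (f x \<bullet>
      Q \<beta> (f x)) else 0)"
    unfolding inner_sum_left using assms by (intro sum.cong) (auto simp: Q_inner_Q)
  also have "\<dots> = factor_metric x \<beta> u v * (k \<beta> * (f x \<bullet> Q \<beta> (f x)))"
    using assms by simp
  finally show ?thesis using sphere[OF assms] by simp
qed

lemma normal_part_tangent: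
  assumes "x \<in> U"
  shows "normal_part x u v \<bullet> D1 x w = 0" "\<beta> < m \<Longrightarrow> normal_part x u v \<bullet> Q \<beta> (D1 x w) = 0"
proof -
  have "Q \<alpha> (f x) \<bullet> D1 x w = 0" if "\<alpha> < m" for \<alpha>
    using tangent[OF assms that, of w] by (simp add: inner_commute)
  then show "normal_part x u v \<bullet> D1 x w = 0" by (simp add: inner_sum_left)
  assume \<beta>: "\<beta> < m"
  have "Q \<alpha> (f x) \<bullet> Q \<beta> (D1 x w) = 0" if "\<alpha> < m" for \<alpha>
    using tangent'[OF assms that \<beta>, of w] by (simp add: inner_commute)
  then show "normal_part x u v \<bullet> Q \<beta> (D1 x w) = 0" by (simp add: inner_sum_left)
qed

lemma g_deriv:
  assumes x: "x \<in> U"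
  shows "frechet_derivative (\<lambda>y. g y v w) (at x) u = D2 x u v \<bullet> D1 x w + D1 x v \<bullet> D2 x u w"
proof -
  have "((\<lambda>y. g y v w) has_derivative (\<lambda>h. D1 x v \<bullet> D2 x h w + D2 x h v \<bullet> D1 x w)) (at x)"
    unfolding g_D1 by (rule has_derivative_inner[OF D2_deriv[OF x] D2_deriv[OF x]])
  from frechet_derivative_at[OF this, symmetric] show ?thesis by simp
qed

text \<open>By \<open>normal_D2\<close> the right-hand side has no normal component, so it is the
  image of some z. Its inner products with tangent vectors are those of \<open>D2 x u v\<close>,
  which makes z a solution of the Koszul formula; injectivity of \<open>D1 x\<close> makes it the
  only one.\<close>

lemma gauss_formula:
  assumes x: "x \<in> U"
  shows "D1 x (christoffel g x u v) = D2 x u v + normal_part x u v"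
proof -
  have "(D2 x u v + normal_part x u v) \<bullet> Q \<alpha> (f x) = 0" if "\<alpha> < m" for \<alpha>
    using normal_D2[OF x that] normal_part_inner[OF x that] by (simp add: inner_add_left)
  then obtain z where z: "D2 x u v + normal_part x u v = D1 x z"
    using tangential_vector[OF x] by blast
  have zw: "D1 x z \<bullet> D1 x w = D2 x u v \<bullet> D1 x w" for w
    unfolding z[symmetric] by (simp add: inner_add_left normal_part_tangent[OF x])
  have "christoffel g x u v = z"
    unfolding christoffel_def
  proof (rule the_equality)
    show "\<forall>w. 2 * g x z w = frechet_derivative (\<lambda>y. g y v w) (at x) u
     + frechet_derivative (\<lambda>y. g y u w) (at x) v - frechet_derivative (\<lambda>y. g y u v) (at x) w"
    proof
      fix w
      show "2 * g x z w = frechet_derivative (\<lambda>y. g y v w) (at x) u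
     + frechet_derivative (\<lambda>y. g y u w) (at x) v - frechet_derivative (\<lambda>y. g y u v) (at x) w"
        unfolding g_deriv[OF x] g_D1[of x z] zw D2_sym[OF x, of v u] D2_sym[OF x, of w u]
            D2_sym[OF x, of w v]
        by (simp add: inner_commute[of "D1 x u"] inner_commute[of "D1 x v"])
    qed
    fix z' assume z': "\<forall>w. 2 * g x z' w = frechet_derivative (\<lambda>y. g y v w) (at x) u
     + frechet_derivative (\<lambda>y. g y u w) (at x) v - frechet_derivative (\<lambda>y. g y u v) (at x) w"
    have "D1 x z' \<bullet> D1 x w = D1 x z \<bullet> D1 x w" for w
      using z'[rule_format, of w] unfolding g_deriv[OF x] g_D1[of x z'] zw
        D2_sym[OF x, of v u] D2_sym[OF x, of w u] D2_sym[OF x, of w v]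
      by (simp add: inner_commute[of "D1 x u"] inner_commute[of "D1 x v"])
    from this[of "z' - z"] have "(D1 x z' - D1 x z) \<bullet> (D1 x z' - D1 x z) = 0"
      by (simp add: linear_diff[OF linear_D1[OF x]] inner_diff_left)
    then show "z' = z" using inj_D1[OF x] by (simp add: inj_eq)
  qed
  then show ?thesis using z by simp
qed

lemma D2_gauss: "x \<in> U \<Longrightarrow> D2 x u v = D1 x (christoffel g x u v) - normal_part x u v"
  by (simp add: gauss_formula)

lemma christoffel_0: "x \<in> U \<Longrightarrow> christoffel g x 0 v = 0"
  using gauss_formula[of x 0 v] linear_D2_left[of x v] linear_0[of "\<lambda>u. D2 x u v"] linear_0[OF
      linear_D1[of x]]
  by (simp add: factor_metric_def D1_eq_0)

text \<open>Each factor metric is parallel: \<open>D2\<close> differs from a tangential vector by a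
  combination of normals, which are orthogonal to the projection of a tangent vector to any
  factor.\<close>

lemma factor_metric_deriv:
  assumes x: "x \<in> U" and \<alpha>: "\<alpha> < m"
  shows "((\<lambda>y. factor_metric y \<alpha> u v) has_derivative
    (\<lambda>w. factor_metric x \<alpha> (christoffel g x w u) v + factor_metric x \<alpha> u (christoffel g x w v)))
        (at x)"
proof -
  have "((\<lambda>y. factor_metric y \<alpha> u v) has_derivative (\<lambda>w. D1 x u \<bullet> Q \<alpha> (D2 x w v) + D2 x w u \<bullet> Q \<alpha>
      (D1 x v))) (at x)"
    unfolding factor_metric_def
    by (rule has_derivative_inner[OF D2_deriv[OF x] bounded_linear.has_derivative[OF
        bounded_linear_Q D2_deriv[OF x]]])
  moreover have "D1 x u \<bullet> Q \<alpha> (D2 x w v) = factor_metric x \<alpha> u (christoffel g x w v)" for w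
  proof -
    have "D1 x u \<bullet> Q \<alpha> (D2 x w v) = D2 x w v \<bullet> Q \<alpha> (D1 x u)"
      using Q_adj[of \<alpha> "D1 x u" "D2 x w v"] by (simp add: inner_commute)
    also have "\<dots> = D1 x (christoffel g x w v) \<bullet> Q \<alpha> (D1 x u)"
      unfolding D2_gauss[OF x] inner_diff_left normal_part_tangent(2)[OF x \<alpha>] by simp
    also have "\<dots> = factor_metric x \<alpha> u (christoffel g x w v)"
      using Q_adj[of \<alpha> "D1 x u" "D1 x (christoffel g x w v)"] by (simp add: factor_metric_def
          inner_commute)
    finally show ?thesis .
  qed
  moreover have "D2 x w u \<bullet> Q \<alpha> (D1 x v) = factor_metric x \<alpha> (christoffel g x w u) v" for w
    unfolding D2_gauss[OF x] inner_diff_left normal_part_tangent(2)[OF x \<alpha>] by (simp add: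
        factor_metric_def)
  ultimately show ?thesis by (simp add: add.commute)
qed

lemma normal_part_deriv:
  assumes x: "x \<in> U"
  shows "((\<lambda>y. normal_part y u v) has_derivative (\<lambda>w. \<Sum>\<alpha><m.
     (k \<alpha> * factor_metric x \<alpha> u v) *\<^sub>R Q \<alpha> (D1 x w) +
     (k \<alpha> * (factor_metric x \<alpha> (christoffel g x w u) v + factor_metric x \<alpha> u (christoffel g x w
         v))) *\<^sub>R Q \<alpha> (f x))) (at x)"
proof (rule has_derivative_sum)
  fix \<alpha> assume "\<alpha> \<in> {..<m}"
  then have \<alpha>: "\<alpha> < m" by simp
  show "((\<lambda>y. (k \<alpha> * factor_metric y \<alpha> u v) *\<^sub>R Q \<alpha> (f y)) has_derivative (\<lambda>w.
     (k \<alpha> * factor_metric x \<alpha> u v) *\<^sub>R Q \<alpha> (D1 x w) +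
     (k \<alpha> * (factor_metric x \<alpha> (christoffel g x w u) v + factor_metric x \<alpha> u (christoffel g x w
         v))) *\<^sub>R Q \<alpha> (f x))) (at x)"
    by (rule has_derivative_scaleR[OF has_derivative_mult_right[OF factor_metric_deriv[OF x \<alpha>]]
       bounded_linear.has_derivative[OF bounded_linear_Q D1_deriv[OF x]]])
qed

text \<open>A definite description offers nothing to differentiate, but the Gauss formula presents
  the Christoffel field as the solution of an injective linear system with differentiable
  coefficients.\<close>

lemma christoffel_differentiable:
  assumes x: "x \<in> U"
  shows "(\<lambda>y. christoffel g y u v) differentiable (at x)"
proof (rule linear_system_solution_differentiable[where A = D1 and \<gamma> = "\<lambda>y. christoffel g y u v"
      and c = "\<lambda>y. D2 y u v + normal_part y u v", OF U x linear_D1 inj_D1[OF x]])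
  show "(\<lambda>y. D1 y w) differentiable (at x)" for w
    using D2_deriv[OF x] unfolding differentiable_def by blast
  show "(\<lambda>y. D2 y u v + normal_part y u v) differentiable (at x)"
    using has_derivative_add[OF D3_deriv[OF x] normal_part_deriv[OF x]] unfolding
        differentiable_def by blast
qed (auto simp: gauss_formula)

text \<open>The derivative of \<open>D1\<close> is available only at fixed vectors, so the product
  rule goes through the coordinates of Z.\<close>

lemma D1_field_deriv:
  assumes x: "x \<in> U" and Z: "(Z has_derivative Z') (at x)"
  shows "((\<lambda>y. D1 y (Z y)) has_derivative (\<lambda>h. D2 x h (Z x) + D1 x (Z' h))) (at x)"
proof -
  have expand: "A w = (\<Sum>b\<in>Basis. (w \<bullet> b) *\<^sub>R A b)" if "linear A" for A :: "'m \<Rightarrow> 'e" and w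
    using linear_sum[OF that, of "\<lambda>b. (w \<bullet> b) *\<^sub>R b" Basis] by (simp add: linear_scale[OF that]
        euclidean_representation)
  have "((\<lambda>y. \<Sum>b\<in>Basis. (Z y \<bullet> b) *\<^sub>R D1 y b) has_derivative
      (\<lambda>h. \<Sum>b\<in>Basis. (Z x \<bullet> b) *\<^sub>R D2 x h b + (Z' h \<bullet> b) *\<^sub>R D1 x b)) (at x)"
    by (rule has_derivative_sum, rule has_derivative_scaleR[OF has_derivative_inner_left[OF Z]
        D2_deriv[OF x]])
  then have "((\<lambda>y. \<Sum>b\<in>Basis. (Z y \<bullet> b) *\<^sub>R D1 y b) has_derivative (\<lambda>h. D2 x h (Z x) + D1 x (Z'
      h))) (at x)"
    unfolding sum.distrib expand[OF linear_D2_right[OF x], symmetric] expand[OF linear_D1[OF x],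
        symmetric] .
  then show ?thesis
    by (rule has_derivative_transform_within_open[OF _ U x]) (rule expand[OF linear_D1, symmetric])
qed

text \<open>Differentiate the Gauss formula along u and pair it with a tangent vector. Of the
  derivative of the normal part only the term that differentiates \<open>f\<close> itself survives,
  and it gives the product of two factor metrics.\<close>

lemma D1_second_covariant_derivative:
  assumes x: "x \<in> U"
  shows "D1 x (nabla_field g (\<lambda>_. u) (nabla_field g (\<lambda>_. v) (\<lambda>_. w)) x) \<bullet> D1 x z =
     D3 x u v w \<bullet> D1 x z + (\<Sum>\<alpha><m. k \<alpha> * factor_metric x \<alpha> v w * factor_metric x \<alpha> u z)"
proof -
  let ?\<Gamma> = "christoffel g"
  have nabla: "nabla_field g (\<lambda>_. v) (\<lambda>_. w) = (\<lambda>y. ?\<Gamma> y v w)"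
    by (simp add: nabla_field_def fun_eq_iff)
  define \<Gamma>' where "\<Gamma>' = frechet_derivative (\<lambda>y. ?\<Gamma> y v w) (at x)"
  have \<Gamma>': "((\<lambda>y. ?\<Gamma> y v w) has_derivative \<Gamma>') (at x)"
    unfolding \<Gamma>'_def using christoffel_differentiable[OF x] by (rule frechet_derivative_works[THEN
        iffD1])
  have "((\<lambda>y. D1 y (?\<Gamma> y v w)) has_derivative (\<lambda>h. D3 x h v w + (\<Sum>\<alpha><m.
     (k \<alpha> * factor_metric x \<alpha> v w) *\<^sub>R Q \<alpha> (D1 x h) +
     (k \<alpha> * (factor_metric x \<alpha> (?\<Gamma> x h v) w + factor_metric x \<alpha> v (?\<Gamma> x h w))) *\<^sub>R Q \<alpha> (f x))))
         (at x)"
    by (rule has_derivative_transform_within_open[OF has_derivative_add[OF D3_deriv[OF x]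
        normal_part_deriv[OF x]] U x])
      (simp add: gauss_formula)
  from has_derivative_unique[OF D1_field_deriv[OF x \<Gamma>'] this]
  have "D2 x u (?\<Gamma> x v w) + D1 x (\<Gamma>' u) = D3 x u v w + (\<Sum>\<alpha><m.
     (k \<alpha> * factor_metric x \<alpha> v w) *\<^sub>R Q \<alpha> (D1 x u) +
     (k \<alpha> * (factor_metric x \<alpha> (?\<Gamma> x u v) w + factor_metric x \<alpha> v (?\<Gamma> x u w))) *\<^sub>R Q \<alpha> (f x))"
    by (rule fun_cong)
  then have "(D2 x u (?\<Gamma> x v w) + D1 x (\<Gamma>' u)) \<bullet> D1 x z = D3 x u v w \<bullet> D1 x z + (\<Sum>\<alpha><m.
     (k \<alpha> * factor_metric x \<alpha> v w) * (Q \<alpha> (D1 x u) \<bullet> D1 x z) +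
     (k \<alpha> * (factor_metric x \<alpha> (?\<Gamma> x u v) w + factor_metric x \<alpha> v (?\<Gamma> x u w))) * (Q \<alpha> (f x) \<bullet> D1 x
         z))"
    by (simp only: inner_add_left inner_sum_left inner_scaleR_left)
  also have "\<dots> = D3 x u v w \<bullet> D1 x z + (\<Sum>\<alpha><m. k \<alpha> * factor_metric x \<alpha> v w * factor_metric x \<alpha> u z)"
  proof (intro arg_cong2[where f = "(+)"] refl sum.cong)
    fix \<alpha> assume "\<alpha> \<in> {..<m}"
    then have "Q \<alpha> (f x) \<bullet> D1 x z = 0" using tangent[OF x, of \<alpha> z] by (simp add: inner_commute)
    then show "(k \<alpha> * factor_metric x \<alpha> v w) * (Q \<alpha> (D1 x u) \<bullet> D1 x z) +
     (k \<alpha> * (factor_metric x \<alpha> (?\<Gamma> x u v) w + factor_metric x \<alpha> v (?\<Gamma> x u w))) * (Q \<alpha> (f x) \<bullet> D1 x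
         z) =
      k \<alpha> * factor_metric x \<alpha> v w * factor_metric x \<alpha> u z"
      by (simp add: factor_metric_def Q_adj)
  qed
  finally have 1: "(D2 x u (?\<Gamma> x v w) + D1 x (\<Gamma>' u)) \<bullet> D1 x z =
      D3 x u v w \<bullet> D1 x z + (\<Sum>\<alpha><m. k \<alpha> * factor_metric x \<alpha> v w * factor_metric x \<alpha> u z)" .
  have "D1 x (nabla_field g (\<lambda>_. u) (nabla_field g (\<lambda>_. v) (\<lambda>_. w)) x) = D1 x (\<Gamma>' u) + D1 x (?\<Gamma> x
      u (?\<Gamma> x v w))"
    unfolding nabla by (simp add: nabla_field_def[of g "\<lambda>_. u"] \<Gamma>'_def linear_add[OF linear_D1[OF
        x]])
  then show ?thesis
    using 1 normal_part_tangent(1)[OF x] by (simp add: gauss_formula[OF x, of u "?\<Gamma> x v w"]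
        inner_add_left)
qed

text \<open>The Gauss equation: constant fields commute, third derivatives are symmetric in their
  two outer directions and cancel, and the products of factor metrics remain.\<close>

lemma Rm_product:
  assumes x: "x \<in> U"
  shows "Rm g x u v w z = (\<Sum>\<alpha><m. k \<alpha> * (factor_metric x \<alpha> v w * factor_metric x \<alpha> u z -
      factor_metric x \<alpha> u w * factor_metric x \<alpha> v z))"
proof -
  have "nabla_field g (lie_bracket (\<lambda>_. u) (\<lambda>_. v)) (\<lambda>_. w) x = 0"
    using christoffel_0[OF x] by (simp add: nabla_field_def lie_bracket_def)
  then have "Rm g x u v w z = D1 x (nabla_field g (\<lambda>_. u) (nabla_field g (\<lambda>_. v) (\<lambda>_. w)) x) \<bullet> D1
      x z -
     D1 x (nabla_field g (\<lambda>_. v) (nabla_field g (\<lambda>_. u) (\<lambda>_. w)) x) \<bullet> D1 x z"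
    by (simp add: Rm_def curvature_field_def g_D1 linear_diff[OF linear_D1[OF x]] inner_diff_left)
  then show ?thesis
    unfolding D1_second_covariant_derivative[OF x] D3_sym[OF x, of v u]
    by (simp add: sum_subtractf[symmetric] algebra_simps)
qed

lemma Ric_product:
  assumes x: "x \<in> U"
  shows "Ric g x u v = (\<Sum>\<alpha><m. k \<alpha> * ((\<Sum>c\<in>Basis. c \<bullet> Q \<alpha> c) - 2) * factor_metric x \<alpha> u v)"
proof -
  have "Ric g x u v = (\<Sum>\<alpha><m. \<Sum>e\<in>onb (g x). k \<alpha> * (factor_metric x \<alpha> u v * factor_metric x \<alpha> e e -
      factor_metric x \<alpha> u e * factor_metric x \<alpha> e v))"
    unfolding Ric_def Rm_product[OF x] by (subst sum.swap) (simp add: mult.commute)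
  also have "\<dots> = (\<Sum>\<alpha><m. k \<alpha> * ((\<Sum>c\<in>Basis. c \<bullet> Q \<alpha> c) - 2) * factor_metric x \<alpha> u v)"
  proof (intro sum.cong refl)
    fix \<alpha> assume "\<alpha> \<in> {..<m}"
    then have tr: "(\<Sum>e\<in>onb (g x). factor_metric x \<alpha> e e) = (\<Sum>c\<in>Basis. c \<bullet> Q \<alpha> c) - 1"
      "(\<Sum>e\<in>onb (g x). factor_metric x \<alpha> u e * factor_metric x \<alpha> e v) = factor_metric x \<alpha> u v"
      using adapted_frame_onb[OF x] by (auto simp: adapted_frame_def)
    show "(\<Sum>e\<in>onb (g x). k \<alpha> * (factor_metric x \<alpha> u v * factor_metric x \<alpha> e e -
      factor_metric x \<alpha> u e * factor_metric x \<alpha> e v)) = k \<alpha> * ((\<Sum>c\<in>Basis. c \<bullet> Q \<alpha> c) - 2) *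
          factor_metric x \<alpha> u v"
      unfolding sum_distrib_left[symmetric] sum_subtractf tr by (simp add: algebra_simps)
  qed
  finally show ?thesis .
qed

lemma K4_product:
  assumes x: "x \<in> U"
  defines "n \<equiv> (\<lambda>\<alpha>. (\<Sum>c\<in>Basis. c \<bullet> Q \<alpha> c) - 1)"
  shows "eq_mform m (factor_metric x) 4 (R4 g x) (thorpe_coeff k)"
    "eq_mform m (factor_metric x) 3 (contraction (g x) (R4 g x)) (contraction_coeff m n
        (thorpe_coeff k))"
    "eq_mform m (factor_metric x) 4 (K4 g x) (projection_coeff m n (thorpe_coeff k))"
proof -
  note frame = adapted_frame_onb[OF x, folded n_def]
  show R4: "eq_mform m (factor_metric x) 4 (R4 g x) (thorpe_coeff k)"
    unfolding eq_mform_def using R4_mform[where b = "factor_metric x", OF Rm_product[OF x]] by blast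
  show "eq_mform m (factor_metric x) 3 (contraction (g x) (R4 g x)) (contraction_coeff m n
      (thorpe_coeff k))"
    by (rule eq_mform_contraction[OF frame]) (use R4 in \<open>simp add: numeral_eq_Suc\<close>)
  show "eq_mform m (factor_metric x) 4 (K4 g x) (projection_coeff m n (thorpe_coeff k))"
    by (rule K4_eq_mform[OF _ frame R4]) (simp add: g_sum)
qed

end

section \<open>Parallelism of K_4 and the Bach tensor\<close>

lemma sum_omit_list_update:
  assumes j: "j < length vs"
  shows "(\<Sum>s<length vs. F (omit j (vs[s := A (vs ! s)]))) =
    F (omit j vs) + (\<Sum>s<length vs - 1. F ((omit j vs)[s := A (omit j vs ! s)]) :: real)"
proof -
  have "(\<Sum>s<length vs. F (omit j (vs[s := A (vs ! s)]))) =
      F (omit j (vs[j := A (vs ! j)])) + (\<Sum>s\<in>{..<length vs} - {j}. F (omit j (vs[s := A (vs !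
          s)])))"
    using j by (subst sum.remove[of _ j]) auto
  \<comment> \<open>The update at position j is lost when j is omitted, which gives the extra
    summand; the other updates become updates of the shortened list.\<close>
  also have "omit j (vs[j := A (vs ! j)]) = omit j vs"
    by (simp add: omit_def)
  also have "(\<Sum>s\<in>{..<length vs} - {j}. F (omit j (vs[s := A (vs ! s)]))) =
      (\<Sum>s<length vs - 1. F ((omit j vs)[s := A (omit j vs ! s)]))"
  proof (rule sum.reindex_bij_witness[where i = "\<lambda>s. if s < j then s else Suc s" and j = "\<lambda>s. if s
      < j then s else s - 1"])
    fix s assume s: "s \<in> {..<length vs} - {j}"
    show "(if (if s < j then s else s - 1) < j then if s < j then s else s - 1 else Suc (if s < j
        then s else s - 1)) = s"
      using s by auto
    show "(if s < j then s else s - 1) \<in> {..<length vs - 1}" using s j by auto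
    have "(omit j vs)[(if s < j then s else s - 1) := A (omit j vs ! (if s < j then s else s -
        1))] = omit j (vs[s := A (vs ! s)])"
      using s j by (intro nth_equalityI) (auto simp: nth_omit nth_list_update)
    then show "F ((omit j vs)[(if s < j then s else s - 1) := A (omit j vs ! (if s < j then s else
        s - 1))]) = F (omit j (vs[s := A (vs ! s)]))"
      by simp
  next
    fix s assume s: "s \<in> {..<length vs - 1}"
    show "(if (if s < j then s else Suc s) < j then if s < j then s else Suc s else (if s < j then
        s else Suc s) - 1) = s"
      using s by auto
    show "(if s < j then s else Suc s) \<in> {..<length vs} - {j}" using s j by auto
  qed
  finally show ?thesis .
qed

text \<open>The hypothesis says that the forms \<open>b\<close> \<alpha> are parallel for the
  connection \<Gamma>. By the product rule along the row expansion, so are the determinants built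
  from them.\<close>

lemma mdet_has_derivative:
  fixes b :: "'a::real_normed_vector \<Rightarrow> nat \<Rightarrow> 'm \<Rightarrow> 'm \<Rightarrow> real"
  assumes b: "\<And>\<alpha> u v. \<alpha> \<in> set \<alpha>s \<Longrightarrow>
      ((\<lambda>y. b y \<alpha> u v) has_derivative (\<lambda>w. b x \<alpha> (\<Gamma> w u) v + b x \<alpha> u (\<Gamma> w v))) (at x)"
    and len: "length us = length \<alpha>s" "length vs = length \<alpha>s"
  shows "((\<lambda>y. mdet (b y) \<alpha>s us vs) has_derivative (\<lambda>w.
     (\<Sum>s<length us. mdet (b x) \<alpha>s (us[s := \<Gamma> w (us ! s)]) vs) +
     (\<Sum>s<length vs. mdet (b x) \<alpha>s us (vs[s := \<Gamma> w (vs ! s)])))) (at x)"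
  using assms
proof (induction \<alpha>s arbitrary: us vs)
  case (Cons \<alpha> \<alpha>s)
  obtain u us' where us: "us = u # us'" using Cons.prems by (cases us) auto
  let ?b = "b x \<alpha>"
  define D where "D w vs' = (\<Sum>s<length us'. mdet (b x) \<alpha>s (us'[s := \<Gamma> w (us' ! s)]) vs') +
     (\<Sum>s<length vs - 1. mdet (b x) \<alpha>s us' (vs'[s := \<Gamma> w (vs' ! s)]))" for w vs'
  have "((\<lambda>y. mdet (b y) \<alpha>s us' (omit j vs)) has_derivative (\<lambda>w. D w (omit j vs))) (at x)" if "j <
      length vs" for j
    using Cons.IH[of us' "omit j vs"] Cons.prems that by (simp add: D_def us)
  then have "((\<lambda>y. mdet (b y) (\<alpha> # \<alpha>s) us vs) has_derivative (\<lambda>w. \<Sum>j<length vs.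
      (-1) ^ j * ?b u (vs ! j) * D w (omit j vs) +
      (-1) ^ j * (?b (\<Gamma> w u) (vs ! j) + ?b u (\<Gamma> w (vs ! j))) * mdet (b x) \<alpha>s us' (omit j vs))) (at
          x)"
    unfolding mdet.simps us list.sel
    by (intro has_derivative_sum has_derivative_mult has_derivative_mult_right Cons.prems(1)) auto
  moreover have "(\<Sum>j<length vs. (-1) ^ j * ?b u (vs ! j) * D w (omit j vs) +
      (-1) ^ j * (?b (\<Gamma> w u) (vs ! j) + ?b u (\<Gamma> w (vs ! j))) * mdet (b x) \<alpha>s us' (omit j vs)) =
     (\<Sum>s<length us. mdet (b x) (\<alpha> # \<alpha>s) (us[s := \<Gamma> w (us ! s)]) vs) +
     (\<Sum>s<length vs. mdet (b x) (\<alpha> # \<alpha>s) us (vs[s := \<Gamma> w (vs ! s)]))" for w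
  proof -
    have 1: "(\<Sum>s<length us. mdet (b x) (\<alpha> # \<alpha>s) (us[s := \<Gamma> w (us ! s)]) vs) =
      (\<Sum>j<length vs. (-1) ^ j * ?b (\<Gamma> w u) (vs ! j) * mdet (b x) \<alpha>s us' (omit j vs)) +
      (\<Sum>j<length vs. (-1) ^ j * ?b u (vs ! j) * (\<Sum>s<length us'. mdet (b x) \<alpha>s (us'[s := \<Gamma> w (us' !
          s)]) (omit j vs)))"
      unfolding us by (simp add: sum.lessThan_Suc_shift sum_distrib_left del: sum.lessThan_Suc)
          (rule sum.swap)
    have 2: "(\<Sum>s<length vs. mdet (b x) (\<alpha> # \<alpha>s) us (vs[s := \<Gamma> w (vs ! s)])) =
      (\<Sum>j<length vs. (-1) ^ j * ?b u (\<Gamma> w (vs ! j)) * mdet (b x) \<alpha>s us' (omit j vs) + 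
         (-1) ^ j * ?b u (vs ! j) * (\<Sum>s<length vs - 1. mdet (b x) \<alpha>s us' ((omit j vs)[s := \<Gamma> w
             (omit j vs ! s)])))"
    proof -
      have "(\<Sum>s<length vs. mdet (b x) (\<alpha> # \<alpha>s) us (vs[s := \<Gamma> w (vs ! s)])) =
        (\<Sum>j<length vs. \<Sum>s<length vs. (-1) ^ j * ?b u (vs[s := \<Gamma> w (vs ! s)] ! j) *
            mdet (b x) \<alpha>s us' (omit j (vs[s := \<Gamma> w (vs ! s)])))"
        unfolding us by (simp del: sum.lessThan_Suc) (rule sum.swap)
      also have "\<dots> = (\<Sum>j<length vs. (-1) ^ j * ?b u (\<Gamma> w (vs ! j)) * mdet (b x) \<alpha>s us' (omit j vs)
          + 
         (-1) ^ j * ?b u (vs ! j) * (\<Sum>s<length vs - 1. mdet (b x) \<alpha>s us' ((omit j vs)[s := \<Gamma> w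
             (omit j vs ! s)])))"
      proof (intro sum.cong refl)
        fix j assume "j \<in> {..<length vs}"
        then have j: "j < length vs" by simp
        \<comment> \<open>For s = j the update changes only the entry in the first row, since the
          minor omits position j. The conditional term records this difference.\<close>
        have "(\<Sum>s<length vs. (-1) ^ j * ?b u (vs[s := \<Gamma> w (vs ! s)] ! j) *
            mdet (b x) \<alpha>s us' (omit j (vs[s := \<Gamma> w (vs ! s)]))) =
          (\<Sum>s<length vs. (-1) ^ j * ?b u (vs ! j) * mdet (b x) \<alpha>s us' (omit j (vs[s := \<Gamma> w (vs !
              s)])) +
             (if s = j then (-1) ^ j * (?b u (\<Gamma> w (vs ! j)) - ?b u (vs ! j)) * mdet (b x) \<alpha>s us'
                 (omit j vs) else 0))"
          using j by (intro sum.cong refl) (auto simp: nth_list_update omit_def algebra_simps)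
        also have "\<dots> = (-1) ^ j * ?b u (vs ! j) * (\<Sum>s<length vs. mdet (b x) \<alpha>s us' (omit j (vs[s
            := \<Gamma> w (vs ! s)]))) +
            (-1) ^ j * (?b u (\<Gamma> w (vs ! j)) - ?b u (vs ! j)) * mdet (b x) \<alpha>s us' (omit j vs)"
          using j by (simp add: sum.distrib sum_distrib_left)
        also have "(\<Sum>s<length vs. mdet (b x) \<alpha>s us' (omit j (vs[s := \<Gamma> w (vs ! s)]))) = mdet (b x)
            \<alpha>s us' (omit j vs) +
            (\<Sum>s<length vs - 1. mdet (b x) \<alpha>s us' ((omit j vs)[s := \<Gamma> w (omit j vs ! s)]))"
          by (rule sum_omit_list_update[OF j])
        finally show "(\<Sum>s<length vs. (-1) ^ j * ?b u (vs[s := \<Gamma> w (vs ! s)] ! j) *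
            mdet (b x) \<alpha>s us' (omit j (vs[s := \<Gamma> w (vs ! s)]))) =
          (-1) ^ j * ?b u (\<Gamma> w (vs ! j)) * mdet (b x) \<alpha>s us' (omit j vs) + 
         (-1) ^ j * ?b u (vs ! j) * (\<Sum>s<length vs - 1. mdet (b x) \<alpha>s us' ((omit j vs)[s := \<Gamma> w
             (omit j vs ! s)]))"
          by (simp add: algebra_simps)
      qed
      finally show ?thesis .
    qed
    show ?thesis
      unfolding 1 2 D_def sum.distrib[symmetric] by (intro sum.cong refl) (simp add: algebra_simps)
  qed
  ultimately show ?case by simp
qed simp

context product_param
begin

text \<open>\<open>K\<^sub>4\<close> is a combination, with constant coefficients, of products of the parallel tensors
  \<^const>\<open>factor_metric\<close>.\<close>

lemma covd_K4:
  assumes x: "x \<in> U" and len: "length ws = 8"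
  shows "covd g (K4_field g) x (v # ws) = 0"
proof -
  let ?n = "\<lambda>\<alpha>. (\<Sum>c\<in>Basis. c \<bullet> Q \<alpha> c) - 1"
  let ?C = "projection_coeff m ?n (thorpe_coeff k)"
  let ?M = "\<lambda>\<alpha>s ws. mdet (factor_metric x) \<alpha>s (take 4 ws) (drop 4 ws)"
  let ?\<Gamma> = "christoffel g x"
  have K: "K4_field g y ws' = label_sum m 4 (\<lambda>\<alpha>s. ?C \<alpha>s * mdet (factor_metric y) \<alpha>s (take 4 ws')
      (drop 4 ws'))"
    if "y \<in> U" "length ws' = 8" for y ws'
    using K4_product(3)[OF that(1)] that(2) by (simp add: K4_field_def eq_mform_def mform_def)
  have label_deriv: "((\<lambda>y. label_sum m p (\<lambda>\<alpha>s. F \<alpha>s y)) has_derivative (\<lambda>w. label_sum m p (\<lambda>\<alpha>s. F'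
      \<alpha>s w))) (at x)"
    if "\<And>\<alpha>s. length \<alpha>s = p \<Longrightarrow> set \<alpha>s \<subseteq> {..<m} \<Longrightarrow> (F \<alpha>s has_derivative F' \<alpha>s) (at x)" for p and F F'
        :: "nat list \<Rightarrow> 'm \<Rightarrow> real"
    using that
  proof (induction p arbitrary: F F')
    case (Suc p)
    show ?case
      unfolding label_sum.simps
    proof (rule has_derivative_sum)
      fix \<alpha> assume "\<alpha> \<in> {..<m}"
      then show "((\<lambda>y. label_sum m p (\<lambda>\<alpha>s. F (\<alpha> # \<alpha>s) y)) has_derivative (\<lambda>w. label_sum m p (\<lambda>\<alpha>s.
          F' (\<alpha> # \<alpha>s) w))) (at x)"
        by (intro Suc.IH Suc.prems) auto
    qed
  qed simp
  have M: "((\<lambda>y. mdet (factor_metric y) \<alpha>s (take 4 ws) (drop 4 ws)) has_derivative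
      (\<lambda>w. \<Sum>s<8. ?M \<alpha>s (ws[s := ?\<Gamma> w (ws ! s)]))) (at x)"
    if "length \<alpha>s = 4" "set \<alpha>s \<subseteq> {..<m}" for \<alpha>s
  proof -
    have "((\<lambda>y. mdet (factor_metric y) \<alpha>s (take 4 ws) (drop 4 ws)) has_derivative
      (\<lambda>w. (\<Sum>s<length (take 4 ws). mdet (factor_metric x) \<alpha>s ((take 4 ws)[s := ?\<Gamma> w (take 4 ws !
          s)]) (drop 4 ws)) +
       (\<Sum>s<length (drop 4 ws). mdet (factor_metric x) \<alpha>s (take 4 ws) ((drop 4 ws)[s := ?\<Gamma> w (drop
           4 ws ! s)])))) (at x)"
      by (rule mdet_has_derivative) (use that len factor_metric_deriv[OF x] in auto)
    moreover have "(\<Sum>s<length (take 4 ws). mdet (factor_metric x) \<alpha>s ((take 4 ws)[s := ?\<Gamma> w (take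
        4 ws ! s)]) (drop 4 ws)) +
       (\<Sum>s<length (drop 4 ws). mdet (factor_metric x) \<alpha>s (take 4 ws) ((drop 4 ws)[s := ?\<Gamma> w (drop
           4 ws ! s)])) =
       (\<Sum>s<8. ?M \<alpha>s (ws[s := ?\<Gamma> w (ws ! s)]))" for w
    proof -
      have "(\<Sum>s<8. ?M \<alpha>s (ws[s := ?\<Gamma> w (ws ! s)])) = (\<Sum>s<4. ?M \<alpha>s (ws[s := ?\<Gamma> w (ws ! s)])) +
         (\<Sum>s<4. ?M \<alpha>s (ws[4 + s := ?\<Gamma> w (ws ! (4 + s))]))"
        by (simp add: numeral_eq_Suc del: mdet.simps)
      then show ?thesis
        using len by (simp add: take_update_swap drop_update_swap list_update_beyond del:
            mdet.simps)
    qed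
    ultimately show ?thesis by simp
  qed
  have "((\<lambda>y. label_sum m 4 (\<lambda>\<alpha>s. ?C \<alpha>s * mdet (factor_metric y) \<alpha>s (take 4 ws) (drop 4 ws)))
      has_derivative
     (\<lambda>w. label_sum m 4 (\<lambda>\<alpha>s. ?C \<alpha>s * (\<Sum>s<8. ?M \<alpha>s (ws[s := ?\<Gamma> w (ws ! s)]))))) (at x)"
    by (intro label_deriv has_derivative_mult_right M)
  then have "((\<lambda>y. K4_field g y ws) has_derivative
     (\<lambda>w. label_sum m 4 (\<lambda>\<alpha>s. ?C \<alpha>s * (\<Sum>s<8. ?M \<alpha>s (ws[s := ?\<Gamma> w (ws ! s)]))))) (at x)"
    by (rule has_derivative_transform_within_open[OF _ U x]) (simp add: K len)
  from frechet_derivative_at[OF this, symmetric]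
  have "covd g (K4_field g) x (v # ws) = label_sum m 4 (\<lambda>\<alpha>s. ?C \<alpha>s * (\<Sum>s<8. ?M \<alpha>s (ws[s := ?\<Gamma> v
      (ws ! s)]))) -
     (\<Sum>s<8. label_sum m 4 (\<lambda>\<alpha>s. ?C \<alpha>s * ?M \<alpha>s (ws[s := ?\<Gamma> v (ws ! s)])))"
    using K[OF x] len by (simp del: mdet.simps sum.lessThan_Suc)
  then show ?thesis by (simp add: label_sum_sum sum_distrib_left del: mdet.simps sum.lessThan_Suc)
qed

text \<open>The first covariant derivative vanishes on all of the open set U, so its derivative does
  too, and every Christoffel term is again a value of the first covariant derivative.\<close>

lemma covd_covd_K4:
  assumes x: "x \<in> U" and len: "length ws = 8"
  shows "covd g (covd g (K4_field g)) x (u # v # ws) = 0"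
proof -
  have "((\<lambda>y. covd g (K4_field g) y (v # ws)) has_derivative (\<lambda>h. 0)) (at x)"
    by (rule has_derivative_transform_within_open[OF has_derivative_const[of 0] U x]) (simp add:
        covd_K4 len del: covd.simps)
  from frechet_derivative_at[OF this, symmetric]
  have 1: "frechet_derivative (\<lambda>y. covd g (K4_field g) y (v # ws)) (at x) u = 0" by simp
  \<comment> \<open>The update may hit the direction of differentiation (s = 0) or an argument; the
    value is 0 in both cases.\<close>
  have 2: "covd g (K4_field g) x ((v # ws)[s := z]) = 0" for s z
    using covd_K4[OF x] len by (cases s) (simp_all del: covd.simps)
  show ?thesis by (subst covd.simps(2)) (simp only: 1 2 sum.neutral_const diff_zero)
qed

lemma higher_bach_product:
  assumes x: "x \<in> U"
  defines "n \<equiv> (\<lambda>\<alpha>. (\<Sum>c\<in>Basis. c \<bullet> Q \<alpha> c) - 1)"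
  shows "higher_bach g x a b = - 1 / 6 * (\<Sum>\<beta><m. bach_coeff m n (contraction_coeff m n
      (thorpe_coeff k))
     (projection_coeff m n (thorpe_coeff k)) \<beta> * factor_metric x \<beta> a b)"
proof -
  let ?E = "onb (g x)"
  let ?P = "contraction_coeff m n (thorpe_coeff k)" and ?C = "projection_coeff m n (thorpe_coeff k)"
  have P: "contraction (g x) (R4 g x) [i1, i2, k'] [j1, j2, l] = mform m (factor_metric x) 3 ?P
      [i1, i2, k'] [j1, j2, l]"
    for i1 i2 k' j1 j2 l
    using K4_product(2)[OF x] by (simp add: eq_mform_def n_def)
  have C: "K4_field g x [a, j1, j2, l, b, i1, i2, k'] = mform m (factor_metric x) 4 ?C [a, j1, j2,
      l] [b, i1, i2, k']"
    for i1 i2 k' j1 j2 l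
    using K4_product(3)[OF x] by (simp add: eq_mform_def n_def K4_field_def)
  have "higher_bach g x a b = (\<Sum>i1\<in>?E. \<Sum>i2\<in>?E. \<Sum>j1\<in>?E. \<Sum>j2\<in>?E. \<Sum>k'\<in>?E. \<Sum>l\<in>?E.
      - 1 / 6 * (mform m (factor_metric x) 3 ?P [i1, i2, k'] [j1, j2, l] * mform m (factor_metric
          x) 4 ?C [a, j1, j2, l] [b, i1, i2, k']))"
    unfolding higher_bach_def Let_def P C by (simp add: covd_covd_K4[OF x] del: covd.simps)
  also have "\<dots> = - 1 / 6 * (\<Sum>\<beta><m. bach_coeff m n ?P ?C \<beta> * factor_metric x \<beta> a b)"
    unfolding sum_distrib_left[symmetric]
    using sum_mform_mform[OF adapted_frame_onb[OF x, folded n_def], of ?P ?C a b] by simp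
  finally show ?thesis .
qed

end

section \<open>Smooth functions and graph charts\<close>

lemma times_differentiable_on_imp_continuous_on:
  "times_differentiable_on k U f \<Longrightarrow> continuous_on U f"
  by (cases k) (auto intro: differentiable_imp_continuous_on)

lemma times_differentiable_on_Suc_imp:
  "times_differentiable_on (Suc k) U f \<Longrightarrow> times_differentiable_on k U f"
proof (induction k arbitrary: f)
  case 0
  then show ?case using times_differentiable_on_imp_continuous_on by fastforce
next
  case (Suc k)
  from Suc.prems have "f differentiable_on U" and 1: "times_differentiable_on (Suc k) U (\<lambda>x.
      frechet_derivative f (at x) v)" for v
    unfolding times_differentiable_on.simps(2)[of "Suc k"] by blast+
  then show ?case
    unfolding times_differentiable_on.simps(2)[of k] using Suc.IH[OF 1] by blast
qed

lemma times_differentiable_on_cong: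
  assumes U: "open U" and fg: "\<And>x. x \<in> U \<Longrightarrow> f x = g x" and f: "times_differentiable_on k U f"
  shows "times_differentiable_on k U g"
  using fg f
proof (induction k arbitrary: f g)
  case 0
  then show ?case by (simp cong: continuous_on_cong)
next
  case (Suc k)
  have d: "(g has_derivative frechet_derivative f (at x)) (at x)" if "x \<in> U" for x
    by (rule has_derivative_transform_within_open[OF times_differentiable_onD[OF Suc.prems(2) U
        that] U that])
       (rule Suc.prems(1))
  have "times_differentiable_on k U (\<lambda>x. frechet_derivative g (at x) v)" for v
  proof (rule Suc.IH)
    show "times_differentiable_on k U (\<lambda>x. frechet_derivative f (at x) v)"
      using Suc.prems(2) unfolding times_differentiable_on.simps by blast
    show "frechet_derivative f (at x) v = frechet_derivative g (at x) v" if "x \<in> U" for x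
      using frechet_derivative_at[OF d[OF that]] by (rule fun_cong)
  qed
  moreover have "g differentiable_on U"
    unfolding differentiable_on_def using d has_derivative_at_withinI unfolding differentiable_def
        by blast
  ultimately show ?case unfolding times_differentiable_on.simps by blast
qed

lemma times_differentiable_onI:
  assumes U: "open U" and f: "\<And>x. x \<in> U \<Longrightarrow> (f has_derivative f' x) (at x)"
    and f': "\<And>v. times_differentiable_on k U (\<lambda>x. f' x v)"
  shows "times_differentiable_on (Suc k) U f"
proof -
  have "times_differentiable_on k U (\<lambda>x. frechet_derivative f (at x) v)" for v
    by (rule times_differentiable_on_cong[OF U _ f'[of v]]) (rule fun_cong[OF
        frechet_derivative_at[OF f]])
  moreover have "f differentiable_on U"
    unfolding differentiable_on_def using f has_derivative_at_withinI unfolding differentiable_def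
        by blast
  ultimately show ?thesis unfolding times_differentiable_on.simps by blast
qed

lemma times_differentiable_on_derivD:
  "times_differentiable_on (Suc k) U f \<Longrightarrow> times_differentiable_on k U (\<lambda>x. frechet_derivative f (at
      x) v)"
  unfolding times_differentiable_on.simps by blast

lemma times_differentiable_on_const: "open U \<Longrightarrow> times_differentiable_on k U (\<lambda>x. c)"
proof (induction k arbitrary: c)
  case (Suc k)
  show ?case
    by (rule times_differentiable_onI[where f' = "\<lambda>_ _. 0", OF Suc.prems]) (simp, rule Suc.IH[OF
        Suc.prems])
qed simp

lemma times_differentiable_on_linear:
  assumes U: "open U" and f: "bounded_linear f"
  shows "times_differentiable_on k U f"
proof (cases k)
  case 0
  then show ?thesis using f by (simp add: bounded_linear.continuous_on[OF f continuous_on_id])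
next
  case (Suc k')
  show ?thesis unfolding Suc
    by (rule times_differentiable_onI[where f' = "\<lambda>_. f", OF U])
      (rule bounded_linear.has_derivative[OF f has_derivative_ident], rule
          times_differentiable_on_const[OF U])
qed

lemma times_differentiable_on_add:
  assumes U: "open U" and "times_differentiable_on k U f" "times_differentiable_on k U g"
  shows "times_differentiable_on k U (\<lambda>x. f x + g x)"
  using assms(2,3)
proof (induction k arbitrary: f g)
  case (Suc k)
  note f' = times_differentiable_onD[OF Suc.prems(1) U] times_differentiable_on_derivD[OF
      Suc.prems(1)]
  note g' = times_differentiable_onD[OF Suc.prems(2) U] times_differentiable_on_derivD[OF
      Suc.prems(2)]
  show ?case
    by (rule times_differentiable_onI[OF U has_derivative_add[OF f'(1) g'(1)] Suc.IH[OF f'(2)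
        g'(2)]])
qed (simp add: continuous_on_add)

lemma times_differentiable_on_sum:
  assumes U: "open U" and "\<And>i. i \<in> I \<Longrightarrow> times_differentiable_on k U (f i)"
  shows "times_differentiable_on k U (\<lambda>x. \<Sum>i\<in>I. f i x)"
proof (cases "finite I")
  case True
  then show ?thesis using assms(2)
    by (induction I) (auto intro!: times_differentiable_on_const times_differentiable_on_add U)
qed (simp add: times_differentiable_on_const U)

lemma times_differentiable_on_bilinear:
  fixes f :: "'a::euclidean_space \<Rightarrow> 'b::euclidean_space" and g :: "'a \<Rightarrow> 'c::euclidean_space"
    and B :: "'b \<Rightarrow> 'c \<Rightarrow> 'd::euclidean_space"
  assumes B: "bounded_bilinear B" and U: "open U"
    and "times_differentiable_on k U f" "times_differentiable_on k U g"
  shows "times_differentiable_on k U (\<lambda>x. B (f x) (g x))"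
  using assms(3,4)
proof (induction k arbitrary: f g)
  case (Suc k)
  note f' = times_differentiable_onD[OF Suc.prems(1) U] times_differentiable_on_derivD[OF
      Suc.prems(1)]
  note g' = times_differentiable_onD[OF Suc.prems(2) U] times_differentiable_on_derivD[OF
      Suc.prems(2)]
  note fg = Suc.prems[THEN times_differentiable_on_Suc_imp]
  show ?case
    by (rule times_differentiable_onI[OF U bounded_bilinear.FDERIV[OF B f'(1) g'(1)]
      times_differentiable_on_add[OF U Suc.IH[OF fg(1) g'(2)] Suc.IH[OF f'(2) fg(2)]]])
qed (simp add: bounded_bilinear.continuous_on[OF B])

text \<open>Differentiation lowers the exponent by one, so the induction has to run over all
  exponents at once.\<close>

lemma times_differentiable_on_powr:
  fixes q :: "'a::euclidean_space \<Rightarrow> real"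
  assumes U: "open U" and "times_differentiable_on k U q" and pos: "\<And>x. x \<in> U \<Longrightarrow> q x > 0"
  shows "times_differentiable_on k U (\<lambda>x. q x powr a)"
  using assms(2)
proof (induction k arbitrary: a)
  case 0
  then show ?case using pos by (auto intro!: continuous_on_powr continuous_on_const
      less_imp_neq[symmetric])
next
  case (Suc k)
  note q' = times_differentiable_onD[OF Suc.prems U] times_differentiable_on_derivD[OF Suc.prems]
  show ?case
  proof (rule times_differentiable_onI[OF U])
    fix x assume x: "x \<in> U"
    have "((\<lambda>z. z powr a) has_derivative (\<lambda>h. a * q x powr (a - 1) * h)) (at (q x))"
      using has_real_derivative_powr[OF pos[OF x], of a] by (simp add: has_field_derivative_def)
    from has_derivative_compose[OF q'(1)[OF x] this]
    show "((\<lambda>x. q x powr a) has_derivative (\<lambda>h. a * q x powr (a - 1) * frechet_derivative q (at x)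
        h)) (at x)" .
  next
    fix v
    show "times_differentiable_on k U (\<lambda>x. a * q x powr (a - 1) * frechet_derivative q (at x) v)"
      by (intro times_differentiable_on_bilinear[OF bounded_bilinear_mult U]
          times_differentiable_on_const[OF U]
        Suc.IH[OF times_differentiable_on_Suc_imp[OF Suc.prems]] q'(2))
  qed
qed

section \<open>Graph charts of the sphere product\<close>

context sphere_product
begin

definition sphere_prod :: "'e set" where
  "sphere_prod = {y. \<forall>\<alpha><m. k \<alpha> * (y \<bullet> Q \<alpha> y) = 1}"

lemma product_param_local_param:
  assumes "local_param sphere_prod U f" "DIM('e) = DIM('m) + m"
  shows "product_param Q k m f (U :: 'm::euclidean_space set)"
proof
  show "open U" "smooth_on U f" "\<And>x. x \<in> U \<Longrightarrow> inj (frechet_derivative f (at x))"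
    using assms(1) by (auto simp: local_param_def)
  have "f ` U \<subseteq> sphere_prod"
    using assms(1) openin_subset by (fastforce simp: local_param_def)
  then show "k \<alpha> * (f x \<bullet> Q \<alpha> (f x)) = 1" if "x \<in> U" "\<alpha> < m" for x \<alpha>
    using that by (auto simp: sphere_prod_def)
qed (rule assms(2))

text \<open>The m normals are nonzero and pairwise orthogonal, and the tangent space is the
  orthogonal complement of their span.\<close>

lemma dim_tangent_space:
  assumes p: "p \<in> sphere_prod"
  shows "dim {w. \<forall>\<alpha><m. w \<bullet> Q \<alpha> p = 0} + m = DIM('e)"
proof -
  let ?N = "(\<lambda>\<alpha>. Q \<alpha> p) ` {..<m}"
  have pp: "Q \<alpha> p \<bullet> Q \<beta> p = (if \<alpha> = \<beta> then 1 / k \<alpha> else 0)" if "\<alpha> < m" "\<beta> < m" for \<alpha> \<beta>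
    using p that k[of \<alpha>] by (auto simp: Q_inner_Q sphere_prod_def field_simps)
  have ne: "Q \<alpha> p \<bullet> Q \<alpha> p \<noteq> 0" if "\<alpha> < m" for \<alpha>
    using pp[OF that that] k[OF that] by simp
  have "inj_on (\<lambda>\<alpha>. Q \<alpha> p) {..<m}"
  proof (rule inj_onI, rule ccontr)
    fix \<alpha> \<beta> assume "\<alpha> \<in> {..<m}" "\<beta> \<in> {..<m}" "Q \<alpha> p = Q \<beta> p" "\<alpha> \<noteq> \<beta>"
    then show False using pp[of \<alpha> \<beta>] ne[of \<beta>] by simp
  qed
  then have card: "card ?N = m" by (simp add: card_image)
  have "pairwise orthogonal ?N" using pp by (auto simp: pairwise_def orthogonal_def)
  moreover have "0 \<notin> ?N" using ne by force
  ultimately have "independent ?N" using pairwise_orthogonal_independent by blast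
  then have dimN: "dim (span ?N) = m" using card dim_eq_card_independent[of ?N] by (simp add:
      dim_span)
  have "{w \<in> UNIV. \<forall>n\<in>span ?N. orthogonal n w} = {w. \<forall>\<alpha><m. w \<bullet> Q \<alpha> p = 0}"
  proof (intro equalityI subsetI)
    fix w assume "w \<in> {w \<in> UNIV. \<forall>n\<in>span ?N. orthogonal n w}"
    then have "orthogonal (Q \<alpha> p) w" if "\<alpha> < m" for \<alpha> using that span_base[of "Q \<alpha> p" ?N] by auto
    then show "w \<in> {w. \<forall>\<alpha><m. w \<bullet> Q \<alpha> p = 0}" by (simp add: orthogonal_def inner_commute)
  next
    fix w assume w: "w \<in> {w. \<forall>\<alpha><m. w \<bullet> Q \<alpha> p = 0}"
    have "orthogonal w n" if "n \<in> span ?N" for n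
      by (rule orthogonal_to_span[OF that]) (use w in \<open>auto simp: orthogonal_def\<close>)
    then show "w \<in> {w \<in> UNIV. \<forall>n\<in>span ?N. orthogonal n w}" by (auto simp: orthogonal_commute)
  qed
  then show ?thesis
    using dim_subspace_orthogonal_to_vectors[of "span ?N" UNIV] dimN by (simp add: subspace_span)
qed

text \<open>The sphere product is locally the graph over its tangent space at \<open>p\<close>; the inverse of the
  parametrization is the orthogonal projection, which is linear.\<close>

lemma graph_chart:
  assumes p: "p \<in> sphere_prod" and dim: "DIM('e) = DIM('m) + m"
  shows "\<exists>(U :: 'm::euclidean_space set) f. local_param sphere_prod U f \<and> p \<in> f ` U"
proof -
  let ?T = "{w. \<forall>\<alpha><m. w \<bullet> Q \<alpha> p = 0}"
  have subT: "subspace ?T" by (auto simp: subspace_def inner_add_left)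
  have "dim (UNIV :: 'm set) = dim ?T" using dim_tangent_space[OF p] dim by simp
  from isometries_subspaces[OF subspace_UNIV subT this]
  \<comment> \<open>\<iota> identifies the model space with the tangent space at p; L inverts it
    there and is linear on the ambient space.\<close>
  have "\<exists>(\<iota> :: 'm \<Rightarrow> 'e) L. linear \<iota> \<and> range \<iota> = ?T \<and> linear L \<and> (\<forall>x. L (\<iota> x) = x) \<and> (\<forall>w\<in>?T. \<iota> (L
      w) = w)"
    by (smt (verit) UNIV_I)
  then obtain \<iota> :: "'m \<Rightarrow> 'e" and L where \<iota>: "linear \<iota>" "range \<iota> = ?T"
    and L: "linear L" "\<forall>x. L (\<iota> x) = x" "\<forall>w\<in>?T. \<iota> (L w) = w" by blast
  have bl\<iota>: "bounded_linear \<iota>" and blL: "bounded_linear L" using \<iota>(1) L(1) by (simp_all add: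
      linear_linear)
  have \<iota>p: "\<iota> x \<bullet> Q \<alpha> p = 0" if "\<alpha> < m" for x \<alpha> using \<iota>(2) that by auto
  have pp: "p \<bullet> Q \<alpha> p = 1 / k \<alpha>" if "\<alpha> < m" for \<alpha>
    using p that k[of \<alpha>] by (auto simp: sphere_prod_def field_simps)
  \<comment> \<open>Solves the sphere equation for the height: with \<open>Q\<close> \<alpha> p of
    squared length 1 / k \<alpha>, the point over x has component sqrt (q \<alpha> x) along
    \<open>Q\<close> \<alpha> p.\<close>
  define q where "q \<alpha> x = 1 - k \<alpha> * (\<iota> x \<bullet> Q \<alpha> (\<iota> x))" for \<alpha> x
  define U where "U = {x. \<forall>\<alpha>\<in>{..<m}. 0 < q \<alpha> x}"
  define f where "f x = \<iota> x + (\<Sum>\<alpha><m. (q \<alpha> x powr (1 / 2)) *\<^sub>R Q \<alpha> p)" for x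
  \<comment> \<open>Orthogonal projection onto the tangent space, using that the normals have
    squared length 1 / k \<alpha>.\<close>
  define pr where "pr y = y - (\<Sum>\<alpha><m. (k \<alpha> * (y \<bullet> Q \<alpha> p)) *\<^sub>R Q \<alpha> p)" for y
  have q_cont: "continuous_on UNIV (q \<alpha>)" for \<alpha>
    unfolding q_def
    by (intro continuous_intros bounded_linear.continuous_on[OF bl\<iota>]
        bounded_linear.continuous_on[OF bounded_linear_Q])
  have openU: "open U"
  proof -
    have "open (\<Inter>\<alpha>\<in>{..<m}. {x. 0 < q \<alpha> x})"
      by (intro open_INT ballI open_Collect_less q_cont continuous_on_const finite_lessThan)
    moreover have "U = (\<Inter>\<alpha>\<in>{..<m}. {x. 0 < q \<alpha> x})" by (auto simp: U_def)
    ultimately show ?thesis by simp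
  qed
  have smooth: "times_differentiable_on n U f" for n
  proof -
    have q: "times_differentiable_on n U (q \<alpha>)" for \<alpha>
    proof -
      note inner = times_differentiable_on_bilinear[OF bounded_bilinear_inner openU
          times_differentiable_on_linear[OF openU bl\<iota>]
          times_differentiable_on_linear[OF openU bounded_linear_compose[OF bounded_linear_Q bl\<iota>]]]
      have "times_differentiable_on n U (\<lambda>x. 1 + (- k \<alpha>) * (\<iota> x \<bullet> Q \<alpha> (\<iota> x)))"
        by (rule times_differentiable_on_add[OF openU times_differentiable_on_const[OF openU]
            times_differentiable_on_bilinear[OF bounded_bilinear_mult openU
                times_differentiable_on_const[OF openU] inner]])
      then show ?thesis by (simp add: q_def[abs_def])
    qed
    have "times_differentiable_on n U (\<lambda>x. q \<alpha> x powr (1 / 2))" if "\<alpha> \<in> {..<m}" for \<alpha>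
      by (rule times_differentiable_on_powr[OF openU q]) (use that in \<open>simp add: U_def\<close>)
    note scaled = times_differentiable_on_bilinear[OF bounded_bilinear_scaleR openU this
        times_differentiable_on_const[OF openU]]
    show ?thesis
      unfolding f_def[abs_def]
      by (rule times_differentiable_on_add[OF openU times_differentiable_on_linear[OF openU bl\<iota>]
          times_differentiable_on_sum[OF openU scaled]])
  qed
  have Qf: "Q \<beta> (f x) = Q \<beta> (\<iota> x) + (q \<beta> x powr (1 / 2)) *\<^sub>R Q \<beta> p" if "\<beta> < m" for x \<beta>
  proof -
    have "Q \<beta> (f x) = Q \<beta> (\<iota> x) + (\<Sum>\<alpha><m. (q \<alpha> x powr (1 / 2)) *\<^sub>R Q \<beta> (Q \<alpha> p))"
      unfolding f_def by (simp add: linear_add[OF Q] linear_sum[OF Q] linear_scale[OF Q])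
    also have "(\<Sum>\<alpha><m. (q \<alpha> x powr (1 / 2)) *\<^sub>R Q \<beta> (Q \<alpha> p)) = (\<Sum>\<alpha><m. if \<alpha> = \<beta> then (q \<beta> x powr (1
        / 2)) *\<^sub>R Q \<beta> p else 0)"
      using that by (intro sum.cong) (auto simp: Q_Q)
    finally show ?thesis using that by simp
  qed
  have fp: "f x \<bullet> Q \<beta> p = q \<beta> x powr (1 / 2) / k \<beta>" if "\<beta> < m" for x \<beta>
  proof -
    have "f x \<bullet> Q \<beta> p = Q \<beta> (f x) \<bullet> p" by (simp add: Q_adj)
    also have "\<dots> = q \<beta> x powr (1 / 2) / k \<beta>"
      unfolding Qf[OF that] inner_add_left using \<iota>p[OF that, of x] pp[OF that] by (simp add: Q_adj)
    finally show ?thesis .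
  qed
  have f_sphere: "f x \<in> sphere_prod" if x: "x \<in> U" for x
    unfolding sphere_prod_def
  proof (intro CollectI allI impI)
    fix \<beta> assume \<beta>: "\<beta> < m"
    have "f x \<bullet> Q \<beta> (f x) = Q \<beta> (f x) \<bullet> Q \<beta> (f x)" using \<beta> by (simp add: Q_inner_Q)
    also have "\<dots> = \<iota> x \<bullet> Q \<beta> (\<iota> x) + (q \<beta> x powr (1 / 2) * q \<beta> x powr (1 / 2)) / k \<beta>"
    proof -
      have "p \<bullet> Q \<beta> (\<iota> x) = 0"
        using \<iota>p[OF \<beta>, of x] Q_adj[of \<beta> p "\<iota> x"] by (simp add: inner_commute)
      then show ?thesis
        unfolding Qf[OF \<beta>] using \<beta> \<iota>p[OF \<beta>, of x] pp[OF \<beta>]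
        by (simp add: inner_add_left inner_add_right Q_inner_Q)
    qed
    also have "q \<beta> x powr (1 / 2) * q \<beta> x powr (1 / 2) = q \<beta> x"
      using x \<beta> by (simp add: powr_add[symmetric] U_def less_imp_le)
    finally show "k \<beta> * (f x \<bullet> Q \<beta> (f x)) = 1" using k[OF \<beta>] by (simp add: q_def field_simps)
  qed
  have pr_f: "pr (f x) = \<iota> x" if "x \<in> U" for x
  proof -
    have "(\<Sum>\<alpha><m. (k \<alpha> * (f x \<bullet> Q \<alpha> p)) *\<^sub>R Q \<alpha> p) = (\<Sum>\<alpha><m. (q \<alpha> x powr (1 / 2)) *\<^sub>R Q \<alpha> p)"
      using k by (intro sum.cong refl) (auto simp: fp less_imp_neq[symmetric])
    then show ?thesis unfolding pr_def by (simp add: f_def)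
  qed
  have lin: "bounded_linear (\<lambda>y. L (pr y))"
  proof -
    have "linear pr"
      unfolding pr_def
      by (rule linearI) (simp_all add: inner_add_left distrib_left scaleR_left_distrib sum.distrib
          scaleR_diff_right scaleR_sum_right mult.left_commute)
    then have "bounded_linear pr" by (simp add: linear_linear)
    then show ?thesis by (rule bounded_linear_compose[OF blL])
  qed
  have Lf: "L (pr (f x)) = x" if "x \<in> U" for x using pr_f[OF that] L(2) by simp
  have inj: "inj (frechet_derivative f (at x))" if x: "x \<in> U" for x
  proof -
    have D: "(f has_derivative frechet_derivative f (at x)) (at x)"
      using times_differentiable_onD[OF smooth openU x] .
    \<comment> \<open>Differentiating the linear left inverse of f gives a left inverse of its
      derivative.\<close>
    have "((\<lambda>y. y) has_derivative (\<lambda>v. L (pr (frechet_derivative f (at x) v)))) (at x)"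
      by (rule has_derivative_transform_within_open[OF bounded_linear.has_derivative[OF lin D]
          openU x]) (rule Lf)
    from has_derivative_unique[OF this has_derivative_ident]
    have "L (pr (frechet_derivative f (at x) v)) = v" for v by (rule fun_cong)
    then show ?thesis by (rule inj_on_inverseI)
  qed
  \<comment> \<open>The chart covers the part of the product that lies, in every factor, in the open
    hemisphere around p; this shows that its image is relatively open.\<close>
  have image: "f ` U = sphere_prod \<inter> {y. \<forall>\<alpha>\<in>{..<m}. 0 < y \<bullet> Q \<alpha> p}"
  proof (intro equalityI subsetI)
    fix y assume "y \<in> f ` U"
    then obtain x where x: "x \<in> U" "y = f x" by blast
    have "0 < f x \<bullet> Q \<alpha> p" if "\<alpha> < m" for \<alpha>
    proof -
      have "q \<alpha> x > 0" using x(1) that by (simp add: U_def)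
      then show ?thesis using k[OF that] by (simp add: fp[OF that])
    qed
    then show "y \<in> sphere_prod \<inter> {y. \<forall>\<alpha>\<in>{..<m}. 0 < y \<bullet> Q \<alpha> p}" using x f_sphere by simp
  next
    fix y assume y: "y \<in> sphere_prod \<inter> {y. \<forall>\<alpha>\<in>{..<m}. 0 < y \<bullet> Q \<alpha> p}"
    have Qpr: "Q \<beta> (pr y) = Q \<beta> y - (k \<beta> * (y \<bullet> Q \<beta> p)) *\<^sub>R Q \<beta> p" if "\<beta> < m" for \<beta>
    proof -
      have "Q \<beta> (pr y) = Q \<beta> y - (\<Sum>\<alpha><m. (k \<alpha> * (y \<bullet> Q \<alpha> p)) *\<^sub>R Q \<beta> (Q \<alpha> p))"
        unfolding pr_def by (simp add: linear_diff[OF Q] linear_sum[OF Q] linear_scale[OF Q])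
      also have "(\<Sum>\<alpha><m. (k \<alpha> * (y \<bullet> Q \<alpha> p)) *\<^sub>R Q \<beta> (Q \<alpha> p)) = (\<Sum>\<alpha><m. if \<alpha> = \<beta> then (k \<beta> * (y \<bullet> Q
          \<beta> p)) *\<^sub>R Q \<beta> p else 0)"
        using that by (intro sum.cong) (auto simp: Q_Q)
      finally show ?thesis using that by simp
    qed
    have "pr y \<in> ?T"
    proof (intro CollectI allI impI)
      fix \<beta> assume \<beta>: "\<beta> < m"
      have "pr y \<bullet> Q \<beta> p = Q \<beta> (pr y) \<bullet> p" by (simp add: Q_adj)
      also have "\<dots> = 0" unfolding Qpr[OF \<beta>] inner_diff_left using pp[OF \<beta>] k[OF \<beta>] by (simp add:
          Q_adj)
      finally show "pr y \<bullet> Q \<beta> p = 0" .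
    qed
    then have \<iota>L: "\<iota> (L (pr y)) = pr y" using L(3) by blast
    \<comment> \<open>k \<beta> times the inner product of y with \<open>Q\<close> \<beta> p is the
      height of y over the tangent space; the sphere equation of factor \<beta> identifies its
      square.\<close>
    have q: "q \<beta> (L (pr y)) = (k \<beta> * (y \<bullet> Q \<beta> p)) ^ 2" if \<beta>: "\<beta> < m" for \<beta>
    proof -
      have "pr y \<bullet> Q \<beta> (pr y) = Q \<beta> (pr y) \<bullet> Q \<beta> (pr y)" using \<beta> by (simp add: Q_inner_Q)
      also have "\<dots> = y \<bullet> Q \<beta> y - 2 * (k \<beta> * (y \<bullet> Q \<beta> p)) * (y \<bullet> Q \<beta> p) + (k \<beta> * (y \<bullet> Q \<beta> p)) ^ 2 *
          (p \<bullet> Q \<beta> p)"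
      proof -
        have "p \<bullet> Q \<beta> y = y \<bullet> Q \<beta> p" using Q_adj[of \<beta> p y] by (simp add: inner_commute)
        then show ?thesis
          unfolding Qpr[OF \<beta>] using \<beta>
          by (simp add: inner_diff_left inner_diff_right Q_inner_Q power2_eq_square algebra_simps)
      qed
      finally have 1: "pr y \<bullet> Q \<beta> (pr y) = y \<bullet> Q \<beta> y - 2 * (k \<beta> * (y \<bullet> Q \<beta> p)) * (y \<bullet> Q \<beta> p) + (k
          \<beta> * (y \<bullet> Q \<beta> p)) ^ 2 * (1 / k \<beta>)"
        unfolding pp[OF \<beta>] .
      have "k \<beta> * (y \<bullet> Q \<beta> y) = 1" using y \<beta> by (simp add: sphere_prod_def)
      then show ?thesis
        unfolding q_def \<iota>L 1 using k[OF \<beta>] by (simp add: field_simps power2_eq_square)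
    qed
    have pos: "k \<beta> * (y \<bullet> Q \<beta> p) > 0" if "\<beta> < m" for \<beta> using y k[OF that] that by simp
    have "0 < q \<beta> (L (pr y))" if "\<beta> < m" for \<beta>
      unfolding q[OF that] using pos[OF that] by (rule zero_less_power)
    then have "L (pr y) \<in> U" by (simp add: U_def)
    moreover have "f (L (pr y)) = y"
    proof -
      have "(\<Sum>\<alpha><m. (q \<alpha> (L (pr y)) powr (1 / 2)) *\<^sub>R Q \<alpha> p) = (\<Sum>\<alpha><m. (k \<alpha> * (y \<bullet> Q \<alpha> p)) *\<^sub>R Q \<alpha> p)"
      proof (intro sum.cong refl)
        fix \<alpha> assume "\<alpha> \<in> {..<m}"
        then have \<alpha>: "\<alpha> < m" by simp
        show "(q \<alpha> (L (pr y)) powr (1 / 2)) *\<^sub>R Q \<alpha> p = (k \<alpha> * (y \<bullet> Q \<alpha> p)) *\<^sub>R Q \<alpha> p"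
          using pos[OF \<alpha>] unfolding q[OF \<alpha>] by (simp add: powr_half_sqrt)
      qed
      then show ?thesis unfolding f_def \<iota>L by (simp add: pr_def)
    qed
    ultimately show "y \<in> f ` U" by (metis imageI)
  qed
  have "open (\<Inter>\<alpha>\<in>{..<m}. {y. 0 < y \<bullet> Q \<alpha> p})"
    by (intro open_INT ballI open_Collect_less continuous_intros finite_lessThan)
  moreover have "(\<Inter>\<alpha>\<in>{..<m}. {y. 0 < y \<bullet> Q \<alpha> p}) = {y. \<forall>\<alpha>\<in>{..<m}. 0 < y \<bullet> Q \<alpha> p}" by auto
  ultimately have "open {y. \<forall>\<alpha>\<in>{..<m}. 0 < y \<bullet> Q \<alpha> p}" by simp
  then have "openin (top_of_set sphere_prod) (f ` U)"
    unfolding image by (rule openin_open_Int)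
  moreover have "homeomorphism U (f ` U) f (\<lambda>y. L (pr y))"
  proof (rule homeomorphismI)
    show "continuous_on U f" using smooth[of 0] by simp
    show "continuous_on (f ` U) (\<lambda>y. L (pr y))"
      by (rule bounded_linear.continuous_on[OF lin continuous_on_id])
  qed (auto simp: Lf)
  ultimately have "local_param sphere_prod U f"
    unfolding local_param_def smooth_on_def using openU smooth inj by blast
  moreover have "p \<in> f ` U"
    unfolding image using p pp k by simp
  ultimately show ?thesis by blast
qed

end

section \<open>The product of two surfaces and a fourfold\<close>

text \<open>Labels above 2 also select the last factor, in agreement with \<open>factor_dim\<close>,
  so that \<open>trace_factor_proj\<close> holds for every label.\<close>

definition factor_proj :: "nat \<Rightarrow> (real^3) \<times> (real^3) \<times> (real^5) \<Rightarrow> (real^3) \<times> (real^3) \<times> (real^5)"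
    where
  "factor_proj \<alpha> y = (if \<alpha> = 0 then (fst y, 0, 0) else if \<alpha> = Suc 0 then (0, fst (snd y), 0) else
      (0, 0, snd (snd y)))"

interpretation S: sphere_product factor_proj factor_curvature 3
proof (rule sphere_product.intro)
  show "linear (factor_proj \<alpha>)" for \<alpha>
    by (rule linearI) (auto simp: factor_proj_def prod_eq_iff)
  show "factor_proj \<alpha> u \<bullet> v = u \<bullet> factor_proj \<alpha> v" for \<alpha> u v
    by (simp add: factor_proj_def inner_prod_def)
  show "factor_proj \<alpha> (factor_proj \<beta> u) = (if \<alpha> = \<beta> then factor_proj \<alpha> u else 0)" if "\<alpha> < 3" "\<beta> <
      3" for \<alpha> \<beta> u
    using that by (auto simp: factor_proj_def prod_eq_iff)
  show "(\<Sum>\<alpha><3. factor_proj \<alpha> u) = u" for u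
    unfolding sum_lessThan_3 by (simp add: factor_proj_def prod_eq_iff)
  show "factor_curvature \<alpha> > 0" for \<alpha>
    by (simp add: factor_curvature_def)
qed

lemma round_sphere_eq: "k > 0 \<Longrightarrow> y \<in> round_sphere k \<longleftrightarrow> k * (y \<bullet> y) = 1"
proof -
  assume k: "k > 0"
  have "y \<in> round_sphere k \<longleftrightarrow> sqrt (y \<bullet> y) = sqrt (1 / k)"
    by (simp add: round_sphere_def dist_norm norm_eq_sqrt_inner real_sqrt_divide)
  also have "\<dots> \<longleftrightarrow> k * (y \<bullet> y) = 1" using k by (simp add: field_simps)
  finally show ?thesis .
qed

lemma all_less_3: "(\<forall>\<alpha><3. P \<alpha>) \<longleftrightarrow> P 0 \<and> P (Suc 0) \<and> P (2::nat)"
  by (auto simp: numeral_3_eq_3 numeral_2_eq_2 less_Suc_eq)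

lemma round_sphere_product:
  "round_sphere 3 \<times> round_sphere 3 \<times> round_sphere 1 = S.sphere_prod"
proof (rule set_eqI)
  fix y :: "(real^3) \<times> (real^3) \<times> (real^5)"
  show "y \<in> round_sphere 3 \<times> round_sphere 3 \<times> round_sphere 1 \<longleftrightarrow> y \<in> S.sphere_prod"
    unfolding S.sphere_prod_def mem_Collect_eq all_less_3
    by (cases y) (simp add: round_sphere_eq factor_proj_def factor_curvature_def inner_prod_def)
qed

lemma trace_factor_proj: "(\<Sum>c\<in>Basis. c \<bullet> factor_proj \<alpha> c) - 1 = factor_dim \<alpha>"
proof -
  have B: "sum f Basis = (\<Sum>i\<in>Basis. f (i, 0)) + (\<Sum>i\<in>Basis. f (0, i))"
    for f :: "'a::euclidean_space \<times> 'b::euclidean_space \<Rightarrow> real"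
    unfolding Basis_prod_def by (subst sum.union_disjoint)
      (auto simp: sum.reindex inj_on_def)
  show ?thesis unfolding B factor_proj_def by (simp add: inner_prod_def factor_dim_def)
qed

theorem proposition1:
  "let M = round_sphere 3 \<times> round_sphere 3 \<times> round_sphere 1
         :: ((real^3) \<times> (real^3) \<times> (real^5)) set
   in submanifold TYPE(real^8) M \<and> einstein TYPE(real^8) M \<and>
      \<not> higher_bach_flat TYPE(real^8) M"
proof -
  have dim: "DIM((real^3) \<times> (real^3) \<times> (real^5)) = DIM(real^8) + 3" by simp
  have chart: "\<exists>(U :: (real^8) set) f. local_param S.sphere_prod U f \<and> p \<in> f ` U" if "p \<in>
      S.sphere_prod" for p
    using that dim by (rule S.graph_chart)
  have param: "product_param factor_proj factor_curvature 3 f U"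
    if "local_param S.sphere_prod U f" for U :: "(real^8) set" and f
    using that dim by (rule S.product_param_local_param)
  have dims: "(\<lambda>\<alpha>. (\<Sum>c\<in>Basis. c \<bullet> factor_proj \<alpha> c) - 1) = factor_dim"
    by (intro ext trace_factor_proj)
  have "einstein TYPE(real^8) S.sphere_prod"
    unfolding einstein_def
  proof (intro exI[of _ 3] allI impI ballI)
    fix U :: "(real^8) set" and f x u v assume f: "local_param S.sphere_prod U f" and x: "x \<in> U"
    interpret product_param factor_proj factor_curvature 3 f U using f by (rule param)
    have "factor_curvature \<alpha> * ((\<Sum>c\<in>Basis. c \<bullet> factor_proj \<alpha> c) - 2) = 3" if "\<alpha> < 3" for \<alpha>
    proof -
      have "(\<Sum>c\<in>Basis. c \<bullet> factor_proj \<alpha> c) - 2 = factor_dim \<alpha> - 1"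
        using trace_factor_proj[of \<alpha>] by linarith
      moreover have "\<alpha> = 0 \<or> \<alpha> = Suc 0 \<or> \<alpha> = 2" using that by auto
      ultimately show ?thesis by (auto simp: factor_dim_def factor_curvature_def)
    qed
    then show "Ric (induced_metric f) x u v = 3 * induced_metric f x u v"
      unfolding Ric_product[OF x] g_sum sum_distrib_left by (intro sum.cong) auto
  qed
  moreover have "\<not> higher_bach_flat TYPE(real^8) S.sphere_prod"
  proof
    assume flat: "higher_bach_flat TYPE(real^8) S.sphere_prod"
    \<comment> \<open>Flatness would be vacuous without charts. Any point provides one; in this one
      each component is a unit vector scaled to the radius of its sphere.\<close>
    define p :: "(real^3) \<times> (real^3) \<times> (real^5)" where "p = ((1 / sqrt 3) *\<^sub>R axis 1 1, (1 / sqrt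
        3) *\<^sub>R axis 1 1, axis 1 1)"
    have "p \<in> S.sphere_prod"
      unfolding round_sphere_product[symmetric] p_def
      by (simp add: round_sphere_def norm_axis_1)
    then obtain U :: "(real^8) set" and f where f: "local_param S.sphere_prod U f" "p \<in> f ` U"
      using chart by blast
    then obtain x where x: "x \<in> U" by blast
    interpret product_param factor_proj factor_curvature 3 f U using f(1) by (rule param)
    let ?E = "onb (g x)" and ?c = "bach_coeff 3 factor_dim (contract_coeff R4_coeff)
        (projection_coeff 3 factor_dim R4_coeff)"
    have frame: "adapted_frame 3 (factor_metric x) factor_dim ?E"
      using adapted_frame_onb[OF x] unfolding dims .
    have "higher_bach g x a b = 0" for a b
      using flat f(1) x unfolding higher_bach_flat_def by blast
    then have 0: "(\<Sum>\<beta><3. ?c \<beta> * factor_metric x \<beta> a b) = 0" for a b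
      using higher_bach_product[OF x, of a b] unfolding dims by simp
    \<comment> \<open>Pairing with the metric of the first surface removes the other coefficients by
      the composition rule. The trace 2 of that metric then gives 2 * 432/5.\<close>
    have "0 = (\<Sum>a\<in>?E. \<Sum>b\<in>?E. (\<Sum>\<beta><3. ?c \<beta> * factor_metric x \<beta> a b) * factor_metric x 0 b a)"
      by (simp add: 0)
    also have "\<dots> = (\<Sum>a\<in>?E. \<Sum>\<beta><3. ?c \<beta> * (\<Sum>b\<in>?E. factor_metric x \<beta> a b * factor_metric x 0 b a))"
      unfolding sum_distrib_right sum_distrib_left mult.assoc by (rule sum.cong[OF refl], rule
          sum.swap)
    also have "\<dots> = (\<Sum>a\<in>?E. \<Sum>\<beta><3. ?c \<beta> * (if \<beta> = 0 then factor_metric x 0 a a else 0))"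
      using frame by (intro sum.cong refl) (auto simp: adapted_frame_def)
    also have "\<dots> = ?c 0 * (\<Sum>a\<in>?E. factor_metric x 0 a a)"
      by (simp add: sum_lessThan_3 sum_distrib_left)
    also have "\<dots> = 864 / 5"
      using frame by (simp add: adapted_frame_def bach_coeff_0 factor_dim_def)
    finally show False by simp
  qed
  moreover have "submanifold TYPE(real^8) S.sphere_prod"
    unfolding submanifold_def using chart by blast
  ultimately show ?thesis
    unfolding Let_def round_sphere_product by blast
qed

end
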